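(* Let $K$ be a field. The set of quivers of finite multiplicative type over $K$ is minor closed; that is, if $Q$ is a quiver of finite multiplicative type over $K$ and $Q'$ is a minor of $Q$, then $Q'$ is of finite multiplicative type over $K$.
   Context: A quiver is a finite directed graph. A representation $V$ of a quiver $Q$ over $K$ assigns a finite-dimensional $K$-vector space $V_x$ to each vertex $x$ and a $K$-linear map $V_a:V_{ta}\to V_{ha}$ to each arrow $a$ with tail $ta$ and head $ha$. Tensor product is pointwise: $(V\otimes W)_x=V_x\otimes W_x$, $(V\otimes W)_a=V_a\otimes W_a$. The representation ring $R(Q)$ is the free abelian group on isomorphism classes of representations of $Q$ over $K$ modulo the subgroup generated by $[V]+[W]-[V\oplus W]$, with product $[V][W]=[V\otimes W]$; its identity is the class of the representation with $K$ at every vertex and the identity map at every arrow. $R(Q)_{red}$ is $R(Q)$ modulo its ideal of nilpotent elements. $Q$ is of finite multiplicative type over $K$ if $R(Q)_{red}$ is a finitely generated $\mathbb Z$-module. A minor of $Q$ is any quiver obtained from $Q$ by contracting edges and removing any combination of vertices and edges. *)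

theory Defs
  imports
    "HOL-Algebra.Free_Abelian_Groups"
    "HOL-Algebra.QuotRing"
    "HOL-Algebra.Generated_Groups"
    "Jordan_Normal_Form.Missing_VectorSpace"
    "Graph_Theory.Digraph_Isomorphism"
begin

section \<open>Quivers and their minors\<close>

text \<open>
  A quiver is a \<^term>\<open>Q\<close> with \<^prop>\<open>fin_digraph Q\<close>: a finite directed graph,
  loops and multiple arrows allowed.
\<close>

text \<open>
  Contracting an arrow deletes it and identifies its head with its tail; the tail is kept
  as the name of the merged vertex.  For a loop this is the same as deleting the loop.
\<close>

definition contract_arc :: "('v, 'a) pre_digraph \<Rightarrow> 'a \<Rightarrow> ('v, 'a) pre_digraph" where
  "contract_arc Q e =
    (let merge = (\<lambda>x. if x = head Q e then tail Q e else x)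
     in \<lparr>verts = merge ` verts Q, arcs = arcs Q - {e},
         tail = merge \<circ> tail Q, head = merge \<circ> head Q\<rparr>)"

inductive minor_sequence :: "('v, 'a) pre_digraph \<Rightarrow> ('v, 'a) pre_digraph \<Rightarrow> bool"
  for Q :: "('v, 'a) pre_digraph" where
  start: "minor_sequence Q Q"
| remove_vertex: "minor_sequence Q P \<Longrightarrow> x \<in> verts P \<Longrightarrow> minor_sequence Q (pre_digraph.del_vert P x)"
| remove_arrow: "minor_sequence Q P \<Longrightarrow> e \<in> arcs P \<Longrightarrow> minor_sequence Q (pre_digraph.del_arc P e)"
| contract_arrow: "minor_sequence Q P \<Longrightarrow> e \<in> arcs P \<Longrightarrow> minor_sequence Q (contract_arc P e)"

text \<open>
  Closing under isomorphism makes the choice of name for a merged vertex immaterial, and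
  lets the minor live on other vertex and arrow types.
\<close>

definition quiver_minor :: "('w, 'b) pre_digraph \<Rightarrow> ('v, 'a) pre_digraph \<Rightarrow> bool" where
  "quiver_minor Q' Q \<longleftrightarrow> (\<exists>P. minor_sequence Q P \<and> digraph_iso P Q')"


section \<open>Representations\<close>

record ('v, 'a, 'k, 'u) quiver_rep =
  space :: "'v \<Rightarrow> ('k, 'u) module"
  arrow_map :: "'a \<Rightarrow> 'u \<Rightarrow> 'u"

text \<open>
  Only the values at vertices and arrows of the quiver, and of the maps on the carriers of
  the spaces, are meaningful.
\<close>

definition is_rep :: "'k ring \<Rightarrow> ('v, 'a) pre_digraph \<Rightarrow> ('v, 'a, 'k, 'u) quiver_rep \<Rightarrow> bool" where
  "is_rep K Q V \<longleftrightarrow>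
    (\<forall>x \<in> verts Q. vectorspace K (space V x) \<and> vectorspace.fin_dim K (space V x)) \<and>
    (\<forall>a \<in> arcs Q. linear_map K (space V (tail Q a)) (space V (head Q a)) (arrow_map V a))"

definition rep_iso :: "'k ring \<Rightarrow> ('v, 'a) pre_digraph \<Rightarrow>
    ('v, 'a, 'k, 'u) quiver_rep \<Rightarrow> ('v, 'a, 'k, 'w) quiver_rep \<Rightarrow> bool" where
  "rep_iso K Q V W \<longleftrightarrow> (\<exists>\<phi>.
    (\<forall>x \<in> verts Q. linear_map K (space V x) (space W x) (\<phi> x) \<and>
       bij_betw (\<phi> x) (carrier (space V x)) (carrier (space W x))) \<and>
    (\<forall>a \<in> arcs Q. \<forall>v \<in> carrier (space V (tail Q a)).
       \<phi> (head Q a) (arrow_map V a v) = arrow_map W a (\<phi> (tail Q a) v)))"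

definition rep_sum ::
    "('v, 'a, 'k, 'u) quiver_rep \<Rightarrow> ('v, 'a, 'k, 'w) quiver_rep \<Rightarrow> ('v, 'a, 'k, 'u \<times> 'w) quiver_rep" where
  "rep_sum V W = \<lparr>space = (\<lambda>x. direct_sum (space V x) (space W x)),
     arrow_map = (\<lambda>a. map_prod (arrow_map V a) (arrow_map W a))\<rparr>"

text \<open>The ring multiplication and unit in the record are not part of the vector space structure.\<close>

definition self_space :: "'k ring \<Rightarrow> ('k, 'k) module" where
  "self_space K = \<lparr>carrier = carrier K, monoid.mult = (\<otimes>\<^bsub>K\<^esub>), one = \<one>\<^bsub>K\<^esub>,
     zero = \<zero>\<^bsub>K\<^esub>, add = (\<oplus>\<^bsub>K\<^esub>), smult = (\<otimes>\<^bsub>K\<^esub>)\<rparr>"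

definition unit_rep :: "'k ring \<Rightarrow> ('v, 'a, 'k, 'k) quiver_rep" where
  "unit_rep K = \<lparr>space = (\<lambda>_. self_space K), arrow_map = (\<lambda>_. id)\<rparr>"


section \<open>Tensor products\<close>

definition bilinear_map :: "'k ring \<Rightarrow> ('k, 'u) module \<Rightarrow> ('k, 'w) module \<Rightarrow> ('k, 't) module \<Rightarrow>
    ('u \<Rightarrow> 'w \<Rightarrow> 't) \<Rightarrow> bool" where
  "bilinear_map K V W M \<beta> \<longleftrightarrow>
    (\<forall>v \<in> carrier V. linear_map K W M (\<beta> v)) \<and>
    (\<forall>w \<in> carrier W. linear_map K V M (\<lambda>v. \<beta> v w))"

text \<open>
  \<^term>\<open>T\<close> together with the bilinear map \<^term>\<open>\<tau>\<close> is a tensor product of \<^term>\<open>V\<close>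
  and \<^term>\<open>W\<close>: every bilinear map factors through \<^term>\<open>\<tau>\<close> by a unique linear map.
  Being \<^const>\<open>extensional\<close> is what makes a linear map that matters only on the carrier
  unique as a HOL function.
\<close>

definition is_tensor_product :: "'k ring \<Rightarrow> ('k, 'u) module \<Rightarrow> ('k, 'w) module \<Rightarrow> ('k, 't) module \<Rightarrow>
    ('u \<Rightarrow> 'w \<Rightarrow> 't) \<Rightarrow> bool" where
  "is_tensor_product K V W T \<tau> \<longleftrightarrow> bilinear_map K V W T \<tau> \<and>
    (\<forall>(M :: ('k, 't) module) \<beta>. vectorspace K M \<and> bilinear_map K V W M \<beta> \<longrightarrow>
      (\<exists>!\<phi>. \<phi> \<in> extensional (carrier T) \<and> linear_map K T M \<phi> \<and>
        (\<forall>v \<in> carrier V. \<forall>w \<in> carrier W. \<phi> (\<tau> v w) = \<beta> v w)))"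

text \<open>
  \<^term>\<open>T\<close> is the pointwise tensor product of \<^term>\<open>V\<close> and \<^term>\<open>W\<close>; the second
  condition says that the arrow \<^term>\<open>a\<close> acts on \<^term>\<open>T\<close> by the tensor product of
  its actions on \<^term>\<open>V\<close> and \<^term>\<open>W\<close>.
\<close>

definition is_rep_tensor :: "'k ring \<Rightarrow> ('v, 'a) pre_digraph \<Rightarrow> ('v, 'a, 'k, 'u) quiver_rep \<Rightarrow>
    ('v, 'a, 'k, 'w) quiver_rep \<Rightarrow> ('v, 'a, 'k, 't) quiver_rep \<Rightarrow> bool" where
  "is_rep_tensor K Q V W T \<longleftrightarrow> is_rep K Q T \<and> (\<exists>\<tau>.
    (\<forall>x \<in> verts Q. is_tensor_product K (space V x) (space W x) (space T x) (\<tau> x)) \<and>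
    (\<forall>a \<in> arcs Q. \<forall>v \<in> carrier (space V (tail Q a)). \<forall>w \<in> carrier (space W (tail Q a)).
       arrow_map T a (\<tau> (tail Q a) v w) =
       \<tau> (head Q a) (arrow_map V a v) (arrow_map W a w)))"


section \<open>The representation ring\<close>

text \<open>
  To have a set of all isomorphism classes, the elements of the spaces are drawn from one
  type.  \<^typ>\<open>'k list\<close> is large enough: it contains the lists of length \<open>n\<close> over
  \<^term>\<open>carrier K\<close> for every \<open>n\<close>, so it carries a copy of every finite-dimensional
  \<^term>\<open>K\<close>-vector space.  The carriers and operations of the spaces are arbitrary.
\<close>

type_synonym ('v, 'a, 'k) std_rep = "('v, 'a, 'k, 'k list) quiver_rep"

definition rep_class :: "'k ring \<Rightarrow> ('v, 'a) pre_digraph \<Rightarrow> ('v, 'a, 'k, 'u) quiver_rep \<Rightarrow>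
    ('v, 'a, 'k) std_rep set" where
  "rep_class K Q V = {Z. is_rep K Q Z \<and> rep_iso K Q Z V}"

definition iso_classes :: "'k ring \<Rightarrow> ('v, 'a) pre_digraph \<Rightarrow> ('v, 'a, 'k) std_rep set set" where
  "iso_classes K Q = rep_class K Q ` {V :: ('v, 'a, 'k) std_rep. is_rep K Q V}"

definition class_sum :: "'k ring \<Rightarrow> ('v, 'a) pre_digraph \<Rightarrow>
    ('v, 'a, 'k) std_rep set \<Rightarrow> ('v, 'a, 'k) std_rep set \<Rightarrow> ('v, 'a, 'k) std_rep set" where
  "class_sum K Q A B = (\<Union>V \<in> A. \<Union>W \<in> B. rep_class K Q (rep_sum V W))"

definition class_tensor :: "'k ring \<Rightarrow> ('v, 'a) pre_digraph \<Rightarrow>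
    ('v, 'a, 'k) std_rep set \<Rightarrow> ('v, 'a, 'k) std_rep set \<Rightarrow> ('v, 'a, 'k) std_rep set" where
  "class_tensor K Q A B = {Z. \<exists>V \<in> A. \<exists>W \<in> B. is_rep_tensor K Q V W Z}"

text \<open>
  The free abelian group on the isomorphism classes, with the bilinear extension of the
  tensor product of classes.
\<close>

definition free_rep_ring ::
    "'k ring \<Rightarrow> ('v, 'a) pre_digraph \<Rightarrow> (('v, 'a, 'k) std_rep set \<Rightarrow>\<^sub>0 int) ring" where
  "free_rep_ring K Q =
    \<lparr>carrier = carrier (free_Abelian_group (iso_classes K Q)),
     monoid.mult = (\<lambda>f g. frag_extend (\<lambda>A. frag_extend (\<lambda>B. frag_of (class_tensor K Q A B)) g) f),
     one = frag_of (rep_class K Q (unit_rep K)),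
     zero = 0,
     add = (+)\<rparr>"

definition sum_relations ::
    "'k ring \<Rightarrow> ('v, 'a) pre_digraph \<Rightarrow> (('v, 'a, 'k) std_rep set \<Rightarrow>\<^sub>0 int) set" where
  "sum_relations K Q = {frag_of A + frag_of B - frag_of (class_sum K Q A B) | A B.
     A \<in> iso_classes K Q \<and> B \<in> iso_classes K Q}"

definition rep_ring ::
    "'k ring \<Rightarrow> ('v, 'a) pre_digraph \<Rightarrow> (('v, 'a, 'k) std_rep set \<Rightarrow>\<^sub>0 int) set ring" where
  "rep_ring K Q =
    free_rep_ring K Q Quot generate (add_monoid (free_rep_ring K Q)) (sum_relations K Q)"

definition nilpotents :: "'r ring \<Rightarrow> 'r set" where
  "nilpotents R = {r \<in> carrier R. \<exists>n::nat. r [^]\<^bsub>R\<^esub> n = \<zero>\<^bsub>R\<^esub>}"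

definition reduced_ring :: "'r ring \<Rightarrow> 'r set ring" where
  "reduced_ring R = R Quot nilpotents R"

definition finite_multiplicative_type :: "'k ring \<Rightarrow> ('v, 'a) pre_digraph \<Rightarrow> bool" where
  "finite_multiplicative_type K Q \<longleftrightarrow>
    (let R = reduced_ring (rep_ring K Q)
     in \<exists>S. finite S \<and> S \<subseteq> carrier R \<and> generate (add_monoid R) S = carrier R)"

end

theory Submission
  imports Defs
begin

text \<open>
  The isomorphism classes of representations of \<open>Q\<close> carry a commutative
  multiplication (tensor product), and \<open>R(Q)\<close> is the quotient of the free abelian
  group \<open>A\<close> on the classes by the ideal \<open>I\<close> of additivity relations.
  The nilpotent elements of \<open>A / I\<close> are the image of the radical of
  \<open>I\<close>, so \<open>Q\<close> is of finite multiplicative type exactly when finitely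
  many elements of \<open>A\<close> together with the radical generate \<open>A\<close> as a
  group (\<open>finite_multiplicative_type_iff\<close>). This condition travels along maps
  between the sets of classes in two ways. A surjection that respects unit, sums and products
  carries it to its target (\<open>finite_mod_radical_surjective_class_hom\<close>). If a map
  respecting unit and products has a left inverse that respects sums, the condition passes
  from the target to the source (\<open>finite_mod_radical_split_class_hom\<close>): the left
  inverse shows that an element is in the ideal as soon as its image is, so the reduced ring
  of the source is as a group a quotient of a subgroup of that of the target, and subgroups of
  finitely generated abelian groups are finitely generated.

  Both kinds of maps come from maps of quivers \<open>P \<rightarrow> Q\<close> that send an
  arrow to an arrow or collapse it to a vertex: representations of \<open>Q\<close> pull back
  to representations of \<open>P\<close>, a collapsed arrow acting by the identity, and
  pulling back commutes with direct sums, tensor products and the unit. For a subquiver of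
  \<open>Q\<close> pulling back is restriction, and it is surjective since every
  representation of the subquiver extends by zero. This settles the removal of vertices and
  arrows. For an isomorphism of quivers it is surjective as well, and contracting a loop is
  the same as removing it.

  The contraction of an arrow \<open>e\<close> from \<open>t\<close> to a different vertex
  \<open>h\<close> is the main case. The map of quivers from \<open>Q\<close> to
  \<open>Q/e\<close> pulls a representation of \<open>Q/e\<close> back to one of
  \<open>Q\<close> in which \<open>e\<close> acts by the identity. An additive left inverse is
  obtained by forcing \<open>e\<close> to become invertible. In a representation
  \<open>Z\<close> of \<open>Q\<close>, let \<open>M\<close> be the largest subrepresentation
  in which every vector at \<open>h\<close> has a preimage under \<open>e\<close>
  (\<open>divisible\<close>), and let \<open>N\<close> be the smallest subrepresentation of
  \<open>M\<close> that contains a vector of \<open>M\<close> at \<open>t\<close> whenever it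
  contains its image under \<open>e\<close> (\<open>vanishing\<close>). The arrow
  \<open>e\<close> acts bijectively on \<open>M/N\<close>, so \<open>M/N\<close> is, up to
  isomorphism, the pull-back of a representation of \<open>Q/e\<close>, unique up to
  isomorphism. Morphisms of representations preserve \<open>M\<close> and \<open>N\<close>;
  applied to the projections and inclusions of a direct sum this shows that the construction
  is additive. If \<open>e\<close> already acts by the identity then \<open>M\<close> is
  everything and \<open>N\<close> is zero, so the construction undoes the pull-back.
\<close>

section \<open>Radicals and the reduced quotient of a ring\<close>

definition radical :: "('r, 'm) ring_scheme \<Rightarrow> 'r set \<Rightarrow> 'r set" where
  "radical R I = {x \<in> carrier R. \<exists>n::nat. x [^]\<^bsub>R\<^esub> n \<in> I}"

text \<open>
  Splitting one factor \<open>x \<oplus> y\<close> off the power and moving \<open>x\<close>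
  or \<open>y\<close> into \<open>z\<close> lowers one of the two exponents, which makes an
  induction on \<open>n + m\<close> possible. The case \<open>z = \<one>\<close> shows that
  the radical is closed under addition.
\<close>

lemma (in cring) add_pow_mult_in_ideal:
  fixes n m :: nat
  assumes "ideal I R" "x \<in> carrier R" "y \<in> carrier R"
  shows "z \<in> carrier R \<Longrightarrow> x [^] n \<otimes> z \<in> I \<Longrightarrow> y [^] m \<otimes> z \<in> I \<Longrightarrow>
    (x \<oplus> y) [^] (n + m) \<otimes> z \<in> I"
proof (induction "n + m" arbitrary: n m z)
  interpret ideal I R by fact
  case 0
  then show ?case by simp
next
  interpret I: ideal I R by fact
  case (Suc k)
  show ?case
  proof (cases "n = 0 \<or> m = 0")
    case True
    then have "z \<in> I" using Suc.prems assms by auto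
    then show ?thesis using assms Suc.prems by (intro I.I_l_closed) auto
  next
    case False
    then obtain n' m' where nm: "n = Suc n'" "m = Suc m'" by (metis not0_implies_Suc)
    have x: "(x \<oplus> y) [^] (n' + m) \<otimes> (x \<otimes> z) \<in> I"
    proof (rule Suc.hyps(1))
      show "k = n' + m" using Suc.hyps(2) nm by simp
      show "x \<otimes> z \<in> carrier R" using assms Suc.prems by simp
      show "x [^] n' \<otimes> (x \<otimes> z) \<in> I"
        using Suc.prems(2) assms Suc.prems(1) nm by (simp add: m_assoc)
      have "y [^] m \<otimes> (x \<otimes> z) = x \<otimes> (y [^] m \<otimes> z)"
        using assms Suc.prems(1) by (simp add: m_lcomm)
      then show "y [^] m \<otimes> (x \<otimes> z) \<in> I" using Suc.prems assms I.I_l_closed by metis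
    qed
    have y: "(x \<oplus> y) [^] (n + m') \<otimes> (y \<otimes> z) \<in> I"
    proof (rule Suc.hyps(1))
      show "k = n + m'" using Suc.hyps(2) nm by simp
      show "y \<otimes> z \<in> carrier R" using assms Suc.prems by simp
      show "y [^] m' \<otimes> (y \<otimes> z) \<in> I"
        using Suc.prems(3) assms Suc.prems(1) nm by (simp add: m_assoc)
      have "x [^] n \<otimes> (y \<otimes> z) = y \<otimes> (x [^] n \<otimes> z)"
        using assms Suc.prems(1) by (simp add: m_lcomm)
      then show "x [^] n \<otimes> (y \<otimes> z) \<in> I" using Suc.prems assms I.I_l_closed by metis
    qed
    have e: "n' + m = n + m'" "n + m = Suc (n + m')" using nm by auto
    have "(x \<oplus> y) [^] (n + m) \<otimes> z
        = (x \<oplus> y) [^] (n + m') \<otimes> (x \<otimes> z) \<oplus> (x \<oplus> y) [^] (n + m') \<otimes> (y \<otimes> z)"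
      unfolding e(2) nat_pow_Suc using assms Suc.prems(1)
      by (simp add: m_assoc l_distr r_distr)
    also have "\<dots> \<in> I" using x y unfolding e(1) by (rule I.a_closed)
    finally show ?thesis .
  qed
qed

lemma (in cring) ideal_radical:
  assumes "ideal I R"
  shows "ideal (radical R I) R"
proof -
  interpret I: ideal I R by fact
  have sub: "radical R I \<subseteq> carrier R" unfolding radical_def by auto
  have mult: "a \<otimes> x \<in> radical R I" if "x \<in> radical R I" "a \<in> carrier R" for a x
    using that unfolding radical_def by (auto simp: nat_pow_distrib intro: I.I_l_closed)
  have zero: "\<zero> \<in> radical R I"
    unfolding radical_def by (auto intro!: exI[of _ "1::nat"])
  have add: "x \<oplus> y \<in> radical R I" if xy: "x \<in> radical R I" "y \<in> radical R I" for x y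
  proof -
    obtain n m :: nat where "x [^] n \<in> I" "y [^] m \<in> I" "x \<in> carrier R" "y \<in> carrier R"
      using xy unfolding radical_def by auto
    then have "(x \<oplus> y) [^] (n + m) \<otimes> \<one> \<in> I"
      by (intro add_pow_mult_in_ideal[OF assms]) auto
    then show ?thesis using xy unfolding radical_def by auto
  qed
  have neg: "\<ominus> x \<in> radical R I" if "x \<in> radical R I" for x
  proof -
    have "\<ominus> x = (\<ominus> \<one>) \<otimes> x" using that sub by (auto simp: l_minus)
    then show ?thesis using mult[OF that, of "\<ominus> \<one>"] by simp
  qed
  show ?thesis
  proof (rule idealI[OF ring_axioms])
    show "subgroup (radical R I) (add_monoid R)"
      using sub zero add neg by (intro subgroup.intro) (auto simp: a_inv_def[symmetric])
    show "a \<otimes> x \<in> radical R I" "x \<otimes> a \<in> radical R I"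
      if "x \<in> radical R I" "a \<in> carrier R" for a x
      using mult[OF that] m_comm[of x a] that sub by auto
  qed
qed

lemma (in ideal) rcos_eq_zero_iff:
  assumes "y \<in> carrier R"
  shows "I +> y = \<zero>\<^bsub>R Quot I\<^esub> \<longleftrightarrow> y \<in> I"
proof -
  have "\<zero>\<^bsub>R Quot I\<^esub> = I" by (simp add: FactRing_def)
  then show ?thesis
    using rcos_const_imp_mem[OF assms] a_rcos_zero[OF ideal_axioms, of y] by blast
qed

text \<open>
  Finite generation of the quotient of \<open>R\<close> by the radical of \<open>I\<close> as
  an abelian group, expressed inside \<open>R\<close>.
\<close>

definition finite_mod_radical :: "('r, 'm) ring_scheme \<Rightarrow> 'r set \<Rightarrow> bool" where
  "finite_mod_radical R I \<longleftrightarrow> (\<exists>S. finite S \<and> S \<subseteq> carrier R \<and>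
     generate (add_monoid R) (S \<union> radical R I) = carrier R)"

text \<open>
  The composite of the two quotient maps is a surjection of \<open>R\<close> onto the reduced
  ring of \<open>R / I\<close> whose kernel is the radical of \<open>I\<close>, since a power
  of a coset vanishes in \<open>R / I\<close> exactly when the power of a representative is in
  \<open>I\<close>.
\<close>

lemma (in cring) reduced_ring_quotient_hom:
  assumes "ideal I R"
    and h_def: "h = (\<lambda>x. nilpotents (R Quot I) +>\<^bsub>R Quot I\<^esub> (I +>\<^bsub>R\<^esub> x))"
  shows "ring_hom_ring R (reduced_ring (R Quot I)) h"
    and "h ` carrier R = carrier (reduced_ring (R Quot I))"
    and "\<And>x. x \<in> carrier R \<Longrightarrow> h x = \<zero>\<^bsub>reduced_ring (R Quot I)\<^esub> \<longleftrightarrow> x \<in> radical R I"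
proof -
  interpret I: ideal I R by fact
  interpret Q: cring "R Quot I" using I.quotient_is_cring cring_axioms by simp
  have nil: "nilpotents (R Quot I) = radical (R Quot I) {\<zero>\<^bsub>R Quot I\<^esub>}"
    unfolding nilpotents_def radical_def by simp
  interpret N: ideal "nilpotents (R Quot I)" "R Quot I"
    unfolding nil by (intro Q.ideal_radical Q.zeroideal)
  interpret p: ring_hom_ring R "R Quot I" "(+>) I" by (rule I.rcos_ring_hom_ring)
  interpret q: ring_hom_ring "R Quot I" "R Quot I Quot nilpotents (R Quot I)"
    "(+>\<^bsub>R Quot I\<^esub>) (nilpotents (R Quot I))" by (rule N.rcos_ring_hom_ring)
  have h: "h = (+>\<^bsub>R Quot I\<^esub>) (nilpotents (R Quot I)) \<circ> (+>) I"
    unfolding h_def by auto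
  show "ring_hom_ring R (reduced_ring (R Quot I)) h"
    unfolding reduced_ring_def h
    by (intro ring_hom_ringI2 ring_hom_trans[OF I.rcos_ring_hom N.rcos_ring_hom] ring_axioms
        N.quotient_is_ring)
  have "(+>) I ` carrier R = carrier (R Quot I)"
    "(+>\<^bsub>R Quot I\<^esub>) (nilpotents (R Quot I)) ` carrier (R Quot I)
      = carrier (R Quot I Quot nilpotents (R Quot I))"
    by (auto simp: FactRing_def A_RCOSETS_def' a_r_coset_def' r_coset_def)
  moreover have "h ` carrier R = (+>\<^bsub>R Quot I\<^esub>) (nilpotents (R Quot I)) ` ((+>) I ` carrier R)"
    unfolding h_def by (rule image_image[symmetric])
  ultimately show "h ` carrier R = carrier (reduced_ring (R Quot I))"
    unfolding reduced_ring_def by simp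
  fix x assume x: "x \<in> carrier R"
  have "h x = \<zero>\<^bsub>reduced_ring (R Quot I)\<^esub> \<longleftrightarrow> I +> x \<in> nilpotents (R Quot I)"
    unfolding h_def reduced_ring_def by (rule N.rcos_eq_zero_iff[OF p.hom_closed[OF x]])
  also have "\<dots> \<longleftrightarrow> (\<exists>n::nat. I +> (x [^] n) = \<zero>\<^bsub>R Quot I\<^esub>)"
    unfolding nilpotents_def using p.hom_closed[OF x] p.hom_nat_pow[OF x] by simp
  also have "\<dots> \<longleftrightarrow> x \<in> radical R I"
    unfolding radical_def using I.rcos_eq_zero_iff[OF nat_pow_closed[OF x]] x by simp
  finally show "h x = \<zero>\<^bsub>reduced_ring (R Quot I)\<^esub> \<longleftrightarrow> x \<in> radical R I" .
qed

lemma (in cring) reduced_quotient_fin_gen_iff: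
  assumes "ideal I R"
  shows "(\<exists>S. finite S \<and> S \<subseteq> carrier (reduced_ring (R Quot I)) \<and>
      generate (add_monoid (reduced_ring (R Quot I))) S = carrier (reduced_ring (R Quot I)))
    \<longleftrightarrow> finite_mod_radical R I" (is "?lhs \<longleftrightarrow> ?rhs")
proof -
  interpret J: ideal "radical R I" R using assms by (rule ideal_radical)
  let ?Q = "reduced_ring (R Quot I)"
  define h where "h = (\<lambda>x. nilpotents (R Quot I) +>\<^bsub>R Quot I\<^esub> (I +>\<^bsub>R\<^esub> x))"
  note hp = reduced_ring_quotient_hom[OF assms h_def]
  interpret h: ring_hom_ring R ?Q h by (rule hp(1))
  interpret g: group_hom "add_monoid R" "add_monoid ?Q" h by (rule h.a_group_hom)
  have img: "generate (add_monoid ?Q) (h ` S) = h ` generate (add_monoid R) S"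
    if "S \<subseteq> carrier R" for S using g.generate_img[of S] that by simp
  show ?thesis
  proof
    assume ?lhs
    then obtain T where T: "finite T" "T \<subseteq> h ` carrier R"
      "generate (add_monoid ?Q) T = carrier ?Q" using hp(2) by auto
    then obtain S where S: "finite S" "S \<subseteq> carrier R" "T = h ` S"
      by (metis finite_subset_image)
    have "x \<in> generate (add_monoid R) (S \<union> radical R I)" if x: "x \<in> carrier R" for x
    proof -
      have "h x \<in> h ` generate (add_monoid R) S" using x hp(2) T(3) S img by auto
      then obtain s where s: "s \<in> generate (add_monoid R) S" "h x = h s" by auto
      have sc: "s \<in> carrier R" using s(1) add.generate_in_carrier S(2) by auto
      have "h (x \<ominus> s) = \<zero>\<^bsub>?Q\<^esub>" using x sc s(2) by (simp add: a_minus_def h.S.r_neg)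
      then have "x \<ominus> s \<in> radical R I" using hp(3) x sc by simp
      then have "x \<ominus> s \<in> generate (add_monoid R) (S \<union> radical R I)" by (auto intro: generate.incl)
      moreover have "s \<in> generate (add_monoid R) (S \<union> radical R I)"
        using s(1) add.mono_generate[of S "S \<union> radical R I"] by blast
      ultimately have "(x \<ominus> s) \<oplus> s \<in> generate (add_monoid R) (S \<union> radical R I)"
        using generate.eng[of "x \<ominus> s" "add_monoid R" _ s] by simp
      then show ?thesis using x sc by (simp add: a_minus_def a_assoc l_neg)
    qed
    then show ?rhs unfolding finite_mod_radical_def
      using S J.a_subset add.generate_in_carrier[of "S \<union> radical R I"] by (intro exI[of _ S]) auto
  next
    assume ?rhs
    then obtain S where S: "finite S" "S \<subseteq> carrier R"
      "generate (add_monoid R) (S \<union> radical R I) = carrier R"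
      unfolding finite_mod_radical_def by blast
    have "h x = \<zero>\<^bsub>?Q\<^esub>" if "x \<in> radical R I" for x using that hp(3) J.a_subset by blast
    then have "h ` radical R I = {\<zero>\<^bsub>?Q\<^esub>}" using J.zero_closed by (simp add: image_constant[OF J.zero_closed] cong: image_cong)
    moreover have "generate (add_monoid ?Q) (h ` (S \<union> radical R I)) = carrier ?Q"
      using img[of "S \<union> radical R I"] S J.a_subset hp(2) by simp
    ultimately have "generate (add_monoid ?Q) (insert \<zero>\<^bsub>?Q\<^esub> (h ` S)) = carrier ?Q"
      by (simp add: image_Un)
    then show ?lhs using S by (intro exI[of _ "insert \<zero>\<^bsub>?Q\<^esub> (h ` S)"]) auto
  qed
qed

text \<open>
  Images of generators generate: a homomorphism that maps \<open>I\<close> into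
  \<open>I'\<close> also maps the radical of \<open>I\<close> into that of \<open>I'\<close>.
\<close>

lemma finite_mod_radical_surj:
  assumes "cring R" "ideal I R" "cring R'" "ideal I' R'" "h \<in> ring_hom R R'"
    and "h ` carrier R = carrier R'" "h ` I \<subseteq> I'" "finite_mod_radical R I"
  shows "finite_mod_radical R' I'"
proof -
  interpret R: cring R by fact
  interpret R': cring R' by fact
  interpret h: ring_hom_ring R R' h using assms by (intro ring_hom_ringI2 R.ring_axioms R'.ring_axioms)
  interpret g: group_hom "add_monoid R" "add_monoid R'" h by (rule h.a_group_hom)
  interpret J: ideal "radical R I" R using assms(2) by (rule R.ideal_radical)
  interpret J': ideal "radical R' I'" R' using assms(4) by (rule R'.ideal_radical)
  obtain S where S: "finite S" "S \<subseteq> carrier R"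
    "generate (add_monoid R) (S \<union> radical R I) = carrier R"
    using assms(8) unfolding finite_mod_radical_def by blast
  have "h x \<in> radical R' I'" if x: "x \<in> radical R I" for x
  proof -
    obtain n :: nat where n: "x \<in> carrier R" "x [^]\<^bsub>R\<^esub> n \<in> I" using x unfolding radical_def by auto
    then have "h x [^]\<^bsub>R'\<^esub> n \<in> I'" using assms(7) h.hom_nat_pow[OF n(1), of n] by (metis image_subset_iff)
    then show ?thesis using h.hom_closed[OF n(1)] unfolding radical_def by blast
  qed
  then have sub: "h ` (S \<union> radical R I) \<subseteq> h ` S \<union> radical R' I'" by blast
  have "S \<union> radical R I \<subseteq> carrier (add_monoid R)" using S(2) J.a_subset by (auto simp del: Un_subset_iff)
  then have "carrier R' = generate (add_monoid R') (h ` (S \<union> radical R I))"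
    unfolding g.generate_img[OF \<open>S \<union> radical R I \<subseteq> carrier (add_monoid R)\<close>] S(3)
    by (rule_tac assms(6)[symmetric])
  also have "\<dots> \<subseteq> generate (add_monoid R') (h ` S \<union> radical R' I')"
    by (rule R'.add.mono_generate[OF sub])
  finally have le: "carrier R' \<subseteq> generate (add_monoid R') (h ` S \<union> radical R' I')" .
  have hS: "h ` S \<subseteq> carrier R'" using S(2) by auto
  have "radical R' I' \<subseteq> carrier R'" by (rule J'.a_subset)
  then have "h ` S \<union> radical R' I' \<subseteq> carrier R'" using hS by (rule_tac Un_least)
  then have "generate (add_monoid R') (h ` S \<union> radical R' I') \<subseteq> carrier R'"
    by (rule R'.add.generate_incl)
  then have "generate (add_monoid R') (h ` S \<union> radical R' I') = carrier R'"
    using le by (rule equalityI)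
  then show ?thesis unfolding finite_mod_radical_def using finite_imageI[OF S(1), of h] hS by iprover
qed

section \<open>Subgroups of finitely generated abelian groups\<close>

lemma (in comm_group) mem_generate_insert_subgroupE:
  assumes K: "subgroup K G" and a: "a \<in> carrier G" and x: "x \<in> generate G (insert a K)"
  obtains n :: int and k where "k \<in> K" "x = a [^] n \<otimes> k"
proof -
  have Kc: "K \<subseteq> carrier G" using K by (rule subgroup.subset)
  have "\<exists>n::int. \<exists>k \<in> K. x = a [^] n \<otimes> k"
    using x
  proof (induction rule: generate.induct)
    case one
    show ?case using subgroup.one_closed[OF K] a by (intro exI[of _ 0] bexI[of _ \<one>]) auto
  next
    case (incl h)
    show ?case
    proof (cases "h \<in> K")
      case True
      then show ?thesis using Kc by (intro exI[of _ 0] bexI[of _ h]) auto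
    next
      case False
      then show ?thesis using incl subgroup.one_closed[OF K] a
        by (intro exI[of _ 1] bexI[of _ \<one>]) (auto simp: int_pow_1)
    qed
  next
    case (inv h)
    show ?case
    proof (cases "h \<in> K")
      case True
      then show ?thesis using Kc subgroup.m_inv_closed[OF K True]
        by (intro exI[of _ 0] bexI[of _ "inv h"]) auto
    next
      case False
      then show ?thesis using inv subgroup.one_closed[OF K] a
        by (intro exI[of _ "-1"] bexI[of _ \<one>]) (auto simp: int_pow_neg int_pow_1)
    qed
  next
    case (eng h1 h2)
    then obtain n1 n2 :: int and k1 k2 where k: "k1 \<in> K" "k2 \<in> K"
      "h1 = a [^] n1 \<otimes> k1" "h2 = a [^] n2 \<otimes> k2" by blast
    have "h1 \<otimes> h2 = a [^] (n1 + n2) \<otimes> (k1 \<otimes> k2)"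
      using k Kc a by (simp add: int_pow_mult m_ac subsetD)
    then show ?case using subgroup.m_closed[OF K k(1,2)] by blast
  qed
  then show ?thesis using that by blast
qed

text \<open>
  The integers are Noetherian: a subgroup of an abelian group that is finitely generated
  modulo \<open>J\<close> is again finitely generated modulo \<open>J\<close>. The induction
  adds one generator \<open>a\<close> at a time. The exponents with which \<open>a\<close>
  occurs in elements of \<open>H\<close> are the multiples of one integer \<open>d\<close>,
  and an element of \<open>H\<close> in which \<open>a\<close> occurs with exponent
  \<open>d\<close> generates \<open>H\<close> together with the part of \<open>H\<close> that
  does not involve \<open>a\<close>.
\<close>

lemma (in comm_group) subgroup_fin_gen_over:
  assumes J: "subgroup J G" and "finite S" "S \<subseteq> carrier G"
    and "subgroup H G" "H \<subseteq> generate G (S \<union> J)"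
  shows "\<exists>T. finite T \<and> T \<subseteq> H \<and> H \<subseteq> generate G (T \<union> J)"
  using assms(2-5)
proof (induction S arbitrary: H rule: finite_induct)
  case empty
  then show ?case by (intro exI[of _ "{}"]) auto
next
  case (insert a S)
  have Jc: "J \<subseteq> carrier G" using J by (rule subgroup.subset)
  define K where "K = generate G (S \<union> J)"
  have K: "subgroup K G" unfolding K_def using insert.prems Jc by (intro generate_is_subgroup) auto
  have Kc: "K \<subseteq> carrier G" using K by (rule subgroup.subset)
  have a: "a \<in> carrier G" using insert.prems by auto
  have H: "subgroup H G" by fact
  have Hc: "H \<subseteq> carrier G" using H by (rule subgroup.subset)
  have "S \<union> J \<subseteq> K" unfolding K_def by (auto intro: generate.incl)
  then have "generate G (insert a S \<union> J) \<subseteq> generate G (insert a K)"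
    by (intro mono_generate) auto
  then have decomp: "\<exists>n::int. \<exists>k\<in>K. h = a [^] n \<otimes> k" if "h \<in> H" for h
    using mem_generate_insert_subgroupE[OF K a, of h] insert.prems(3) that by blast
  \<comment> \<open>Exponents with which \<open>a\<close> occurs in elements of \<open>H\<close>; they need
    not be determined by the element.\<close>
  define E where "E = {n::int. \<exists>h\<in>H. \<exists>k\<in>K. h = a [^] n \<otimes> k}"
  have HK: "subgroup (H \<inter> K) G" using subgroups_Inter_pair[OF H K] .
  have ih: "\<exists>T. finite T \<and> T \<subseteq> H \<inter> K \<and> H \<inter> K \<subseteq> generate G (T \<union> J)"
    using insert.IH[OF _ HK] insert.prems unfolding K_def by auto
  then obtain T where T: "finite T" "T \<subseteq> H \<inter> K" "H \<inter> K \<subseteq> generate G (T \<union> J)" by blast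
  have diff: "h \<otimes> inv (h0 [^] q) = a [^] (n - q * d) \<otimes> (k \<otimes> inv (k0 [^] q))"
    if "h = a [^] n \<otimes> k" "h0 = a [^] d \<otimes> k0" "k \<in> K" "k0 \<in> K" for h h0 k k0 and n d q :: int
  proof -
    have "k \<in> carrier G" "k0 \<in> carrier G" using that Kc by auto
    moreover have "h0 [^] q = a [^] (q * d) \<otimes> k0 [^] q"
      using that a calculation by (simp add: int_pow_distrib int_pow_pow mult.commute)
    ultimately show ?thesis using that a
      by (simp add: inv_mult m_ac int_pow_diff)
  qed
  show ?case
  proof (cases "\<exists>n \<in> E. n > 0")
    case False
    have "H \<subseteq> K"
    proof
      fix h assume h: "h \<in> H"
      then obtain n :: int and k where nk: "k \<in> K" "h = a [^] n \<otimes> k" using decomp by blast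
      have "inv h = a [^] (- n) \<otimes> inv k"
        using nk a Kc by (simp add: inv_mult int_pow_neg subsetD)
      then have "n \<in> E" "- n \<in> E" unfolding E_def
        using nk h subgroup.m_inv_closed[OF H h] subgroup.m_inv_closed[OF K nk(1)] by auto
      then have "n = 0" using False by (metis neg_0_less_iff_less linorder_neqE_linordered_idom)
      then show "h \<in> K" using nk Kc by auto
    qed
    then show ?thesis using T by (intro exI[of _ T]) auto
  next
    case True
    then obtain n0 where n0: "n0 \<in> E" "n0 > 0" by blast
    define d where "d = int (LEAST m. m > 0 \<and> int m \<in> E)"
    have "(LEAST m. m > 0 \<and> int m \<in> E) > 0 \<and> int (LEAST m. m > 0 \<and> int m \<in> E) \<in> E"
      by (rule LeastI[of _ "nat n0"]) (use n0 in auto)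
    then have d: "d > 0" "d \<in> E" unfolding d_def by auto
    have least: "r = 0" if "r \<in> E" "0 \<le> r" "r < d" for r
    proof (rule ccontr)
      assume "r \<noteq> 0"
      then have "(LEAST m. m > 0 \<and> int m \<in> E) \<le> nat r"
        using that by (intro Least_le) auto
      then show False using that unfolding d_def by linarith
    qed
    obtain h0 k0 where h0: "h0 \<in> H" "k0 \<in> K" "h0 = a [^] d \<otimes> k0" using d(2) unfolding E_def by blast
    let ?T = "insert h0 T"
    have gen: "subgroup (generate G (?T \<union> J)) G"
      using T(2) h0(1) Hc Jc by (intro generate_is_subgroup) auto
    have "h \<in> generate G (?T \<union> J)" if h: "h \<in> H" for h
    proof -
      obtain n :: int and k where nk: "k \<in> K" "h = a [^] n \<otimes> k" using decomp h by blast
      \<comment> \<open>Division with remainder by the least positive exponent leaves an element of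
        \<open>H\<close> in which \<open>a\<close> no longer occurs.\<close>
      define q where "q = n div d"
      define x where "x = h \<otimes> inv (h0 [^] q)"
      have x: "x = a [^] (n - q * d) \<otimes> (k \<otimes> inv (k0 [^] q))"
        unfolding x_def using nk h0 by (intro diff) auto
      have xH: "x \<in> H" unfolding x_def
        using h h0(1) H by (intro subgroup.m_closed subgroup.m_inv_closed subgroup_int_pow_closed)
      have k': "k \<otimes> inv (k0 [^] q) \<in> K"
        using nk h0(2) K by (intro subgroup.m_closed subgroup.m_inv_closed subgroup_int_pow_closed)
      have "n - q * d \<in> E" unfolding E_def using x xH k' by blast
      moreover have "n - q * d = n mod d" unfolding q_def by (simp add: minus_div_mult_eq_mod)
      ultimately have "n - q * d = 0" using least d(1) by simp
      then have "x \<in> H \<inter> K" using x xH k' Kc by auto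
      then have "x \<in> generate G (?T \<union> J)" using T(3) mono_generate[of "T \<union> J" "?T \<union> J"] by blast
      moreover have "h0 [^] q \<in> generate G (?T \<union> J)"
        using gen by (intro subgroup_int_pow_closed) (auto intro: generate.incl)
      ultimately have "x \<otimes> h0 [^] q \<in> generate G (?T \<union> J)" using subgroup.m_closed[OF gen] by blast
      moreover have "x \<otimes> h0 [^] q = h"
        unfolding x_def using h h0(1) Hc by (simp add: m_assoc subsetD)
      ultimately show ?thesis by simp
    qed
    then show ?thesis using T h0(1) by (intro exI[of _ ?T]) auto
  qed
qed

text \<open>
  If only elements of \<open>I'\<close> are mapped into \<open>I\<close>, then only elements
  of the radical of \<open>I'\<close> are mapped into the radical of \<open>I\<close>. The
  quotient of \<open>R'\<close> by its radical is thus an image of a subgroup of the quotient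
  of \<open>R\<close>, a finitely generated abelian group.
\<close>

lemma finite_mod_radical_reflect:
  assumes "cring R" "ideal I R" "cring R'" "ideal I' R'" "h \<in> ring_hom R' R"
    and "\<And>x. x \<in> carrier R' \<Longrightarrow> h x \<in> I \<Longrightarrow> x \<in> I'" and "finite_mod_radical R I"
  shows "finite_mod_radical R' I'"
proof -
  interpret R: cring R by fact
  interpret R': cring R' by fact
  interpret h: ring_hom_ring R' R h using assms by (intro ring_hom_ringI2 R.ring_axioms R'.ring_axioms)
  interpret J: ideal "radical R I" R using assms(2) by (rule R.ideal_radical)
  interpret J': ideal "radical R' I'" R' using assms(4) by (rule R'.ideal_radical)
  obtain S where S: "finite S" "S \<subseteq> carrier R"
    "generate (add_monoid R) (S \<union> radical R I) = carrier R"
    using assms(7) unfolding finite_mod_radical_def by blast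
  have H: "subgroup (h ` carrier R') (add_monoid R)"
    using h.img_is_add_subgroup[of "carrier R'"] R'.add.subgroup_self by simp
  have "\<exists>T. finite T \<and> T \<subseteq> h ` carrier R' \<and>
      h ` carrier R' \<subseteq> generate (add_monoid R) (T \<union> radical R I)"
    using S H J.a_subgroup by (intro R.add.subgroup_fin_gen_over[of _ S]) auto
  then obtain T' where T': "finite T'" "T' \<subseteq> carrier R'"
    "h ` carrier R' \<subseteq> generate (add_monoid R) (h ` T' \<union> radical R I)"
    by (metis finite_subset_image)
  have refl: "x \<in> radical R' I'" if x: "x \<in> carrier R'" "h x \<in> radical R I" for x
  proof -
    obtain n :: nat where n: "h x [^]\<^bsub>R\<^esub> n \<in> I" using x(2) unfolding radical_def by auto
    then have "h (x [^]\<^bsub>R'\<^esub> n) \<in> I" using h.hom_nat_pow[OF x(1), of n] by simp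
    then show ?thesis using assms(6)[of "x [^]\<^bsub>R'\<^esub> n"] x(1) unfolding radical_def by auto
  qed
  let ?G = "generate (add_monoid R') T'"
  have Gc: "?G \<subseteq> carrier R'" using R'.add.generate_incl[of T'] T' by simp
  \<comment> \<open>The group generated by \<open>h(T')\<close> and the radical is the sum of
    \<open>h(?G)\<close> and the radical.\<close>
  have split: "\<exists>s \<in> ?G. \<exists>j \<in> radical R I. y = h s \<oplus>\<^bsub>R\<^esub> j"
    if "y \<in> generate (add_monoid R) (h ` T' \<union> radical R I)" for y
    using that
  proof (induction rule: generate.induct)
    case one
    then show ?case using J.zero_closed generate.one[of "add_monoid R'" T']
      by (intro bexI[of _ "\<zero>\<^bsub>R'\<^esub>"] bexI[of _ "\<zero>\<^bsub>R\<^esub>"]) auto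
  next
    case (incl y)
    then show ?case
    proof
      assume "y \<in> h ` T'"
      then obtain s where "s \<in> T'" "y = h s" by auto
      then show ?thesis using J.zero_closed generate.incl[of s T' "add_monoid R'"] T'(2)
        by (intro bexI[of _ s] bexI[of _ "\<zero>\<^bsub>R\<^esub>"]) auto
    next
      assume "y \<in> radical R I"
      then show ?thesis using J.a_subset generate.one[of "add_monoid R'" T']
        by (intro bexI[of _ "\<zero>\<^bsub>R'\<^esub>"] bexI[of _ y]) auto
    qed
  next
    case (inv y)
    then show ?case
    proof
      assume "y \<in> h ` T'"
      then obtain s where "s \<in> T'" "y = h s" by auto
      then show ?thesis using J.zero_closed generate.inv[of s T' "add_monoid R'"] T'(2)
        by (intro bexI[of _ "\<ominus>\<^bsub>R'\<^esub> s"] bexI[of _ "\<zero>\<^bsub>R\<^esub>"])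
          (auto simp: a_inv_def[symmetric])
    next
      assume "y \<in> radical R I"
      then show ?thesis using J.a_subset generate.one[of "add_monoid R'" T'] J.a_inv_closed
        by (intro bexI[of _ "\<zero>\<^bsub>R'\<^esub>"] bexI[of _ "\<ominus>\<^bsub>R\<^esub> y"])
          (auto simp: a_inv_def[symmetric])
    qed
  next
    case (eng y1 y2)
    then obtain s1 s2 j1 j2 where *: "s1 \<in> ?G" "s2 \<in> ?G" "j1 \<in> radical R I" "j2 \<in> radical R I"
      "y1 = h s1 \<oplus>\<^bsub>R\<^esub> j1" "y2 = h s2 \<oplus>\<^bsub>R\<^esub> j2" by blast
    have c: "s1 \<in> carrier R'" "s2 \<in> carrier R'" "j1 \<in> carrier R" "j2 \<in> carrier R"
      using * Gc J.a_subset by auto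
    have "y1 \<oplus>\<^bsub>R\<^esub> y2 = h (s1 \<oplus>\<^bsub>R'\<^esub> s2) \<oplus>\<^bsub>R\<^esub> (j1 \<oplus>\<^bsub>R\<^esub> j2)"
      unfolding *(5,6) using c by (simp add: R.add.m_ac)
    then show ?case using * generate.eng[of s1 "add_monoid R'" T' s2] J.a_closed[of j1 j2]
      by (intro bexI[of _ "s1 \<oplus>\<^bsub>R'\<^esub> s2"] bexI[of _ "j1 \<oplus>\<^bsub>R\<^esub> j2"]) auto
  qed
  have "x \<in> generate (add_monoid R') (T' \<union> radical R' I')" if x: "x \<in> carrier R'" for x
  proof -
    obtain s j where s: "s \<in> ?G" "j \<in> radical R I" "h x = h s \<oplus>\<^bsub>R\<^esub> j"
      using split[of "h x"] T'(3) x by blast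
    have c: "s \<in> carrier R'" "j \<in> carrier R" using s Gc J.a_subset by auto
    have "h (x \<ominus>\<^bsub>R'\<^esub> s) = j"
      using x c s(3) by (simp add: a_minus_def R.a_assoc R.a_comm[of j] R.r_neg2)
    then have "x \<ominus>\<^bsub>R'\<^esub> s \<in> radical R' I'" using s(2) x c by (intro refl) auto
    then have "x \<ominus>\<^bsub>R'\<^esub> s \<in> generate (add_monoid R') (T' \<union> radical R' I')"
      by (auto intro: generate.incl)
    moreover have "s \<in> generate (add_monoid R') (T' \<union> radical R' I')"
      using s(1) R'.add.mono_generate[of T' "T' \<union> radical R' I'"] by blast
    ultimately have "s \<oplus>\<^bsub>R'\<^esub> (x \<ominus>\<^bsub>R'\<^esub> s) \<in> generate (add_monoid R') (T' \<union> radical R' I')"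
      using generate.eng[of s "add_monoid R'" _ "x \<ominus>\<^bsub>R'\<^esub> s"] by simp
    moreover have "s \<oplus>\<^bsub>R'\<^esub> (x \<ominus>\<^bsub>R'\<^esub> s) = x"
      using x c by (simp add: a_minus_def R'.a_lcomm[of s x] R'.r_neg)
    ultimately show ?thesis by simp
  qed
  then show ?thesis unfolding finite_mod_radical_def
    using T' J'.a_subset R'.add.generate_in_carrier[of "T' \<union> radical R' I'"]
    by (intro exI[of _ T']) auto
qed

section \<open>The Grothendieck ring of a semiring of classes\<close>

definition frag_mult :: "('c \<Rightarrow> 'c \<Rightarrow> 'c) \<Rightarrow> ('c \<Rightarrow>\<^sub>0 int) \<Rightarrow> ('c \<Rightarrow>\<^sub>0 int) \<Rightarrow> 'c \<Rightarrow>\<^sub>0 int" where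
  "frag_mult m f g = frag_extend (\<lambda>A. frag_extend (\<lambda>B. frag_of (m A B)) g) f"

definition monoid_algebra :: "'c set \<Rightarrow> ('c \<Rightarrow> 'c \<Rightarrow> 'c) \<Rightarrow> 'c \<Rightarrow> ('c \<Rightarrow>\<^sub>0 int) ring" where
  "monoid_algebra S m u = \<lparr>carrier = carrier (free_Abelian_group S), monoid.mult = frag_mult m,
     one = frag_of u, zero = 0, add = (+)\<rparr>"

definition additivity_relations :: "'c set \<Rightarrow> ('c \<Rightarrow> 'c \<Rightarrow> 'c) \<Rightarrow> ('c \<Rightarrow>\<^sub>0 int) set" where
  "additivity_relations S p = {frag_of A + frag_of B - frag_of (p A B) | A B. A \<in> S \<and> B \<in> S}"

text \<open>
  Defined as the additive subgroup generated by the relations, as in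
  \<^const>\<open>rep_ring\<close>; distributivity makes it an ideal.
\<close>

definition additivity_ideal :: "'c set \<Rightarrow> ('c \<Rightarrow> 'c \<Rightarrow> 'c) \<Rightarrow> ('c \<Rightarrow> 'c \<Rightarrow> 'c) \<Rightarrow> 'c \<Rightarrow> ('c \<Rightarrow>\<^sub>0 int) set" where
  "additivity_ideal S p m u = generate (add_monoid (monoid_algebra S m u)) (additivity_relations S p)"

lemma frag_mult_simps [simp]:
  "frag_mult m (frag_of a) (frag_of b) = frag_of (m a b)"
  "frag_mult m 0 y = 0" "frag_mult m x 0 = 0"
  "frag_mult m (x - x') y = frag_mult m x y - frag_mult m x' y"
  "frag_mult m x (y - y') = frag_mult m x y - frag_mult m x y'"
  "frag_mult m (x + x') y = frag_mult m x y + frag_mult m x' y"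
  "frag_mult m x (y + y') = frag_mult m x y + frag_mult m x y'"
  "frag_mult m (- x) y = - frag_mult m x y"
  "frag_mult m x (- y) = - frag_mult m x y"
proof -
  have add: "frag_extend (\<lambda>A. f A + g A) x = frag_extend f x + frag_extend g x" for f g :: "'b \<Rightarrow> 'a \<Rightarrow>\<^sub>0 int" and x
    by (induction x rule: frag_induction[OF subset_UNIV]) (simp_all add: frag_extend_diff)
  have diff: "frag_extend (\<lambda>A. f A - g A) x = frag_extend f x - frag_extend g x" for f g :: "'b \<Rightarrow> 'a \<Rightarrow>\<^sub>0 int" and x
    by (induction x rule: frag_induction[OF subset_UNIV]) (simp_all add: frag_extend_diff)
  have zero: "frag_extend (\<lambda>A. 0) x = 0" for x :: "'b \<Rightarrow>\<^sub>0 int"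
    by (rule frag_extend_eq_0) simp
  show z: "frag_mult m x 0 = 0" by (simp add: frag_mult_def zero)
  show d: "frag_mult m x (y - y') = frag_mult m x y - frag_mult m x y'" for y y'
    by (simp add: frag_mult_def frag_extend_diff diff)
  show "frag_mult m x (y + y') = frag_mult m x y + frag_mult m x y'"
    by (simp add: frag_mult_def frag_extend_add add)
  show "frag_mult m x (- y) = - frag_mult m x y" using d[of 0 y] z by simp
qed (simp_all add: frag_mult_def frag_extend_diff frag_extend_add frag_extend_minus)

lemma keys_frag_diff_subset: "Poly_Mapping.keys a \<subseteq> S \<Longrightarrow> Poly_Mapping.keys b \<subseteq> S \<Longrightarrow> Poly_Mapping.keys (a - b) \<subseteq> S"
  using keys_diff[of a b] by blast

lemma keys_frag_mult_subset:
  assumes "\<And>a b. a \<in> S \<Longrightarrow> b \<in> S \<Longrightarrow> m a b \<in> S"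
    and "Poly_Mapping.keys x \<subseteq> S" "Poly_Mapping.keys y \<subseteq> S"
  shows "Poly_Mapping.keys (frag_mult m x y) \<subseteq> S"
proof -
  have "Poly_Mapping.keys (frag_mult m (frag_of a) y) \<subseteq> S" if "a \<in> S" for a
    using assms(3) by (induction y rule: frag_induction)
      (simp_all add: assms(1) that keys_frag_of keys_frag_diff_subset)
  note of = this
  show ?thesis
    using assms(2) by (induction x rule: frag_induction) (simp_all add: keys_frag_diff_subset of)
qed

definition frag_map :: "('a \<Rightarrow> 'b) \<Rightarrow> ('a \<Rightarrow>\<^sub>0 int) \<Rightarrow> 'b \<Rightarrow>\<^sub>0 int" where
  "frag_map f = frag_extend (frag_of \<circ> f)"

lemma frag_map_simps [simp]:
  "frag_map f (frag_of a) = frag_of (f a)" "frag_map f 0 = 0"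
  "frag_map f (x + y) = frag_map f x + frag_map f y"
  "frag_map f (x - y) = frag_map f x - frag_map f y"
  by (simp_all add: frag_map_def frag_extend_add frag_extend_diff)

lemma keys_frag_map_subset:
  assumes "f ` S \<subseteq> S'" "Poly_Mapping.keys x \<subseteq> S"
  shows "Poly_Mapping.keys (frag_map f x) \<subseteq> S'"
  using assms(2)
  by (induction x rule: frag_induction) (use assms(1) in \<open>auto simp: keys_frag_of intro: subsetD[OF keys_frag_diff_subset]\<close>)

text \<open>
  The laws of sum \<open>p\<close>, product \<open>m\<close> and unit \<open>u\<close> of
  isomorphism classes that turn the free abelian group on the classes into a commutative ring
  in which the additivity relations generate an ideal as a subgroup.
\<close>

locale class_semiring =
  fixes S :: "'c set" and p m :: "'c \<Rightarrow> 'c \<Rightarrow> 'c" and u :: 'c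
  assumes p_closed: "a \<in> S \<Longrightarrow> b \<in> S \<Longrightarrow> p a b \<in> S"
    and m_closed: "a \<in> S \<Longrightarrow> b \<in> S \<Longrightarrow> m a b \<in> S"
    and u_closed: "u \<in> S"
    and m_assoc: "a \<in> S \<Longrightarrow> b \<in> S \<Longrightarrow> c \<in> S \<Longrightarrow> m (m a b) c = m a (m b c)"
    and m_comm: "a \<in> S \<Longrightarrow> b \<in> S \<Longrightarrow> m a b = m b a"
    and m_unit: "a \<in> S \<Longrightarrow> m a u = a"
    and m_distrib: "a \<in> S \<Longrightarrow> b \<in> S \<Longrightarrow> c \<in> S \<Longrightarrow> m (p a b) c = p (m a c) (m b c)"
begin

abbreviation "alg \<equiv> monoid_algebra S m u"
abbreviation "relations_ideal \<equiv> additivity_ideal S p m u"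

lemma algebra_simps:
  "carrier alg = {x. Poly_Mapping.keys x \<subseteq> S}" "\<zero>\<^bsub>alg\<^esub> = 0" "\<one>\<^bsub>alg\<^esub> = frag_of u"
  "x \<otimes>\<^bsub>alg\<^esub> y = frag_mult m x y" "x \<oplus>\<^bsub>alg\<^esub> y = x + y"
  by (simp_all add: monoid_algebra_def free_Abelian_group_def)

lemma cring_algebra: "cring alg"
proof (rule cringI)
  show "abelian_group alg"
  proof (rule abelian_groupI)
    fix x assume "x \<in> carrier alg"
    then show "\<exists>y\<in>carrier alg. y \<oplus>\<^bsub>alg\<^esub> x = \<zero>\<^bsub>alg\<^esub>"
      by (intro bexI[of _ "- x"]) (auto simp: algebra_simps)
  next
    show "x \<oplus>\<^bsub>alg\<^esub> y \<in> carrier alg" if "x \<in> carrier alg" "y \<in> carrier alg" for x y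
      using that keys_add[of x y] unfolding algebra_simps by blast
  qed (simp_all add: algebra_simps)
  show "comm_monoid alg"
  proof (rule comm_monoidI)
    show "x \<otimes>\<^bsub>alg\<^esub> y \<in> carrier alg" if "x \<in> carrier alg" "y \<in> carrier alg" for x y
      using that m_closed keys_frag_mult_subset[of S m x y] by (simp add: algebra_simps)
    show "\<one>\<^bsub>alg\<^esub> \<in> carrier alg" using u_closed by (simp add: algebra_simps)
    show "x \<otimes>\<^bsub>alg\<^esub> y \<otimes>\<^bsub>alg\<^esub> z = x \<otimes>\<^bsub>alg\<^esub> (y \<otimes>\<^bsub>alg\<^esub> z)"
      if "x \<in> carrier alg" "y \<in> carrier alg" "z \<in> carrier alg" for x y z
    proof -
      have 1: "frag_mult m (frag_mult m (frag_of a) (frag_of b)) z = frag_mult m (frag_of a) (frag_mult m (frag_of b) z)"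
        if "a \<in> S" "b \<in> S" for a b
        using \<open>z \<in> _\<close>[unfolded algebra_simps mem_Collect_eq] that
        by (induction z rule: frag_induction) (simp_all add: m_assoc)
      have 2: "frag_mult m (frag_mult m (frag_of a) y) z = frag_mult m (frag_of a) (frag_mult m y z)"
        if "a \<in> S" for a
        using \<open>y \<in> _\<close>[unfolded algebra_simps mem_Collect_eq] that 1
        by (induction y rule: frag_induction) simp_all
      show ?thesis unfolding algebra_simps
        using \<open>x \<in> _\<close>[unfolded algebra_simps mem_Collect_eq] 2
        by (induction x rule: frag_induction) simp_all
    qed
    show "\<one>\<^bsub>alg\<^esub> \<otimes>\<^bsub>alg\<^esub> x = x" if "x \<in> carrier alg" for x
      using that[unfolded algebra_simps mem_Collect_eq] unfolding algebra_simps
      by (induction x rule: frag_induction) (simp_all add: m_unit m_comm[OF u_closed])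
    show "x \<otimes>\<^bsub>alg\<^esub> y = y \<otimes>\<^bsub>alg\<^esub> x" if "x \<in> carrier alg" "y \<in> carrier alg" for x y
    proof -
      have "frag_mult m (frag_of a) y = frag_mult m y (frag_of a)" if "a \<in> S" for a
        using \<open>y \<in> _\<close>[unfolded algebra_simps mem_Collect_eq] that
        by (induction y rule: frag_induction) (simp_all add: m_comm)
      note of = this
      show ?thesis unfolding algebra_simps
        using \<open>x \<in> _\<close>[unfolded algebra_simps mem_Collect_eq]
        by (induction x rule: frag_induction) (simp_all add: of)
    qed
  qed
qed (simp add: algebra_simps)

sublocale alg: cring alg by (rule cring_algebra)

lemma a_inv_algebra: "x \<in> carrier alg \<Longrightarrow> \<ominus>\<^bsub>alg\<^esub> x = - x"
  by (rule alg.minus_equality) (auto simp: algebra_simps)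

lemma relations_subset: "additivity_relations S p \<subseteq> carrier alg"
  using p_closed keys_diff keys_add unfolding additivity_relations_def algebra_simps
  by (fastforce simp: keys_frag_of intro!: keys_frag_diff_subset)

lemma subgroup_relations: "subgroup relations_ideal (add_monoid alg)"
  unfolding additivity_ideal_def using relations_subset by (intro alg.add.generate_is_subgroup) simp

lemma inv_add_monoid_algebra: "x \<in> carrier alg \<Longrightarrow> inv\<^bsub>add_monoid alg\<^esub> x = - x"
  using a_inv_algebra[of x] unfolding a_inv_def .

lemma relations_ideal_closed:
  shows "0 \<in> relations_ideal" "h \<in> additivity_relations S p \<Longrightarrow> h \<in> relations_ideal"
    and "x \<in> relations_ideal \<Longrightarrow> y \<in> relations_ideal \<Longrightarrow> x - y \<in> relations_ideal"
proof -
  have add_mult: "x \<otimes>\<^bsub>add_monoid alg\<^esub> y = x + y" for x y by (simp add: monoid_algebra_def)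
  have Gc: "relations_ideal \<subseteq> carrier alg" using subgroup.subset[OF subgroup_relations] by simp
  show "x - y \<in> relations_ideal" if xy: "x \<in> relations_ideal" "y \<in> relations_ideal"
    using subgroup.m_closed[OF subgroup_relations xy(1) subgroup.m_inv_closed[OF subgroup_relations xy(2)]]
    unfolding add_mult inv_add_monoid_algebra[OF subsetD[OF Gc xy(2)]] by simp
  have "\<one>\<^bsub>add_monoid alg\<^esub> = 0" by (simp add: monoid_algebra_def)
  then show "0 \<in> relations_ideal" using subgroup.one_closed[OF subgroup_relations] by metis
  show "h \<in> relations_ideal" if "h \<in> additivity_relations S p"
    unfolding additivity_ideal_def using that by (rule generate.incl)
qed

text \<open>
  Closure under differences covers sums and inverses at once, which leaves one case for
  homomorphisms of groups to check.
\<close>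

lemma relations_ideal_induct [consumes 1, case_names zero rel diff]:
  assumes "x \<in> relations_ideal" "P 0" "\<And>h. h \<in> additivity_relations S p \<Longrightarrow> P h"
    and "\<And>x y. P x \<Longrightarrow> P y \<Longrightarrow> P (x - y)"
  shows "P x"
  using assms(1) unfolding additivity_ideal_def
proof (induction rule: generate.induct)
  case one
  have "\<one>\<^bsub>add_monoid alg\<^esub> = 0" by (simp add: monoid_algebra_def)
  then show ?case using assms(2) by metis
next
  case (incl h)
  then show ?case by (rule assms(3))
next
  case (inv h)
  then have "inv\<^bsub>add_monoid alg\<^esub> h = - h" using relations_subset by (intro inv_add_monoid_algebra) auto
  then show ?case using assms(4)[OF assms(2) assms(3)[OF inv]] by simp
next
  case (eng h1 h2)
  have "h1 \<otimes>\<^bsub>add_monoid alg\<^esub> h2 = h1 - (0 - h2)" by (simp add: monoid_algebra_def)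
  moreover have "P (h1 - (0 - h2))" using assms(2,4) eng.IH by blast
  ultimately show ?case by metis
qed

text \<open>
  By distributivity the product of a class with an additivity relation is again an additivity
  relation.
\<close>

lemma ideal_relations: "ideal relations_ideal alg"
proof -
  let ?G = "relations_ideal"
  have Gc: "?G \<subseteq> carrier alg" using subgroup.subset[OF subgroup_relations] by simp
  have rel: "frag_mult m (frag_of a) h \<in> additivity_relations S p"
    if a: "a \<in> S" and h: "h \<in> additivity_relations S p" for a h
  proof -
    obtain b c where bc: "b \<in> S" "c \<in> S" "h = frag_of b + frag_of c - frag_of (p b c)"
      using h unfolding additivity_relations_def by blast
    have "frag_mult m (frag_of a) h = frag_of (m a b) + frag_of (m a c) - frag_of (p (m a b) (m a c))"
      using bc a p_closed by (simp add: m_comm[OF a] m_distrib)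
    then show ?thesis unfolding additivity_relations_def using bc a m_closed by blast
  qed
  have of: "frag_mult m (frag_of a) r \<in> ?G" if "a \<in> S" "r \<in> ?G" for a r
    using that(2) by (induction r rule: relations_ideal_induct)
      (simp_all add: relations_ideal_closed rel that(1))
  have mult: "frag_mult m x r \<in> ?G" if "x \<in> carrier alg" "r \<in> ?G" for x r
    using that(1)[unfolded algebra_simps mem_Collect_eq]
    by (induction x rule: frag_induction) (simp_all add: relations_ideal_closed of that(2))
  show ?thesis
  proof (rule idealI[OF alg.ring_axioms subgroup_relations])
    show "x \<otimes>\<^bsub>alg\<^esub> a \<in> ?G" "a \<otimes>\<^bsub>alg\<^esub> x \<in> ?G" if "a \<in> ?G" "x \<in> carrier alg" for a x
      using mult[OF that(2,1)] alg.m_comm[of x a] that Gc by (auto simp: algebra_simps(4))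
  qed
qed

end

lemma class_hom_ring_hom:
  assumes "class_semiring S p m u" "class_semiring S' p' m' u'"
    and "f ` S \<subseteq> S'" "f u = u'" "\<And>a b. a \<in> S \<Longrightarrow> b \<in> S \<Longrightarrow> f (m a b) = m' (f a) (f b)"
  shows "frag_map f \<in> ring_hom (monoid_algebra S m u) (monoid_algebra S' m' u')"
proof -
  interpret A: class_semiring S p m u by fact
  interpret B: class_semiring S' p' m' u' by fact
  show ?thesis
  proof (rule ring_hom_memI)
    show "frag_map f x \<in> carrier B.alg" if "x \<in> carrier A.alg" for x
      using that keys_frag_map_subset[OF assms(3)] unfolding A.algebra_simps B.algebra_simps by blast
    show "frag_map f (x \<oplus>\<^bsub>A.alg\<^esub> y) = frag_map f x \<oplus>\<^bsub>B.alg\<^esub> frag_map f y" for x y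
      by (simp add: A.algebra_simps B.algebra_simps)
    show "frag_map f \<one>\<^bsub>A.alg\<^esub> = \<one>\<^bsub>B.alg\<^esub>"
      by (simp add: A.algebra_simps B.algebra_simps assms)
    show "frag_map f (x \<otimes>\<^bsub>A.alg\<^esub> y) = frag_map f x \<otimes>\<^bsub>B.alg\<^esub> frag_map f y"
      if "x \<in> carrier A.alg" "y \<in> carrier A.alg" for x y
    proof -
      have of: "frag_map f (frag_mult m (frag_of a) y) = frag_mult m' (frag_of (f a)) (frag_map f y)"
        if "a \<in> S" for a
        using \<open>y \<in> _\<close>[unfolded A.algebra_simps mem_Collect_eq]
        by (induction y rule: frag_induction) (simp_all add: assms(5) that)
      show ?thesis unfolding A.algebra_simps B.algebra_simps
        using \<open>x \<in> _\<close>[unfolded A.algebra_simps mem_Collect_eq]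
        by (induction x rule: frag_induction) (simp_all add: of)
    qed
  qed
qed

text \<open>
  The ideal is generated by the additivity relations already as a group. This lets maps of
  classes that are merely additive, such as the one induced by inverting an arrow, be used
  below.
\<close>

lemma additive_map_relations_ideal:
  assumes "class_semiring S p m u" "class_semiring S' p' m' u'"
    and "f ` S \<subseteq> S'" "\<And>a b. a \<in> S \<Longrightarrow> b \<in> S \<Longrightarrow> f (p a b) = p' (f a) (f b)"
    and "x \<in> additivity_ideal S p m u"
  shows "frag_map f x \<in> additivity_ideal S' p' m' u'"
proof -
  interpret A: class_semiring S p m u by fact
  interpret B: class_semiring S' p' m' u' by fact
  have rel: "frag_map f h \<in> additivity_relations S' p'" if h: "h \<in> additivity_relations S p" for h
  proof -
    obtain b c where bc: "b \<in> S" "c \<in> S" "h = frag_of b + frag_of c - frag_of (p b c)"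
      using h unfolding additivity_relations_def by blast
    then have "frag_map f h = frag_of (f b) + frag_of (f c) - frag_of (p' (f b) (f c))"
      by (simp add: assms(4))
    then show ?thesis unfolding additivity_relations_def using bc assms(3) by blast
  qed
  show ?thesis using assms(5)
    by (induction x rule: A.relations_ideal_induct) (simp_all add: B.relations_ideal_closed rel)
qed

theorem finite_mod_radical_surjective_class_hom:
  assumes "class_semiring S p m u" "class_semiring S' p' m' u'"
    and "f ` S = S'" "f u = u'" "\<And>a b. a \<in> S \<Longrightarrow> b \<in> S \<Longrightarrow> f (m a b) = m' (f a) (f b)"
    and "\<And>a b. a \<in> S \<Longrightarrow> b \<in> S \<Longrightarrow> f (p a b) = p' (f a) (f b)"
    and "finite_mod_radical (monoid_algebra S m u) (additivity_ideal S p m u)"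
  shows "finite_mod_radical (monoid_algebra S' m' u') (additivity_ideal S' p' m' u')"
proof -
  interpret A: class_semiring S p m u by fact
  interpret B: class_semiring S' p' m' u' by fact
  have F: "frag_map f \<in> ring_hom A.alg B.alg"
    using assms by (intro class_hom_ring_hom[OF assms(1,2)]) auto
  show ?thesis
  proof (rule finite_mod_radical_surj[OF A.cring_algebra A.ideal_relations B.cring_algebra B.ideal_relations F _ _ assms(7)])
    show "frag_map f ` A.relations_ideal \<subseteq> B.relations_ideal"
      using additive_map_relations_ideal[OF assms(1,2), of f] assms(3,6) by auto
    have "y \<in> frag_map f ` carrier A.alg" if "Poly_Mapping.keys y \<subseteq> S'" for y
      using that
    proof (induction y rule: frag_induction)
      case zero
      show ?case by (rule image_eqI[of _ _ 0]) (simp_all add: A.algebra_simps)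
    next
      case (one b)
      then obtain a where "a \<in> S" "b = f a" using assms(3) by auto
      then show ?case by (intro image_eqI[of _ _ "frag_of a"]) (simp_all add: A.algebra_simps)
    next
      case (diff a b)
      then obtain a' b' where "a' \<in> carrier A.alg" "b' \<in> carrier A.alg" "a = frag_map f a'" "b = frag_map f b'" by blast
      then show ?case
        by (intro image_eqI[of _ _ "a' - b'"]) (simp_all add: A.algebra_simps keys_frag_diff_subset)
    qed
    then show "frag_map f ` carrier A.alg = carrier B.alg"
      using ring_hom_closed[OF F] by (auto simp: B.algebra_simps)
  qed
qed

text \<open>
  The additive left inverse \<open>g\<close> detects the ideal: if the image of
  \<open>x\<close> under \<open>f\<close> is in the ideal, then so is \<open>x\<close>, which
  is recovered by applying \<open>g\<close>.
\<close>

theorem finite_mod_radical_split_class_hom: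
  assumes "class_semiring S p m u" "class_semiring S' p' m' u'"
    and "f ` S' \<subseteq> S" "f u' = u" "\<And>a b. a \<in> S' \<Longrightarrow> b \<in> S' \<Longrightarrow> f (m' a b) = m (f a) (f b)"
    and "g ` S \<subseteq> S'" "\<And>a b. a \<in> S \<Longrightarrow> b \<in> S \<Longrightarrow> g (p a b) = p' (g a) (g b)"
    and "\<And>a. a \<in> S' \<Longrightarrow> g (f a) = a"
    and "finite_mod_radical (monoid_algebra S m u) (additivity_ideal S p m u)"
  shows "finite_mod_radical (monoid_algebra S' m' u') (additivity_ideal S' p' m' u')"
proof -
  interpret A: class_semiring S p m u by fact
  interpret B: class_semiring S' p' m' u' by fact
  have F: "frag_map f \<in> ring_hom B.alg A.alg"
    using assms by (intro class_hom_ring_hom[OF assms(2,1)]) auto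
  show ?thesis
  proof (rule finite_mod_radical_reflect[OF A.cring_algebra A.ideal_relations B.cring_algebra B.ideal_relations F _ assms(9)])
    fix x assume x: "x \<in> carrier B.alg" "frag_map f x \<in> A.relations_ideal"
    have "frag_map g (frag_map f x) = x"
      using x(1)[unfolded B.algebra_simps mem_Collect_eq]
      by (induction x rule: frag_induction) (simp_all add: assms(8))
    then show "x \<in> B.relations_ideal"
      using additive_map_relations_ideal[OF assms(1,2,6,7) x(2)] by simp
  qed
qed

section \<open>Linear maps and quotients of vector spaces\<close>

lemma linear_mapI:
  assumes "vectorspace K V" "vectorspace K W" "\<And>v. v \<in> carrier V \<Longrightarrow> f v \<in> carrier W"
    and "\<And>v w. v \<in> carrier V \<Longrightarrow> w \<in> carrier V \<Longrightarrow> f (v \<oplus>\<^bsub>V\<^esub> w) = f v \<oplus>\<^bsub>W\<^esub> f w"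
    and "\<And>c v. c \<in> carrier K \<Longrightarrow> v \<in> carrier V \<Longrightarrow> f (c \<odot>\<^bsub>V\<^esub> v) = c \<odot>\<^bsub>W\<^esub> f v"
  shows "linear_map K V W f"
  using assms unfolding linear_map_def mod_hom_def mod_hom_axioms_def LinearCombinations.module_hom_def vectorspace_def by auto

lemma linear_mapD:
  assumes "linear_map K V W f"
  shows "vectorspace K V" "vectorspace K W"
    and "v \<in> carrier V \<Longrightarrow> f v \<in> carrier W"
    and "v \<in> carrier V \<Longrightarrow> w \<in> carrier V \<Longrightarrow> f (v \<oplus>\<^bsub>V\<^esub> w) = f v \<oplus>\<^bsub>W\<^esub> f w"
    and "c \<in> carrier K \<Longrightarrow> v \<in> carrier V \<Longrightarrow> f (c \<odot>\<^bsub>V\<^esub> v) = c \<odot>\<^bsub>W\<^esub> f v"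
    and "f \<zero>\<^bsub>V\<^esub> = \<zero>\<^bsub>W\<^esub>"
    and "v \<in> carrier V \<Longrightarrow> w \<in> carrier V \<Longrightarrow> f (v \<ominus>\<^bsub>V\<^esub> w) = f v \<ominus>\<^bsub>W\<^esub> f w"
proof -
  interpret linear_map K V W f by fact
  show "vectorspace K V" "vectorspace K W" by unfold_locales
  show "v \<in> carrier V \<Longrightarrow> f v \<in> carrier W" by simp
  show "v \<in> carrier V \<Longrightarrow> w \<in> carrier V \<Longrightarrow> f (v \<oplus>\<^bsub>V\<^esub> w) = f v \<oplus>\<^bsub>W\<^esub> f w" by simp
  show "c \<in> carrier K \<Longrightarrow> v \<in> carrier V \<Longrightarrow> f (c \<odot>\<^bsub>V\<^esub> v) = c \<odot>\<^bsub>W\<^esub> f v" by simp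
  show "f \<zero>\<^bsub>V\<^esub> = \<zero>\<^bsub>W\<^esub>" by simp
  show "v \<in> carrier V \<Longrightarrow> w \<in> carrier V \<Longrightarrow> f (v \<ominus>\<^bsub>V\<^esub> w) = f v \<ominus>\<^bsub>W\<^esub> f w" by simp
qed

lemma (in vectorspace) vector_space_laws:
  shows "field K" "\<zero>\<^bsub>V\<^esub> \<in> carrier V"
    and "v \<in> carrier V \<Longrightarrow> w \<in> carrier V \<Longrightarrow> v \<oplus>\<^bsub>V\<^esub> w \<in> carrier V"
    and "c \<in> carrier K \<Longrightarrow> v \<in> carrier V \<Longrightarrow> c \<odot>\<^bsub>V\<^esub> v \<in> carrier V"
    and "v \<in> carrier V \<Longrightarrow> v \<oplus>\<^bsub>V\<^esub> \<zero>\<^bsub>V\<^esub> = v" "v \<in> carrier V \<Longrightarrow> \<zero>\<^bsub>V\<^esub> \<oplus>\<^bsub>V\<^esub> v = v"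
    and "c \<in> carrier K \<Longrightarrow> c \<odot>\<^bsub>V\<^esub> \<zero>\<^bsub>V\<^esub> = \<zero>\<^bsub>V\<^esub>"
    and "v \<in> carrier V \<Longrightarrow> \<one>\<^bsub>K\<^esub> \<odot>\<^bsub>V\<^esub> v = v"
    and "c \<in> carrier K \<Longrightarrow> v \<in> carrier V \<Longrightarrow> w \<in> carrier V \<Longrightarrow>
      c \<odot>\<^bsub>V\<^esub> (v \<oplus>\<^bsub>V\<^esub> w) = c \<odot>\<^bsub>V\<^esub> v \<oplus>\<^bsub>V\<^esub> c \<odot>\<^bsub>V\<^esub> w"
    and "c \<in> carrier K \<Longrightarrow> d \<in> carrier K \<Longrightarrow> v \<in> carrier V \<Longrightarrow>
      (c \<oplus>\<^bsub>K\<^esub> d) \<odot>\<^bsub>V\<^esub> v = c \<odot>\<^bsub>V\<^esub> v \<oplus>\<^bsub>V\<^esub> d \<odot>\<^bsub>V\<^esub> v"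
    and "c \<in> carrier K \<Longrightarrow> d \<in> carrier K \<Longrightarrow> v \<in> carrier V \<Longrightarrow>
      (c \<otimes>\<^bsub>K\<^esub> d) \<odot>\<^bsub>V\<^esub> v = c \<odot>\<^bsub>V\<^esub> (d \<odot>\<^bsub>V\<^esub> v)"
    and "v \<in> carrier V \<Longrightarrow> w \<in> carrier V \<Longrightarrow> v \<oplus>\<^bsub>V\<^esub> w = w \<oplus>\<^bsub>V\<^esub> v"
    and "v \<in> carrier V \<Longrightarrow> w \<in> carrier V \<Longrightarrow> x \<in> carrier V \<Longrightarrow>
      v \<oplus>\<^bsub>V\<^esub> w \<oplus>\<^bsub>V\<^esub> x = v \<oplus>\<^bsub>V\<^esub> (w \<oplus>\<^bsub>V\<^esub> x)"
    and "v \<in> carrier V \<Longrightarrow> w \<in> carrier V \<Longrightarrow> x \<in> carrier V \<Longrightarrow>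
      v \<oplus>\<^bsub>V\<^esub> (w \<oplus>\<^bsub>V\<^esub> x) = w \<oplus>\<^bsub>V\<^esub> (v \<oplus>\<^bsub>V\<^esub> x)"
  by (unfold_locales, auto simp: smult_assoc1 smult_l_distr smult_r_distr a_assoc a_lcomm intro: a_comm)

lemmas vectorspaceD = vectorspace.vector_space_laws

lemma vectorspace_smult_commute:
  assumes "vectorspace K V" "c \<in> carrier K" "d \<in> carrier K" "v \<in> carrier V"
  shows "c \<odot>\<^bsub>V\<^esub> (d \<odot>\<^bsub>V\<^esub> v) = d \<odot>\<^bsub>V\<^esub> (c \<odot>\<^bsub>V\<^esub> v)"
proof -
  interpret V: vectorspace K V by fact
  show ?thesis
    using assms V.smult_assoc1[of c d v] V.smult_assoc1[of d c v] V.R.m_comm[of c d] by simp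
qed

lemma linear_map_cong:
  assumes "linear_map K V W f" "\<And>v. v \<in> carrier V \<Longrightarrow> g v = f v"
  shows "linear_map K V W g"
  using linear_mapD[OF assms(1)] assms(2)
  by (intro linear_mapI) (simp_all add: vectorspaceD(3,4))

lemma linear_map_id: "vectorspace K V \<Longrightarrow> linear_map K V V (\<lambda>v. v)"
  by (rule linear_mapI) simp_all

lemma linear_map_comp:
  assumes "linear_map K V W f" "linear_map K W X g"
  shows "linear_map K V X (\<lambda>v. g (f v))"
  using linear_mapD[OF assms(1)] linear_mapD[OF assms(2)] by (intro linear_mapI) simp_all

lemma linear_map_zero:
  assumes "vectorspace K V" "vectorspace K W"
  shows "linear_map K V W (\<lambda>_. \<zero>\<^bsub>W\<^esub>)"
  using assms by (intro linear_mapI) (simp_all add: vectorspaceD)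

lemma linear_map_add:
  assumes "linear_map K V W f" "linear_map K V W g"
  shows "linear_map K V W (\<lambda>v. f v \<oplus>\<^bsub>W\<^esub> g v)"
proof -
  note f = linear_mapD[OF assms(1)] and g = linear_mapD[OF assms(2)]
  note W = vectorspaceD[OF f(2)]
  show ?thesis
  proof (rule linear_mapI[OF f(1,2)])
    fix v w assume "v \<in> carrier V" "w \<in> carrier V"
    then show "f (v \<oplus>\<^bsub>V\<^esub> w) \<oplus>\<^bsub>W\<^esub> g (v \<oplus>\<^bsub>V\<^esub> w) = f v \<oplus>\<^bsub>W\<^esub> g v \<oplus>\<^bsub>W\<^esub> (f w \<oplus>\<^bsub>W\<^esub> g w)"
      using f g W by (simp add: W(13,14) W(3))
  qed (use f g W in simp_all)
qed

lemma linear_map_smult: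
  assumes "linear_map K V W f" "c \<in> carrier K"
  shows "linear_map K V W (\<lambda>v. c \<odot>\<^bsub>W\<^esub> f v)"
proof -
  note f = linear_mapD[OF assms(1)]
  show ?thesis
    using f vectorspaceD[OF f(2)] assms(2) vectorspace_smult_commute[OF f(2)]
    by (intro linear_mapI) simp_all
qed

lemma linear_map_bij_inverse:
  assumes "linear_map K V W f" "bij_betw f (carrier V) (carrier W)"
  shows "linear_map K W V (the_inv_into (carrier V) f)"
proof -
  note f = linear_mapD[OF assms(1)]
  let ?g = "the_inv_into (carrier V) f"
  have inj: "inj_on f (carrier V)" and im: "f ` carrier V = carrier W"
    using assms(2) by (auto simp: bij_betw_def)
  have g: "?g w \<in> carrier V" "f (?g w) = w" if "w \<in> carrier W" for w
    using that the_inv_into_into[OF inj, of w] f_the_inv_into_f[OF inj, of w] im by auto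
  have gf: "?g (f v) = v" if "v \<in> carrier V" for v using the_inv_into_f_f[OF inj that] .
  note V = vectorspaceD[OF f(1)]
  show ?thesis
  proof (rule linear_mapI[OF f(2,1)])
    fix v w assume vw: "v \<in> carrier W" "w \<in> carrier W"
    have "v \<oplus>\<^bsub>W\<^esub> w = f (?g v \<oplus>\<^bsub>V\<^esub> ?g w)" using vw g f by simp
    then show "?g (v \<oplus>\<^bsub>W\<^esub> w) = ?g v \<oplus>\<^bsub>V\<^esub> ?g w" using gf g vw V(3) by simp
  next
    fix c w assume cw: "c \<in> carrier K" "w \<in> carrier W"
    have "c \<odot>\<^bsub>W\<^esub> w = f (c \<odot>\<^bsub>V\<^esub> ?g w)" using cw g f by simp
    then show "?g (c \<odot>\<^bsub>W\<^esub> w) = c \<odot>\<^bsub>V\<^esub> ?g w" using gf g cw V(4) by simp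
  qed (use g in auto)
qed

text \<open>
  Transport of structure: all vector space axioms of the image are inherited from
  \<open>V\<close>.
\<close>

lemma linear_map_on_image:
  assumes V: "vectorspace K V" and im: "carrier W = f ` carrier V" and zero: "f \<zero>\<^bsub>V\<^esub> = \<zero>\<^bsub>W\<^esub>"
    and add: "\<And>v w. v \<in> carrier V \<Longrightarrow> w \<in> carrier V \<Longrightarrow> f (v \<oplus>\<^bsub>V\<^esub> w) = f v \<oplus>\<^bsub>W\<^esub> f w"
    and smult: "\<And>c v. c \<in> carrier K \<Longrightarrow> v \<in> carrier V \<Longrightarrow> f (c \<odot>\<^bsub>V\<^esub> v) = c \<odot>\<^bsub>W\<^esub> f v"
  shows "linear_map K V W f"
proof (rule linear_mapI[OF V _ _ add smult])
  interpret V: vectorspace K V by fact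
  have mem: "w \<in> carrier W \<longleftrightarrow> (\<exists>v\<in>carrier V. w = f v)" for w using im by auto
  show "vectorspace K W"
  proof (rule vs_criteria)
    show "field K" by unfold_locales
    show "\<zero>\<^bsub>W\<^esub> \<in> carrier W" using zero mem by (metis V.zero_closed)
    show "\<forall>v w. v \<in> carrier W \<and> w \<in> carrier W \<longrightarrow> v \<oplus>\<^bsub>W\<^esub> w \<in> carrier W"
      unfolding mem by (auto simp: add[symmetric])
    show "\<forall>v\<in>carrier W. \<exists>neg_v\<in>carrier W. v \<oplus>\<^bsub>W\<^esub> neg_v = \<zero>\<^bsub>W\<^esub>"
    proof
      fix w assume "w \<in> carrier W"
      then obtain v where v: "v \<in> carrier V" "w = f v" using mem by auto
      then have "w \<oplus>\<^bsub>W\<^esub> f (\<ominus>\<^bsub>V\<^esub> v) = \<zero>\<^bsub>W\<^esub>"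
        using add[of v "\<ominus>\<^bsub>V\<^esub> v"] zero by (simp add: V.r_neg)
      then show "\<exists>neg_v\<in>carrier W. w \<oplus>\<^bsub>W\<^esub> neg_v = \<zero>\<^bsub>W\<^esub>" using mem v by blast
    qed
    show "\<forall>c v. c \<in> carrier K \<and> v \<in> carrier W \<longrightarrow> c \<odot>\<^bsub>W\<^esub> v \<in> carrier W"
      unfolding mem by (auto simp: smult[symmetric])
    show "\<forall>v w. v \<in> carrier W \<and> w \<in> carrier W \<longrightarrow> v \<oplus>\<^bsub>W\<^esub> w = w \<oplus>\<^bsub>W\<^esub> v"
      unfolding mem by (auto simp: add[symmetric] V.a_comm)
    show "\<forall>v w x. v \<in> carrier W \<and> w \<in> carrier W \<and> x \<in> carrier W \<longrightarrow>
        v \<oplus>\<^bsub>W\<^esub> w \<oplus>\<^bsub>W\<^esub> x = v \<oplus>\<^bsub>W\<^esub> (w \<oplus>\<^bsub>W\<^esub> x)"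
      unfolding mem by (auto simp: add[symmetric] V.a_assoc)
    show "\<forall>v\<in>carrier W. v \<oplus>\<^bsub>W\<^esub> \<zero>\<^bsub>W\<^esub> = v"
      using add[of _ "\<zero>\<^bsub>V\<^esub>"] zero im by auto
    show "\<forall>a b v. a \<in> carrier K \<and> b \<in> carrier K \<and> v \<in> carrier W \<longrightarrow>
        (a \<otimes>\<^bsub>K\<^esub> b) \<odot>\<^bsub>W\<^esub> v = a \<odot>\<^bsub>W\<^esub> (b \<odot>\<^bsub>W\<^esub> v)"
      unfolding mem by (auto simp: smult[symmetric] V.smult_assoc1)
    show "\<forall>v\<in>carrier W. \<one>\<^bsub>K\<^esub> \<odot>\<^bsub>W\<^esub> v = v"
      unfolding mem by (auto simp: smult[symmetric] mem)
    show "\<forall>a b v. a \<in> carrier K \<and> b \<in> carrier K \<and> v \<in> carrier W \<longrightarrow>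
        (a \<oplus>\<^bsub>K\<^esub> b) \<odot>\<^bsub>W\<^esub> v = a \<odot>\<^bsub>W\<^esub> v \<oplus>\<^bsub>W\<^esub> b \<odot>\<^bsub>W\<^esub> v"
      unfolding mem by (auto simp: smult[symmetric] add[symmetric] V.smult_l_distr)
    show "\<forall>a v w. a \<in> carrier K \<and> v \<in> carrier W \<and> w \<in> carrier W \<longrightarrow>
        a \<odot>\<^bsub>W\<^esub> (v \<oplus>\<^bsub>W\<^esub> w) = a \<odot>\<^bsub>W\<^esub> v \<oplus>\<^bsub>W\<^esub> a \<odot>\<^bsub>W\<^esub> w"
      unfolding mem by (auto simp: smult[symmetric] add[symmetric] V.smult_r_distr)
  qed
qed (use im in auto)

abbreviation fd_space :: "('k, 'm) ring_scheme \<Rightarrow> ('k, 'u, 'n) module_scheme \<Rightarrow> bool" where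
  "fd_space K V \<equiv> vectorspace K V \<and> vectorspace.fin_dim K V"

lemma fin_dim_linear_image:
  assumes "linear_map K V W f" "f ` carrier V = carrier W" "vectorspace.fin_dim K V"
  shows "fd_space K W"
proof -
  interpret linear_map K V W f by fact
  show ?thesis using rank_nullity_main(2)[OF assms(3,2)] W.vectorspace_axioms by simp
qed

text \<open>
  Linearly independent subsets of \<open>N\<close> are independent in \<open>V\<close> and so
  of bounded size; a maximal one generates \<open>N\<close>.
\<close>

lemma fin_dim_subspace:
  assumes "fd_space K V" "submodule K N V"
  shows "fd_space K (V\<lparr>carrier := N\<rparr>)"
proof -
  interpret V: vectorspace K V using assms by simp
  have sub: "VectorSpace.subspace K N V" using assms by (simp add: VectorSpace.subspace_def)
  interpret N: vectorspace K "V\<lparr>carrier := N\<rparr>" by (rule V.subspace_is_vs[OF sub])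
  have NV: "N \<subseteq> carrier V" using submodule.subset[OF assms(2)] .
  let ?P = "\<lambda>S. S \<subseteq> carrier (V\<lparr>carrier := N\<rparr>) \<and> \<not> N.lin_dep S"
  have "finite S \<and> card S \<le> V.dim" if "?P S" for S
  proof -
    have "V.lin_indpt S" using that V.span_li_not_depend(2)[of S N] assms(2) by simp
    then show ?thesis using that NV assms(1) V.li_le_dim[of S] by auto
  qed
  moreover have "?P {}" by (simp add: N.lin_dep_def)
  ultimately obtain S where S: "finite S" "maximal S ?P"
    using maximal_exists[of ?P V.dim "{}"] by blast
  then have "N.gen_set S" "S \<subseteq> carrier (V\<lparr>carrier := N\<rparr>)"
    using N.max_li_is_gen[OF S(2)] unfolding maximal_def by auto
  then show ?thesis using S(1) N.vectorspace_axioms unfolding N.fin_dim_def by blast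
qed

text \<open>
  The quotient by \<open>N\<close> with its elements drawn from a prescribed type
  \<open>'t\<close>: a coset is represented by one of its vectors, and this vector by its
  code. Cosets as such would be sets of vectors, whereas isomorphism classes consist of
  representations with one fixed type of vectors.
\<close>

lemma linear_quotient_with_code:
  fixes V :: "('k, 'u) module" and code :: "'u \<Rightarrow> 't"
  assumes V: "fd_space K V" and N: "submodule K N V" and code: "inj_on code (carrier V)"
  obtains W :: "('k, 't) module" and q
  where "linear_map K V W q" "q ` carrier V = carrier W" "fd_space K W"
    and "\<And>v. v \<in> carrier V \<Longrightarrow> q v = \<zero>\<^bsub>W\<^esub> \<longleftrightarrow> v \<in> N"
proof -
  interpret V: vectorspace K V using V by simp
  interpret N: submodule K N V by fact
  have NV: "N \<subseteq> carrier V" by (rule N.subset)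
  have Nneg: "\<ominus>\<^bsub>V\<^esub> v \<in> N" if "v \<in> N" for v
    using N.smult_closed[OF _ that, of "\<ominus>\<^bsub>K\<^esub> \<one>\<^bsub>K\<^esub>"] V.smult_minus_1[OF subsetD[OF NV that]]
    by (metis V.R.a_inv_closed V.R.one_closed)
  \<comment> \<open>The condition depends only on the coset of \<open>v\<close>, so all its members get the
    same representative.\<close>
  define r where "r v = (SOME w. w \<in> carrier V \<and> v \<ominus>\<^bsub>V\<^esub> w \<in> N)" for v
  have r: "r v \<in> carrier V" "v \<ominus>\<^bsub>V\<^esub> r v \<in> N" if "v \<in> carrier V" for v
  proof -
    have "v \<ominus>\<^bsub>V\<^esub> v \<in> N" unfolding a_minus_def V.r_neg[OF that] by (rule N.zero_closed)
    then have "\<exists>w. w \<in> carrier V \<and> v \<ominus>\<^bsub>V\<^esub> w \<in> N" using that by blast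
    from someI_ex[OF this] show "r v \<in> carrier V" "v \<ominus>\<^bsub>V\<^esub> r v \<in> N" unfolding r_def by auto
  qed
  have sum: "(a \<ominus>\<^bsub>V\<^esub> b) \<oplus>\<^bsub>V\<^esub> (b \<ominus>\<^bsub>V\<^esub> c) = a \<ominus>\<^bsub>V\<^esub> c"
    if "a \<in> carrier V" "b \<in> carrier V" "c \<in> carrier V" for a b c
    using that by (simp add: a_minus_def V.a_assoc V.r_neg1)
  have swap: "b \<ominus>\<^bsub>V\<^esub> a \<in> N" if "a \<ominus>\<^bsub>V\<^esub> b \<in> N" "a \<in> carrier V" "b \<in> carrier V" for a b
    using Nneg[OF that(1)] that by (simp add: a_minus_def V.minus_add V.a_comm)
  have r_eq: "r v = r w \<longleftrightarrow> v \<ominus>\<^bsub>V\<^esub> w \<in> N" if "v \<in> carrier V" "w \<in> carrier V" for v w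
  proof
    assume "r v = r w"
    then have "v \<ominus>\<^bsub>V\<^esub> r v \<in> N" "r v \<ominus>\<^bsub>V\<^esub> w \<in> N" using r[OF that(1)] r[OF that(2)] swap that by auto
    then show "v \<ominus>\<^bsub>V\<^esub> w \<in> N" using sum[of v "r v" w] r that N.m_closed by metis
  next
    assume vw: "v \<ominus>\<^bsub>V\<^esub> w \<in> N"
    have "v \<ominus>\<^bsub>V\<^esub> x \<in> N \<longleftrightarrow> w \<ominus>\<^bsub>V\<^esub> x \<in> N" if "x \<in> carrier V" for x
      using sum[of v w x] sum[of w v x] N.m_closed vw swap[OF vw] that \<open>v \<in> carrier V\<close> \<open>w \<in> carrier V\<close> by metis
    then show "r v = r w" unfolding r_def by metis
  qed
  define q where "q v = code (r v)" for v
  have q_eq: "q v = q w \<longleftrightarrow> v \<ominus>\<^bsub>V\<^esub> w \<in> N" if "v \<in> carrier V" "w \<in> carrier V" for v w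
    unfolding q_def using that r_eq r(1) code by (auto simp: inj_on_eq_iff)
  define s where "s y = (SOME v. v \<in> carrier V \<and> q v = y)" for y
  have s: "s (q v) \<in> carrier V" "q (s (q v)) = q v" if "v \<in> carrier V" for v
    using someI_ex[of "\<lambda>w. w \<in> carrier V \<and> q w = q v"] that unfolding s_def by auto
  define W :: "('k, 't) module" where
    "W = \<lparr>carrier = q ` carrier V, monoid.mult = (\<lambda>x y. x), one = q \<zero>\<^bsub>V\<^esub>, zero = q \<zero>\<^bsub>V\<^esub>,
      add = (\<lambda>x y. q (s x \<oplus>\<^bsub>V\<^esub> s y)), smult = (\<lambda>c x. q (c \<odot>\<^bsub>V\<^esub> s x))\<rparr>"
  have q: "linear_map K V W q"
  proof (rule linear_map_on_image)
    show "vectorspace K V" by unfold_locales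
    show "q (v \<oplus>\<^bsub>V\<^esub> w) = q v \<oplus>\<^bsub>W\<^esub> q w" if "v \<in> carrier V" "w \<in> carrier V" for v w
    proof -
      have "v \<ominus>\<^bsub>V\<^esub> s (q v) \<in> N" "w \<ominus>\<^bsub>V\<^esub> s (q w) \<in> N" using q_eq s that by metis+
      then have "(v \<ominus>\<^bsub>V\<^esub> s (q v)) \<oplus>\<^bsub>V\<^esub> (w \<ominus>\<^bsub>V\<^esub> s (q w)) \<in> N" by (rule N.m_closed)
      moreover have "(v \<ominus>\<^bsub>V\<^esub> s (q v)) \<oplus>\<^bsub>V\<^esub> (w \<ominus>\<^bsub>V\<^esub> s (q w)) = (v \<oplus>\<^bsub>V\<^esub> w) \<ominus>\<^bsub>V\<^esub> (s (q v) \<oplus>\<^bsub>V\<^esub> s (q w))"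
        using that s(1) by (simp add: a_minus_def V.minus_add V.a_ac)
      ultimately show ?thesis unfolding W_def using q_eq[of "v \<oplus>\<^bsub>V\<^esub> w" "s (q v) \<oplus>\<^bsub>V\<^esub> s (q w)"] that s(1) by simp
    qed
    show "q (c \<odot>\<^bsub>V\<^esub> v) = c \<odot>\<^bsub>W\<^esub> q v" if "c \<in> carrier K" "v \<in> carrier V" for c v
    proof -
      have "v \<ominus>\<^bsub>V\<^esub> s (q v) \<in> N" using q_eq s that by metis
      then have "c \<odot>\<^bsub>V\<^esub> (v \<ominus>\<^bsub>V\<^esub> s (q v)) \<in> N" using that(1) by (rule_tac N.smult_closed)
      moreover have "c \<odot>\<^bsub>V\<^esub> (v \<ominus>\<^bsub>V\<^esub> s (q v)) = c \<odot>\<^bsub>V\<^esub> v \<ominus>\<^bsub>V\<^esub> c \<odot>\<^bsub>V\<^esub> s (q v)"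
        using that s(1) by (simp add: a_minus_def V.smult_r_distr V.smult_r_minus)
      ultimately show ?thesis unfolding W_def using q_eq[of "c \<odot>\<^bsub>V\<^esub> v" "c \<odot>\<^bsub>V\<^esub> s (q v)"] that s(1) by simp
    qed
  qed (auto simp: W_def)
  have im: "q ` carrier V = carrier W" by (simp add: W_def)
  have "q v = \<zero>\<^bsub>W\<^esub> \<longleftrightarrow> v \<in> N" if "v \<in> carrier V" for v
    using q_eq[of v "\<zero>\<^bsub>V\<^esub>"] that V.minus_equality[of "\<zero>\<^bsub>V\<^esub>" "\<zero>\<^bsub>V\<^esub>"]
    by (simp add: W_def a_minus_def)
  with that[OF q im fin_dim_linear_image[OF q im]] V show ?thesis by blast
qed

text \<open>
  The coordinates with respect to a finite generating set determine a vector.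
\<close>

lemma fd_space_list_code:
  fixes V :: "('k, 'u) module"
  assumes "fd_space K V"
  obtains code :: "'u \<Rightarrow> 'k list" where "inj_on code (carrier V)"
proof -
  interpret V: vectorspace K V using assms by simp
  obtain A where A: "finite A" "A \<subseteq> carrier V" "V.span A = carrier V"
    using assms unfolding V.fin_dim_def by auto
  obtain xs where xs: "set xs = A" using A(1) finite_list by blast
  have "\<exists>a. a \<in> A \<rightarrow> carrier K \<and> V.lincomb a A = v" if "v \<in> carrier V" for v
    using V.finite_in_span[OF A(1,2), of v] that A(3) by auto
  then obtain c where c: "\<And>v. v \<in> carrier V \<Longrightarrow> c v \<in> A \<rightarrow> carrier K \<and> V.lincomb (c v) A = v" by metis
  have "inj_on (\<lambda>v. map (c v) xs) (carrier V)"
  proof (rule inj_onI)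
    fix v w assume *: "v \<in> carrier V" "w \<in> carrier V" "map (c v) xs = map (c w) xs"
    then have "V.lincomb (c v) A = V.lincomb (c w) A"
      using c A xs by (intro V.lincomb_cong) auto
    then show "v = w" using c * by metis
  qed
  then show ?thesis by (rule that)
qed

lemma linear_quotient_list:
  fixes V :: "('k, 'u) module"
  assumes "fd_space K V" "submodule K N V"
  obtains W :: "('k, 'k list) module" and q
  where "linear_map K V W q" "q ` carrier V = carrier W" "fd_space K W"
    and "\<And>v. v \<in> carrier V \<Longrightarrow> q v = \<zero>\<^bsub>W\<^esub> \<longleftrightarrow> v \<in> N"
  using linear_quotient_with_code[OF assms] fd_space_list_code[OF assms(1)] by metis

text \<open>
  The quotient by the zero subspace is a copy of the space with lists as elements.
\<close>

lemma linear_iso_list: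
  fixes V :: "('k, 'u) module"
  assumes V: "fd_space K V"
  obtains W :: "('k, 'k list) module" and q
  where "linear_map K V W q" "bij_betw q (carrier V) (carrier W)" "fd_space K W"
proof -
  interpret V: vectorspace K V using V by simp
  have "submodule K {\<zero>\<^bsub>V\<^esub>} V" unfolding submodule_def by (auto intro: V.module_axioms)
  then obtain W :: "('k, 'k list) module" and q where
    q: "linear_map K V W q" "q ` carrier V = carrier W" "fd_space K W"
    "\<And>v. v \<in> carrier V \<Longrightarrow> q v = \<zero>\<^bsub>W\<^esub> \<longleftrightarrow> v \<in> {\<zero>\<^bsub>V\<^esub>}"
    using linear_quotient_list[OF V] by metis
  interpret W: vectorspace K W using q(3) by simp
  have "inj_on q (carrier V)"
  proof (rule inj_onI)
    fix v w assume *: "v \<in> carrier V" "w \<in> carrier V" "q v = q w"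
    then have "q (v \<ominus>\<^bsub>V\<^esub> w) = \<zero>\<^bsub>W\<^esub>"
      using linear_mapD(3,7)[OF q(1)] W.M.minus_other_side[of "q v" "q w"] by simp
    then show "v = w" using q(4)[of "v \<ominus>\<^bsub>V\<^esub> w"] * by simp
  qed
  then show ?thesis using q that by (simp add: bij_betw_def)
qed

lemma vectorspace_self_space: "field K \<Longrightarrow> vectorspace K (self_space K)"
proof -
  assume "field K"
  then interpret field K .
  show ?thesis
  proof (rule vs_criteria)
    show "\<forall>v\<in>carrier (self_space K). \<exists>neg_v\<in>carrier (self_space K). v \<oplus>\<^bsub>self_space K\<^esub> neg_v = \<zero>\<^bsub>self_space K\<^esub>"
      by (auto simp: self_space_def intro!: r_neg bexI[of _ "\<ominus>\<^bsub>K\<^esub> _"])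
  qed (auto simp: self_space_def m_assoc a_assoc l_distr r_distr intro: field_axioms a_comm)
qed

lemma self_space_simps [simp]:
  "carrier (self_space K) = carrier K" "\<zero>\<^bsub>self_space K\<^esub> = \<zero>\<^bsub>K\<^esub>"
  "x \<oplus>\<^bsub>self_space K\<^esub> y = x \<oplus>\<^bsub>K\<^esub> y" "c \<odot>\<^bsub>self_space K\<^esub> y = c \<otimes>\<^bsub>K\<^esub> y"
  by (simp_all add: self_space_def)

abbreviation functional :: "'k ring \<Rightarrow> ('k, 'u) module \<Rightarrow> ('u \<Rightarrow> 'k) \<Rightarrow> bool" where
  "functional K V f \<equiv> linear_map K V (self_space K) f"

text \<open>
  A basis together with its coordinate functionals, in the only form in which bases enter the
  theory of tensor products below.
\<close>

lemma dual_basis: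
  fixes V :: "('k, 'u) module"
  assumes V: "fd_space K V"
  obtains A c where "finite A" "A \<subseteq> carrier V" "\<And>a. a \<in> A \<Longrightarrow> functional K V (c a)"
    and "\<And>v. v \<in> carrier V \<Longrightarrow> v = (\<Oplus>\<^bsub>V\<^esub>a\<in>A. c a v \<odot>\<^bsub>V\<^esub> a)"
proof -
  interpret V: vectorspace K V using V by simp
  obtain A where A: "finite A" "V.basis A" using V V.finite_basis_exists by auto
  have AV: "A \<subseteq> carrier V" using A(2) by (simp add: V.basis_def)
  have uniq: "\<exists>!a. a \<in> A \<rightarrow>\<^sub>E carrier K \<and> V.lincomb a A = v" if "v \<in> carrier V" for v
    using V.basis_criterion[OF A(1) AV] A(2) that by blast
  have carF: "carrier (V.func_space A) = A \<rightarrow>\<^sub>E carrier K" by (simp add: V.func_space_def)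
  have lin: "linear_map K (V.func_space A) V (\<lambda>a. V.lincomb a A)"
    by (rule V.lincomb_is_linear[OF A(1) AV])
  have bij: "bij_betw (\<lambda>a. V.lincomb a A) (carrier (V.func_space A)) (carrier V)"
  proof (rule bij_betwI')
    fix x y assume "x \<in> carrier (V.func_space A)" "y \<in> carrier (V.func_space A)"
    then show "(V.lincomb x A = V.lincomb y A) = (x = y)"
      using uniq[of "V.lincomb y A"] linear_mapD(3)[OF lin] unfolding carF by blast
  next
    show "V.lincomb x A \<in> carrier V" if "x \<in> carrier (V.func_space A)" for x
      using that linear_mapD(3)[OF lin] by blast
    show "\<exists>x\<in>carrier (V.func_space A). y = V.lincomb x A" if "y \<in> carrier V" for y
      using uniq[OF that] unfolding carF by blast
  qed
  define g where "g = the_inv_into (carrier (V.func_space A)) (\<lambda>a. V.lincomb a A)"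
  have g: "linear_map K V (V.func_space A) g" unfolding g_def by (rule linear_map_bij_inverse[OF lin bij])
  have gv: "g v \<in> A \<rightarrow>\<^sub>E carrier K" "V.lincomb (g v) A = v" if "v \<in> carrier V" for v
    using linear_mapD(3)[OF g that] bij that f_the_inv_into_f_bij_betw[OF bij, of v] unfolding g_def carF by auto
  have "functional K V (\<lambda>v. g v a)" if "a \<in> A" for a
  proof (rule linear_mapI)
    show "vectorspace K V" by unfold_locales
    show "vectorspace K (self_space K)" by (intro vectorspace_self_space V.field_axioms)
    show "g v a \<in> carrier (self_space K)" if "v \<in> carrier V" for v
      using gv[OF that] \<open>a \<in> A\<close> by auto
    show "g (v \<oplus>\<^bsub>V\<^esub> w) a = g v a \<oplus>\<^bsub>self_space K\<^esub> g w a" if "v \<in> carrier V" "w \<in> carrier V" for v w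
      using linear_mapD(4)[OF g that] \<open>a \<in> A\<close> by (simp add: V.func_space_def)
    show "g (k \<odot>\<^bsub>V\<^esub> v) a = k \<odot>\<^bsub>self_space K\<^esub> g v a" if "k \<in> carrier K" "v \<in> carrier V" for k v
      using linear_mapD(5)[OF g that] \<open>a \<in> A\<close> by (simp add: V.func_space_def)
  qed
  moreover have "v = (\<Oplus>\<^bsub>V\<^esub>a\<in>A. g v a \<odot>\<^bsub>V\<^esub> a)" if "v \<in> carrier V" for v
    using gv(2)[OF that] by (simp add: V.lincomb_def)
  ultimately show ?thesis using that[of A "\<lambda>a v. g v a"] A(1) AV by blast
qed

lemma linear_map_finsum:
  assumes "finite A" "vectorspace K V" "vectorspace K W" "\<And>a. a \<in> A \<Longrightarrow> linear_map K V W (f a)"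
  shows "linear_map K V W (\<lambda>v. \<Oplus>\<^bsub>W\<^esub>a\<in>A. f a v)"
  using assms(1,4)
proof (induction A rule: finite_induct)
  case empty
  interpret W: vectorspace K W by fact
  show ?case using linear_map_zero[OF assms(2,3)] by simp
next
  case (insert a A)
  interpret W: vectorspace K W by fact
  have "linear_map K V W (\<lambda>v. f a v \<oplus>\<^bsub>W\<^esub> (\<Oplus>\<^bsub>W\<^esub>a\<in>A. f a v))"
    using insert by (intro linear_map_add) auto
  then show ?case
    by (rule linear_map_cong)
      (use insert.hyps linear_mapD(3)[OF insert.prems] in \<open>subst W.finsum_insert, auto\<close>)
qed

lemma linear_map_of_finsum:
  assumes f: "linear_map K V W f" and "finite A" "\<And>a. a \<in> A \<Longrightarrow> g a \<in> carrier V"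
  shows "f (\<Oplus>\<^bsub>V\<^esub>a\<in>A. g a) = (\<Oplus>\<^bsub>W\<^esub>a\<in>A. f (g a))"
  using assms(2,3)
proof (induction A rule: finite_induct)
  interpret V: vectorspace K V by (rule linear_mapD(1)[OF f])
  interpret W: vectorspace K W by (rule linear_mapD(2)[OF f])
  {
    case empty
    show ?case using linear_mapD(6)[OF f] by simp
  next
    case (insert a A)
    have "f (\<Oplus>\<^bsub>V\<^esub>a\<in>insert a A. g a) = f (g a \<oplus>\<^bsub>V\<^esub> (\<Oplus>\<^bsub>V\<^esub>a\<in>A. g a))"
      using insert by (subst V.finsum_insert) auto
    also have "\<dots> = f (g a) \<oplus>\<^bsub>W\<^esub> (\<Oplus>\<^bsub>W\<^esub>a\<in>A. f (g a))"
      using insert V.finsum_closed[of g A] by (subst linear_mapD(4)[OF f]) auto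
    also have "\<dots> = (\<Oplus>\<^bsub>W\<^esub>a\<in>insert a A. f (g a))"
      using insert linear_mapD(3)[OF f] by (subst W.finsum_insert) auto
    finally show ?case .
  }
qed

lemma bilinear_mapD:
  assumes "bilinear_map K V W M \<beta>"
  shows "v \<in> carrier V \<Longrightarrow> linear_map K W M (\<beta> v)"
    and "w \<in> carrier W \<Longrightarrow> linear_map K V M (\<lambda>v. \<beta> v w)"
    and "v \<in> carrier V \<Longrightarrow> w \<in> carrier W \<Longrightarrow> \<beta> v w \<in> carrier M"
  using assms linear_mapD(3)[of K W M "\<beta> v" w] unfolding bilinear_map_def by blast+

section \<open>Tensor products of vector spaces\<close>

lemma bilinear_map_expand:
  assumes \<beta>: "bilinear_map K V W M \<beta>" and v: "v \<in> carrier V" and w: "w \<in> carrier W"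
    and A: "finite A" "A \<subseteq> carrier V" "\<And>a. a \<in> A \<Longrightarrow> functional K V (c a)"
    and vA: "v = (\<Oplus>\<^bsub>V\<^esub>a\<in>A. c a v \<odot>\<^bsub>V\<^esub> a)"
    and B: "finite B" "B \<subseteq> carrier W" "\<And>b. b \<in> B \<Longrightarrow> functional K W (d b)"
    and wB: "w = (\<Oplus>\<^bsub>W\<^esub>b\<in>B. d b w \<odot>\<^bsub>W\<^esub> b)"
  shows "\<beta> v w = (\<Oplus>\<^bsub>M\<^esub>a\<in>A. \<Oplus>\<^bsub>M\<^esub>b\<in>B. (c a v \<otimes>\<^bsub>K\<^esub> d b w) \<odot>\<^bsub>M\<^esub> \<beta> a b)"
proof -
  interpret M: vectorspace K M using linear_mapD(2)[OF bilinear_mapD(1)[OF \<beta> v]] .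
  interpret V: vectorspace K V using linear_mapD(1)[OF bilinear_mapD(2)[OF \<beta> w]] .
  interpret W: vectorspace K W using linear_mapD(1)[OF bilinear_mapD(1)[OF \<beta> v]] .
  have c: "c a v \<in> carrier K" if "a \<in> A" for a using linear_mapD(3)[OF A(3)[OF that] v] by simp
  have d: "d b w \<in> carrier K" if "b \<in> B" for b using linear_mapD(3)[OF B(3)[OF that] w] by simp
  have AV: "a \<in> carrier V" if "a \<in> A" for a using that A by auto
  have BW: "b \<in> carrier W" if "b \<in> B" for b using that B by auto
  have \<beta>_ab: "\<beta> a b \<in> carrier M" if "a \<in> A" "b \<in> B" for a b
    using bilinear_mapD(3)[OF \<beta> AV BW] that .
  have \<beta>_aw: "\<beta> a w = (\<Oplus>\<^bsub>M\<^esub>b\<in>B. d b w \<odot>\<^bsub>M\<^esub> \<beta> a b)" if a: "a \<in> A" for a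
  proof -
    note \<beta>a = bilinear_mapD(1)[OF \<beta> AV[OF a]]
    have "\<beta> a w = \<beta> a (\<Oplus>\<^bsub>W\<^esub>b\<in>B. d b w \<odot>\<^bsub>W\<^esub> b)" using wB by simp
    also have "\<dots> = (\<Oplus>\<^bsub>M\<^esub>b\<in>B. \<beta> a (d b w \<odot>\<^bsub>W\<^esub> b))"
      using BW d by (intro linear_map_of_finsum[OF \<beta>a B(1)]) auto
    also have "\<dots> = (\<Oplus>\<^bsub>M\<^esub>b\<in>B. d b w \<odot>\<^bsub>M\<^esub> \<beta> a b)"
      using BW d linear_mapD(5)[OF \<beta>a] \<beta>_ab a by (intro M.finsum_cong') auto
    finally show ?thesis .
  qed
  have "\<beta> v w = \<beta> (\<Oplus>\<^bsub>V\<^esub>a\<in>A. c a v \<odot>\<^bsub>V\<^esub> a) w" using vA by simp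
  also have "\<dots> = (\<Oplus>\<^bsub>M\<^esub>a\<in>A. \<beta> (c a v \<odot>\<^bsub>V\<^esub> a) w)"
    using AV c by (intro linear_map_of_finsum[OF bilinear_mapD(2)[OF \<beta> w] A(1)]) auto
  also have "\<dots> = (\<Oplus>\<^bsub>M\<^esub>a\<in>A. \<Oplus>\<^bsub>M\<^esub>b\<in>B. (c a v \<otimes>\<^bsub>K\<^esub> d b w) \<odot>\<^bsub>M\<^esub> \<beta> a b)"
  proof (rule M.finsum_cong')
    show "(\<lambda>a. \<Oplus>\<^bsub>M\<^esub>b\<in>B. (c a v \<otimes>\<^bsub>K\<^esub> d b w) \<odot>\<^bsub>M\<^esub> \<beta> a b) \<in> A \<rightarrow> carrier M"
      using c d \<beta>_ab by (auto intro!: M.finsum_closed)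
    fix a assume a: "a \<in> A"
    have "\<beta> (c a v \<odot>\<^bsub>V\<^esub> a) w = c a v \<odot>\<^bsub>M\<^esub> \<beta> a w"
      using linear_mapD(5)[OF bilinear_mapD(2)[OF \<beta> w]] c AV a by simp
    also have "\<dots> = (\<Oplus>\<^bsub>M\<^esub>b\<in>B. c a v \<odot>\<^bsub>M\<^esub> (d b w \<odot>\<^bsub>M\<^esub> \<beta> a b))"
      unfolding \<beta>_aw[OF a] using c[OF a] d \<beta>_ab a by (intro M.finsum_smult) auto
    also have "\<dots> = (\<Oplus>\<^bsub>M\<^esub>b\<in>B. (c a v \<otimes>\<^bsub>K\<^esub> d b w) \<odot>\<^bsub>M\<^esub> \<beta> a b)"
      using c[OF a] d \<beta>_ab a by (intro M.finsum_cong') (auto simp: M.smult_assoc1)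
    finally show "\<beta> (c a v \<odot>\<^bsub>V\<^esub> a) w = (\<Oplus>\<^bsub>M\<^esub>b\<in>B. (c a v \<otimes>\<^bsub>K\<^esub> d b w) \<odot>\<^bsub>M\<^esub> \<beta> a b)" .
  qed simp
  finally show ?thesis .
qed

text \<open>
  Pure tensors absorb scalars, so their sums already exhaust the tensor product. Using sums
  instead of linear combinations spares the scalar case in inductions over tensors.
\<close>

inductive_set sum_closure :: "('a \<Rightarrow> 'a \<Rightarrow> 'a) \<Rightarrow> 'a set \<Rightarrow> 'a set" for plus S where
  base: "x \<in> S \<Longrightarrow> x \<in> sum_closure plus S"
| step: "x \<in> sum_closure plus S \<Longrightarrow> y \<in> sum_closure plus S \<Longrightarrow> plus x y \<in> sum_closure plus S"

text \<open>
  An intrinsic description of tensor products: pure tensors generate \<open>T\<close>, and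
  there are enough functionals on \<open>T\<close> to keep them apart, namely the products
  \<open>f \<otimes> g\<close>. The universal property
  \<^const>\<open>is_tensor_product\<close> speaks only about targets whose elements have the
  type of those of \<open>T\<close>, which is not invariant under isomorphism across types;
  this description mentions no other spaces and so may be used for spaces with elements of any
  types. For finite-dimensional spaces of lists the two notions agree
  (\<open>tensor_presentation_is_tensor_product\<close>,
  \<open>is_tensor_product_tensor_presentation\<close>).
\<close>

definition tensor_presentation :: "'k ring \<Rightarrow> ('k, 'u) module \<Rightarrow> ('k, 'w) module \<Rightarrow> ('k, 't) module \<Rightarrow>
    ('u \<Rightarrow> 'w \<Rightarrow> 't) \<Rightarrow> bool" where
  "tensor_presentation K V W T \<tau> \<longleftrightarrow> vectorspace K V \<and> vectorspace K W \<and> vectorspace K T \<and>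
    bilinear_map K V W T \<tau> \<and>
    carrier T \<subseteq> sum_closure (\<oplus>\<^bsub>T\<^esub>) {\<tau> v w | v w. v \<in> carrier V \<and> w \<in> carrier W} \<and>
    (\<forall>f g. functional K V f \<longrightarrow> functional K W g \<longrightarrow>
      (\<exists>h. functional K T h \<and> (\<forall>v\<in>carrier V. \<forall>w\<in>carrier W. h (\<tau> v w) = f v \<otimes>\<^bsub>K\<^esub> g w)))"

lemma tensor_presentationD:
  assumes "tensor_presentation K V W T \<tau>"
  shows "vectorspace K V" "vectorspace K W" "vectorspace K T" "bilinear_map K V W T \<tau>"
    and "v \<in> carrier V \<Longrightarrow> w \<in> carrier W \<Longrightarrow> \<tau> v w \<in> carrier T"
    and "functional K V f \<Longrightarrow> functional K W g \<Longrightarrow>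
      \<exists>h. functional K T h \<and> (\<forall>v\<in>carrier V. \<forall>w\<in>carrier W. h (\<tau> v w) = f v \<otimes>\<^bsub>K\<^esub> g w)"
  using assms bilinear_mapD(3)[of K V W T \<tau> v w] unfolding tensor_presentation_def by auto

lemma tensor_induct [consumes 2, case_names pure add]:
  assumes \<tau>: "tensor_presentation K V W T \<tau>" and t: "t \<in> carrier T"
    and pure: "\<And>v w. v \<in> carrier V \<Longrightarrow> w \<in> carrier W \<Longrightarrow> P (\<tau> v w)"
    and add: "\<And>s t. s \<in> carrier T \<Longrightarrow> t \<in> carrier T \<Longrightarrow> P s \<Longrightarrow> P t \<Longrightarrow> P (s \<oplus>\<^bsub>T\<^esub> t)"
  shows "P t"
proof -
  note T = tensor_presentationD[OF \<tau>]
  have "t \<in> sum_closure (\<oplus>\<^bsub>T\<^esub>) {\<tau> v w | v w. v \<in> carrier V \<and> w \<in> carrier W}"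
    using \<tau> t unfolding tensor_presentation_def by auto
  then have "t \<in> carrier T \<and> P t"
    by (induction rule: sum_closure.induct) (use T(5) pure add vectorspaceD(3)[OF T(3)] in auto)
  then show ?thesis by blast
qed

lemma tensor_linear_maps_eq:
  assumes \<tau>: "tensor_presentation K V W T \<tau>" and "linear_map K T M \<phi>" "linear_map K T M \<psi>"
    and "\<And>v w. v \<in> carrier V \<Longrightarrow> w \<in> carrier W \<Longrightarrow> \<phi> (\<tau> v w) = \<psi> (\<tau> v w)" and "t \<in> carrier T"
  shows "\<phi> t = \<psi> t"
  using \<tau> assms(5)
  by (induction rule: tensor_induct) (simp_all add: assms(4) linear_mapD(4)[OF assms(2)] linear_mapD(4)[OF assms(3)])

text \<open>
  With dual bases \<open>(a, c\<^sub>a)\<close> and \<open>(b, d\<^sub>b)\<close> of the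
  factors, the map that sends \<open>t\<close> to the sum of the \<open>(c\<^sub>a \<otimes>
  d\<^sub>b)(t)\<close>-fold of \<open>\<beta> a b\<close> is the factorization of
  \<open>\<beta>\<close>.
\<close>

lemma tensor_lift:
  assumes \<tau>: "tensor_presentation K V W T \<tau>" and V: "fd_space K V" and W: "fd_space K W"
    and \<beta>: "bilinear_map K V W M \<beta>" and M: "vectorspace K M"
  obtains \<phi> where "linear_map K T M \<phi>"
    and "\<And>v w. v \<in> carrier V \<Longrightarrow> w \<in> carrier W \<Longrightarrow> \<phi> (\<tau> v w) = \<beta> v w"
proof -
  note T = tensor_presentationD[OF \<tau>]
  obtain A c where A: "finite A" "A \<subseteq> carrier V" "\<And>a. a \<in> A \<Longrightarrow> functional K V (c a)"
    "\<And>v. v \<in> carrier V \<Longrightarrow> v = (\<Oplus>\<^bsub>V\<^esub>a\<in>A. c a v \<odot>\<^bsub>V\<^esub> a)" by (rule dual_basis[OF V]) blast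
  obtain B d where B: "finite B" "B \<subseteq> carrier W" "\<And>b. b \<in> B \<Longrightarrow> functional K W (d b)"
    "\<And>w. w \<in> carrier W \<Longrightarrow> w = (\<Oplus>\<^bsub>W\<^esub>b\<in>B. d b w \<odot>\<^bsub>W\<^esub> b)" by (rule dual_basis[OF W]) blast
  have "\<forall>a\<in>A. \<forall>b\<in>B. \<exists>h. functional K T h \<and> (\<forall>v\<in>carrier V. \<forall>w\<in>carrier W. h (\<tau> v w) = c a v \<otimes>\<^bsub>K\<^esub> d b w)"
    using T(6) A(3) B(3) by blast
  then obtain h where h: "\<And>a b. a \<in> A \<Longrightarrow> b \<in> B \<Longrightarrow> functional K T (h a b)"
    "\<And>a b v w. a \<in> A \<Longrightarrow> b \<in> B \<Longrightarrow> v \<in> carrier V \<Longrightarrow> w \<in> carrier W \<Longrightarrow> h a b (\<tau> v w) = c a v \<otimes>\<^bsub>K\<^esub> d b w"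
    by metis
  define \<phi> where "\<phi> t = (\<Oplus>\<^bsub>M\<^esub>a\<in>A. \<Oplus>\<^bsub>M\<^esub>b\<in>B. h a b t \<odot>\<^bsub>M\<^esub> \<beta> a b)" for t
  interpret M: vectorspace K M by fact
  have \<beta>_ab: "\<beta> a b \<in> carrier M" if "a \<in> A" "b \<in> B" for a b
    using bilinear_mapD(3)[OF \<beta>] that A(2) B(2) by blast
  have "linear_map K T M (\<lambda>t. h a b t \<odot>\<^bsub>M\<^esub> \<beta> a b)" if "a \<in> A" "b \<in> B" for a b
    using linear_mapD(3-5)[OF h(1)[OF that]] \<beta>_ab[OF that]
    by (intro linear_mapI T(3) M) (simp_all add: M.smult_l_distr M.smult_assoc1)
  then have "linear_map K T M \<phi>"
    unfolding \<phi>_def using A(1) B(1) T(3) M by (intro linear_map_finsum) auto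
  moreover have "\<phi> (\<tau> v w) = \<beta> v w" if v: "v \<in> carrier V" and w: "w \<in> carrier W" for v w
  proof -
    have cd: "c a v \<in> carrier K" "d b w \<in> carrier K" if "a \<in> A" "b \<in> B" for a b
      using linear_mapD(3)[OF A(3)[OF that(1)] v] linear_mapD(3)[OF B(3)[OF that(2)] w] by simp_all
    have "\<phi> (\<tau> v w) = (\<Oplus>\<^bsub>M\<^esub>a\<in>A. \<Oplus>\<^bsub>M\<^esub>b\<in>B. (c a v \<otimes>\<^bsub>K\<^esub> d b w) \<odot>\<^bsub>M\<^esub> \<beta> a b)"
      unfolding \<phi>_def using cd \<beta>_ab h(2)[OF _ _ v w]
      by (intro M.finsum_cong') (auto intro!: M.finsum_closed M.finsum_cong')
    also have "\<dots> = \<beta> v w"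
      using bilinear_map_expand[OF \<beta> v w A(1-3) A(4)[OF v] B(1-3) B(4)[OF w]] by simp
    finally show ?thesis .
  qed
  ultimately show ?thesis by (rule that)
qed

lemma finsum_in_submodule:
  assumes "vectorspace K V" "submodule K N V" "finite A" "\<And>a. a \<in> A \<Longrightarrow> g a \<in> N"
  shows "(\<Oplus>\<^bsub>V\<^esub>a\<in>A. g a) \<in> N"
  using assms(3,4)
proof (induction A rule: finite_induct)
  interpret V: vectorspace K V by fact
  interpret N: submodule K N V by fact
  {
    case empty
    then show ?case using N.zero_closed by simp
  next
    case (insert a A)
    then show ?case using N.subset N.m_closed by (subst V.finsum_insert) auto
  }
qed

lemma tensor_fin_dim:
  assumes \<tau>: "tensor_presentation K V W T \<tau>" and V: "fd_space K V" and W: "fd_space K W"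
  shows "fd_space K T"
proof -
  note T = tensor_presentationD[OF \<tau>]
  interpret T: vectorspace K T by (rule T(3))
  obtain A c where A: "finite A" "A \<subseteq> carrier V" "\<And>a. a \<in> A \<Longrightarrow> functional K V (c a)"
    "\<And>v. v \<in> carrier V \<Longrightarrow> v = (\<Oplus>\<^bsub>V\<^esub>a\<in>A. c a v \<odot>\<^bsub>V\<^esub> a)" by (rule dual_basis[OF V]) blast
  obtain B d where B: "finite B" "B \<subseteq> carrier W" "\<And>b. b \<in> B \<Longrightarrow> functional K W (d b)"
    "\<And>w. w \<in> carrier W \<Longrightarrow> w = (\<Oplus>\<^bsub>W\<^esub>b\<in>B. d b w \<odot>\<^bsub>W\<^esub> b)" by (rule dual_basis[OF W]) blast
  let ?S = "(\<lambda>(a, b). \<tau> a b) ` (A \<times> B)"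
  have S: "?S \<subseteq> carrier T" using A(2) B(2) T(5) by auto
  have span: "submodule K (T.span ?S) T" by (rule T.span_is_submodule[OF S])
  interpret S: submodule K "T.span ?S" T by (rule span)
  have field: "field K" by unfold_locales
  interpret K: field K by fact
  have "t \<in> T.span ?S" if "t \<in> carrier T" for t
    using \<tau> that
  proof (induction rule: tensor_induct)
    case (pure v w)
    have "c a v \<otimes>\<^bsub>K\<^esub> d b w \<in> carrier K" if "a \<in> A" "b \<in> B" for a b
      using linear_mapD(3)[OF A(3)[OF that(1)] pure(1)] linear_mapD(3)[OF B(3)[OF that(2)] pure(2)] by simp
    moreover have "\<tau> a b \<in> T.span ?S" if "a \<in> A" "b \<in> B" for a b
      using T.in_own_span[OF S] that by auto
    ultimately show ?case
      using A(1) B(1)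
      by (subst bilinear_map_expand[OF T(4) pure A(1-3) A(4)[OF pure(1)] B(1-3) B(4)[OF pure(2)]])
        (auto intro!: finsum_in_submodule[OF T(3) span] S.smult_closed)
  next
    case (add s t)
    then show ?case by (intro S.m_closed)
  qed
  then have "T.gen_set ?S" using T.span_is_subset2[OF S] by auto
  then have "T.fin_dim" unfolding T.fin_dim_def using A(1) B(1) S by (intro exI[of _ ?S]) auto
  then show ?thesis using T(3) by simp
qed

lemma tensor_presentation_iso:
  assumes \<tau>: "tensor_presentation K V W T \<tau>"
    and \<alpha>: "linear_map K V' V \<alpha>" "bij_betw \<alpha> (carrier V') (carrier V)"
    and \<beta>: "linear_map K W' W \<beta>" "bij_betw \<beta> (carrier W') (carrier W)"
    and \<gamma>: "linear_map K T T' \<gamma>" "bij_betw \<gamma> (carrier T) (carrier T')"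
    and \<sigma>: "\<And>v w. v \<in> carrier V' \<Longrightarrow> w \<in> carrier W' \<Longrightarrow> \<sigma> v w = \<gamma> (\<tau> (\<alpha> v) (\<beta> w))"
  shows "tensor_presentation K V' W' T' \<sigma>"
proof -
  note T = tensor_presentationD[OF \<tau>]
  define \<alpha>' where "\<alpha>' = the_inv_into (carrier V') \<alpha>"
  define \<beta>' where "\<beta>' = the_inv_into (carrier W') \<beta>"
  define \<gamma>' where "\<gamma>' = the_inv_into (carrier T) \<gamma>"
  have \<alpha>': "linear_map K V V' \<alpha>'" "\<And>v. v \<in> carrier V' \<Longrightarrow> \<alpha>' (\<alpha> v) = v" "\<And>v. v \<in> carrier V \<Longrightarrow> \<alpha> (\<alpha>' v) = v"
    unfolding \<alpha>'_def using linear_map_bij_inverse[OF \<alpha>] \<alpha>(2)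
    by (simp_all add: the_inv_into_f_f[OF bij_betw_imp_inj_on] f_the_inv_into_f_bij_betw)
  have \<beta>': "linear_map K W W' \<beta>'" "\<And>v. v \<in> carrier W' \<Longrightarrow> \<beta>' (\<beta> v) = v" "\<And>v. v \<in> carrier W \<Longrightarrow> \<beta> (\<beta>' v) = v"
    unfolding \<beta>'_def using linear_map_bij_inverse[OF \<beta>] \<beta>(2)
    by (simp_all add: the_inv_into_f_f[OF bij_betw_imp_inj_on] f_the_inv_into_f_bij_betw)
  have \<gamma>': "linear_map K T' T \<gamma>'" "\<And>v. v \<in> carrier T \<Longrightarrow> \<gamma>' (\<gamma> v) = v" "\<And>v. v \<in> carrier T' \<Longrightarrow> \<gamma> (\<gamma>' v) = v"
    unfolding \<gamma>'_def using linear_map_bij_inverse[OF \<gamma>] \<gamma>(2)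
    by (simp_all add: the_inv_into_f_f[OF bij_betw_imp_inj_on] f_the_inv_into_f_bij_betw)
  show ?thesis unfolding tensor_presentation_def
  proof (intro conjI allI impI)
    show "vectorspace K V'" "vectorspace K W'" "vectorspace K T'"
      using linear_mapD(1)[OF \<alpha>(1)] linear_mapD(1)[OF \<beta>(1)] linear_mapD(2)[OF \<gamma>(1)] .
    show "bilinear_map K V' W' T' \<sigma>" unfolding bilinear_map_def
    proof (intro conjI ballI)
      fix v assume v: "v \<in> carrier V'"
      show "linear_map K W' T' (\<sigma> v)"
        using linear_map_comp[OF linear_map_comp[OF \<beta>(1) bilinear_mapD(1)[OF T(4) linear_mapD(3)[OF \<alpha>(1) v]]] \<gamma>(1)]
        by (rule linear_map_cong) (simp add: \<sigma> v)
    next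
      fix w assume w: "w \<in> carrier W'"
      show "linear_map K V' T' (\<lambda>v. \<sigma> v w)"
        using linear_map_comp[OF linear_map_comp[OF \<alpha>(1) bilinear_mapD(2)[OF T(4) linear_mapD(3)[OF \<beta>(1) w]]] \<gamma>(1)]
        by (rule linear_map_cong) (simp add: \<sigma> w)
    qed
    show "carrier T' \<subseteq> sum_closure (\<oplus>\<^bsub>T'\<^esub>) {\<sigma> v w | v w. v \<in> carrier V' \<and> w \<in> carrier W'}" (is "_ \<subseteq> ?X")
    proof
      fix t' assume t': "t' \<in> carrier T'"
      have "\<gamma> t \<in> ?X" if "t \<in> carrier T" for t
        using \<tau> that
      proof (induction rule: tensor_induct)
        case (pure v w)
        then have "\<gamma> (\<tau> v w) = \<sigma> (\<alpha>' v) (\<beta>' w)"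
          using \<alpha>' \<beta>' linear_mapD(3)[OF \<alpha>'(1)] linear_mapD(3)[OF \<beta>'(1)] by (simp add: \<sigma>)
        then show ?case using pure linear_mapD(3)[OF \<alpha>'(1)] linear_mapD(3)[OF \<beta>'(1)]
          by (intro sum_closure.base) blast
      next
        case (add s t)
        then show ?case by (simp add: linear_mapD(4)[OF \<gamma>(1)] sum_closure.step)
      qed
      from this[of "\<gamma>' t'"] show "t' \<in> ?X" using \<gamma>' t' linear_mapD(3)[OF \<gamma>'(1)] by simp
    qed
    fix f g assume fg: "functional K V' f" "functional K W' g"
    obtain h where h: "functional K T h"
      "\<And>v w. v \<in> carrier V \<Longrightarrow> w \<in> carrier W \<Longrightarrow> h (\<tau> v w) = f (\<alpha>' v) \<otimes>\<^bsub>K\<^esub> g (\<beta>' w)"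
      using T(6)[OF linear_map_comp[OF \<alpha>'(1) fg(1)] linear_map_comp[OF \<beta>'(1) fg(2)]] by blast
    have "h (\<gamma>' (\<sigma> v w)) = f v \<otimes>\<^bsub>K\<^esub> g w" if "v \<in> carrier V'" "w \<in> carrier W'" for v w
      using that linear_mapD(3)[OF \<alpha>(1)] linear_mapD(3)[OF \<beta>(1)] by (simp add: \<sigma> \<gamma>' T(5) h(2) \<alpha>' \<beta>')
    then show "\<exists>h. functional K T' h \<and> (\<forall>v\<in>carrier V'. \<forall>w\<in>carrier W'. h (\<sigma> v w) = f v \<otimes>\<^bsub>K\<^esub> g w)"
      using linear_map_comp[OF \<gamma>'(1) h(1)] by blast
  qed
qed

lemma bij_betw_self: "bij_betw (\<lambda>v. v) A A"
  by (simp add: bij_betw_def inj_on_def)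

text \<open>
  Inside the space of functions on pairs of functionals, take the sums of the functions
  \<open>(f, g) \<mapsto> f(v) g(w)\<close>. Evaluation at \<open>(f, g)\<close> is the
  required product functional. The resulting space is finite-dimensional and hence has a copy
  whose elements are lists.
\<close>

lemma tensor_presentation_exists:
  fixes V :: "('k, 'u) module" and W :: "('k, 'w) module"
  assumes V: "fd_space K V" and W: "fd_space K W"
  obtains T :: "('k, 'k list) module" and \<tau> where "tensor_presentation K V W T \<tau>"
proof -
  interpret V: vectorspace K V using V by simp
  interpret W: vectorspace K W using W by simp
  define D where "D = {(f, g). functional K V f \<and> functional K W g}"
  let ?F = "V.func_space D"
  define \<tau> where "\<tau> v w = (\<lambda>(f, g)\<in>D. f v \<otimes>\<^bsub>K\<^esub> g w)" for v w
  define X where "X = sum_closure (\<oplus>\<^bsub>?F\<^esub>) {\<tau> v w | v w. v \<in> carrier V \<and> w \<in> carrier W}"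
  define T where "T = ?F\<lparr>carrier := X\<rparr>"
  interpret F: vectorspace K ?F by (rule V.func_space_is_vs)
  have DK: "f v \<in> carrier K" "g w \<in> carrier K" if "(f, g) \<in> D" "v \<in> carrier V" "w \<in> carrier W" for f g v w
    using that linear_mapD(3)[of K V "self_space K" f v] linear_mapD(3)[of K W "self_space K" g w] unfolding D_def by auto
  have \<tau>F: "\<tau> v w \<in> carrier ?F" if "v \<in> carrier V" "w \<in> carrier W" for v w
    using DK that by (auto simp: \<tau>_def V.func_space_def)
  have bl: "\<tau> (v \<oplus>\<^bsub>V\<^esub> v') w = \<tau> v w \<oplus>\<^bsub>?F\<^esub> \<tau> v' w" if "v \<in> carrier V" "v' \<in> carrier V" "w \<in> carrier W" for v v' w
    using that DK
    by (auto simp: \<tau>_def V.func_space_def D_def linear_mapD(4)[where W = "self_space K"] V.R.l_distr intro!: restrict_ext)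
  have br: "\<tau> v (w \<oplus>\<^bsub>W\<^esub> w') = \<tau> v w \<oplus>\<^bsub>?F\<^esub> \<tau> v w'" if "v \<in> carrier V" "w \<in> carrier W" "w' \<in> carrier W" for v w w'
    using that DK
    by (auto simp: \<tau>_def V.func_space_def D_def linear_mapD(4)[where W = "self_space K"] V.R.r_distr intro!: restrict_ext)
  have sl: "\<tau> (c \<odot>\<^bsub>V\<^esub> v) w = c \<odot>\<^bsub>?F\<^esub> \<tau> v w" if "v \<in> carrier V" "c \<in> carrier K" "w \<in> carrier W" for v c w
    using that DK
    by (auto simp: \<tau>_def V.func_space_def D_def linear_mapD(5)[where W = "self_space K"] V.R.m_assoc intro!: restrict_ext)
  have sr: "\<tau> v (c \<odot>\<^bsub>W\<^esub> w) = c \<odot>\<^bsub>?F\<^esub> \<tau> v w" if "v \<in> carrier V" "c \<in> carrier K" "w \<in> carrier W" for v c w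
    using that DK
    by (auto simp: \<tau>_def V.func_space_def D_def linear_mapD(5)[where W = "self_space K"] V.R.m_lcomm intro!: restrict_ext)
  have XF: "x \<in> carrier ?F" if "x \<in> X" for x
    using that unfolding X_def by (induction rule: sum_closure.induct) (auto intro: \<tau>F F.a_closed)
  have pureX: "\<tau> v w \<in> X" if "v \<in> carrier V" "w \<in> carrier W" for v w
    unfolding X_def using that by (intro sum_closure.base) blast
  have "submodule K X ?F"
  proof (unfold submodule_def, intro conjI allI impI)
    show "Module.module K ?F" by unfold_locales
    show "X \<subseteq> carrier ?F" using XF by blast
    show "v \<oplus>\<^bsub>?F\<^esub> w \<in> X" if "v \<in> X" "w \<in> X" for v w
      using that unfolding X_def by (rule sum_closure.step)
    have "\<tau> (\<zero>\<^bsub>K\<^esub> \<odot>\<^bsub>V\<^esub> \<zero>\<^bsub>V\<^esub>) \<zero>\<^bsub>W\<^esub> = \<zero>\<^bsub>?F\<^esub>"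
      using sl[of "\<zero>\<^bsub>V\<^esub>" "\<zero>\<^bsub>K\<^esub>" "\<zero>\<^bsub>W\<^esub>"] \<tau>F[of "\<zero>\<^bsub>V\<^esub>" "\<zero>\<^bsub>W\<^esub>"] F.lmult_0 by simp
    then show "\<zero>\<^bsub>?F\<^esub> \<in> X" using pureX[of "\<zero>\<^bsub>K\<^esub> \<odot>\<^bsub>V\<^esub> \<zero>\<^bsub>V\<^esub>" "\<zero>\<^bsub>W\<^esub>"] by simp
    show "c \<odot>\<^bsub>?F\<^esub> x \<in> X" if c: "c \<in> carrier K" and "x \<in> X" for c x
      using that(2) unfolding X_def
    proof (induction rule: sum_closure.induct)
      case (base x)
      then obtain v w where "v \<in> carrier V" "w \<in> carrier W" "x = \<tau> v w" by blast
      then show ?case using pureX[of "c \<odot>\<^bsub>V\<^esub> v" w] sl c unfolding X_def by simp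
    next
      case (step x y)
      then show ?case
        using F.smult_r_distr[OF c XF[of x] XF[of y]] sum_closure.step[of "c \<odot>\<^bsub>?F\<^esub> x" _ _ "c \<odot>\<^bsub>?F\<^esub> y"]
        unfolding X_def by simp
    qed
  qed
  then have T: "vectorspace K T" unfolding T_def
    by (intro F.subspace_is_vs) (simp add: VectorSpace.subspace_def F.vectorspace_axioms)
  have pres: "tensor_presentation K V W T \<tau>" unfolding tensor_presentation_def
  proof (intro conjI allI impI)
    show "vectorspace K V" "vectorspace K W" "vectorspace K T" using V W T by simp_all
    show "bilinear_map K V W T \<tau>" unfolding bilinear_map_def
      using V W T pureX bl br sl sr by (auto simp: T_def intro!: linear_mapI)
    show "carrier T \<subseteq> sum_closure (\<oplus>\<^bsub>T\<^esub>) {\<tau> v w | v w. v \<in> carrier V \<and> w \<in> carrier W}"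
      by (simp add: T_def X_def)
    fix f g assume fg: "functional K V f" "functional K W g"
    then have D: "(f, g) \<in> D" by (simp add: D_def)
    have "functional K T (\<lambda>t. t (f, g))"
    proof (rule linear_mapI[OF T linear_mapD(2)[OF fg(1)]])
      show "t (f, g) \<in> carrier (self_space K)" if "t \<in> carrier T" for t
        using XF[of t] that D by (auto simp: T_def V.func_space_def)
    qed (use D in \<open>simp_all add: T_def V.func_space_def\<close>)
    moreover have "\<tau> v w (f, g) = f v \<otimes>\<^bsub>K\<^esub> g w" for v w using D by (simp add: \<tau>_def)
    ultimately show "\<exists>h. functional K T h \<and> (\<forall>v\<in>carrier V. \<forall>w\<in>carrier W. h (\<tau> v w) = f v \<otimes>\<^bsub>K\<^esub> g w)"
      by blast
  qed
  obtain T' :: "('k, 'k list) module" and q where q: "linear_map K T T' q" "bij_betw q (carrier T) (carrier T')"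
    using linear_iso_list[OF tensor_fin_dim[OF pres V W]] by metis
  have "tensor_presentation K V W T' (\<lambda>v w. q (\<tau> v w))"
    using V W by (intro tensor_presentation_iso[OF pres linear_map_id bij_betw_self linear_map_id bij_betw_self q]) simp_all
  then show ?thesis by (rule that)
qed

lemma tensor_unique:
  assumes \<tau>: "tensor_presentation K V W T \<tau>" and \<tau>': "tensor_presentation K V W T' \<tau>'"
    and V: "fd_space K V" and W: "fd_space K W"
  obtains \<phi> where "linear_map K T T' \<phi>" "bij_betw \<phi> (carrier T) (carrier T')"
    and "\<And>v w. v \<in> carrier V \<Longrightarrow> w \<in> carrier W \<Longrightarrow> \<phi> (\<tau> v w) = \<tau>' v w"
proof -
  note T = tensor_presentationD[OF \<tau>] and T' = tensor_presentationD[OF \<tau>']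
  obtain \<phi> where \<phi>: "linear_map K T T' \<phi>" "\<And>v w. v \<in> carrier V \<Longrightarrow> w \<in> carrier W \<Longrightarrow> \<phi> (\<tau> v w) = \<tau>' v w"
    using tensor_lift[OF \<tau> V W T'(4) T'(3)] by blast
  obtain \<psi> where \<psi>: "linear_map K T' T \<psi>" "\<And>v w. v \<in> carrier V \<Longrightarrow> w \<in> carrier W \<Longrightarrow> \<psi> (\<tau>' v w) = \<tau> v w"
    using tensor_lift[OF \<tau>' V W T(4) T(3)] by blast
  have "\<psi> (\<phi> t) = t" if "t \<in> carrier T" for t
    using tensor_linear_maps_eq[OF \<tau> linear_map_comp[OF \<phi>(1) \<psi>(1)] linear_map_id[OF T(3)] _ that] \<phi>(2) \<psi>(2) by simp
  moreover have "\<phi> (\<psi> t) = t" if "t \<in> carrier T'" for t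
    using tensor_linear_maps_eq[OF \<tau>' linear_map_comp[OF \<psi>(1) \<phi>(1)] linear_map_id[OF T'(3)] _ that] \<phi>(2) \<psi>(2) by simp
  ultimately have "bij_betw \<phi> (carrier T) (carrier T')"
    using linear_mapD(3)[OF \<phi>(1)] linear_mapD(3)[OF \<psi>(1)] by (intro bij_betw_byWitness[where f' = \<psi>]) auto
  with \<phi> that show ?thesis by blast
qed

lemma tensor_presentation_is_tensor_product:
  assumes \<tau>: "tensor_presentation K V W T \<tau>" and V: "fd_space K V" and W: "fd_space K W"
  shows "is_tensor_product K V W T \<tau>"
  unfolding is_tensor_product_def
proof (intro conjI allI impI)
  note T = tensor_presentationD[OF \<tau>]
  show "bilinear_map K V W T \<tau>" by (rule T(4))
  fix M :: "('a, 'd) module" and \<beta>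
  assume M: "vectorspace K M \<and> bilinear_map K V W M \<beta>"
  obtain \<phi> where \<phi>: "linear_map K T M \<phi>" "\<And>v w. v \<in> carrier V \<Longrightarrow> w \<in> carrier W \<Longrightarrow> \<phi> (\<tau> v w) = \<beta> v w"
    using tensor_lift[OF \<tau> V W] M by blast
  show "\<exists>!\<phi>. \<phi> \<in> extensional (carrier T) \<and> linear_map K T M \<phi> \<and>
      (\<forall>v\<in>carrier V. \<forall>w\<in>carrier W. \<phi> (\<tau> v w) = \<beta> v w)"
  proof (rule ex1I[of _ "restrict \<phi> (carrier T)"], intro conjI ballI)
    show "linear_map K T M (restrict \<phi> (carrier T))" using \<phi>(1) by (rule linear_map_cong) simp
  next
    fix \<psi> assume "\<psi> \<in> extensional (carrier T) \<and> linear_map K T M \<psi> \<and>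
      (\<forall>v\<in>carrier V. \<forall>w\<in>carrier W. \<psi> (\<tau> v w) = \<beta> v w)"
    then show "\<psi> = restrict \<phi> (carrier T)"
      using tensor_linear_maps_eq[OF \<tau> _ \<phi>(1), of \<psi>] \<phi>(2) by (intro extensionalityI[of _ "carrier T"]) auto
  qed (use \<phi>(2) T(5) in auto)
qed

text \<open>
  Compare \<open>T\<close> with a tensor product \<open>T0\<close> that is known to have a
  presentation. As both have elements of the same type, the universal property of
  \<open>T\<close> applies to \<open>T0\<close> and to \<open>T\<close> itself and shows that
  the canonical maps between \<open>T\<close> and \<open>T0\<close> are mutually inverse.
\<close>

lemma is_tensor_product_tensor_presentation:
  fixes T :: "('k, 'k list) module"
  assumes \<tau>: "is_tensor_product K V W T \<tau>" and V: "fd_space K V" and W: "fd_space K W" and T: "vectorspace K T"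
  shows "tensor_presentation K V W T \<tau>"
proof -
  obtain T0 :: "('k, 'k list) module" and \<tau>0 where \<tau>0: "tensor_presentation K V W T0 \<tau>0"
    using tensor_presentation_exists[OF V W] by blast
  note T0 = tensor_presentationD[OF \<tau>0]
  have bil: "bilinear_map K V W T \<tau>" using \<tau> by (simp add: is_tensor_product_def)
  note ex1 = \<tau>[unfolded is_tensor_product_def, THEN conjunct2, rule_format]
  obtain \<phi> where \<phi>: "linear_map K T T0 \<phi>" "\<forall>v\<in>carrier V. \<forall>w\<in>carrier W. \<phi> (\<tau> v w) = \<tau>0 v w"
    using ex1[of T0 \<tau>0] T0(3,4) by blast
  obtain \<psi> where \<psi>: "linear_map K T0 T \<psi>" "\<And>v w. v \<in> carrier V \<Longrightarrow> w \<in> carrier W \<Longrightarrow> \<psi> (\<tau>0 v w) = \<tau> v w"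
    using tensor_lift[OF \<tau>0 V W bil T] by blast
  have cl: "\<tau> v w \<in> carrier T" if "v \<in> carrier V" "w \<in> carrier W" for v w
    using bilinear_mapD(3)[OF bil that] .
  define P where "P f \<longleftrightarrow> f \<in> extensional (carrier T) \<and> linear_map K T T f \<and>
    (\<forall>v\<in>carrier V. \<forall>w\<in>carrier W. f (\<tau> v w) = \<tau> v w)" for f
  have "\<exists>!f. P f" using ex1[of T \<tau>] T bil unfolding P_def by blast
  moreover have "P (\<lambda>t\<in>carrier T. \<psi> (\<phi> t))" unfolding P_def
    using \<phi>(2) \<psi>(2) cl linear_map_cong[OF linear_map_comp[OF \<phi>(1) \<psi>(1)]] by auto
  moreover have "P (\<lambda>t\<in>carrier T. t)" unfolding P_def
    using cl linear_map_cong[OF linear_map_id[OF T]] by auto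
  ultimately have "(\<lambda>t\<in>carrier T. \<psi> (\<phi> t)) = (\<lambda>t\<in>carrier T. t)" by blast
  then have "\<psi> (\<phi> t) = t" if "t \<in> carrier T" for t using that by (metis restrict_apply')
  moreover have "\<phi> (\<psi> t) = t" if "t \<in> carrier T0" for t
    using tensor_linear_maps_eq[OF \<tau>0 linear_map_comp[OF \<psi>(1) \<phi>(1)] linear_map_id[OF T0(3)] _ that] \<phi>(2) \<psi>(2) by simp
  ultimately have "bij_betw \<psi> (carrier T0) (carrier T)"
    using linear_mapD(3)[OF \<phi>(1)] linear_mapD(3)[OF \<psi>(1)] by (intro bij_betw_byWitness[where f' = \<phi>]) auto
  then show ?thesis
    using tensor_presentation_iso[OF \<tau>0 linear_map_id bij_betw_self linear_map_id bij_betw_self \<psi>(1)] V W \<psi>(2) by auto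
qed

lemma tensor_presentation_swap:
  assumes \<tau>: "tensor_presentation K V W T \<tau>"
  shows "tensor_presentation K W V T (\<lambda>w v. \<tau> v w)"
proof -
  note T = tensor_presentationD[OF \<tau>]
  interpret V: vectorspace K V by (rule T(1))
  show ?thesis unfolding tensor_presentation_def
  proof (intro conjI allI impI)
    show "bilinear_map K W V T (\<lambda>w v. \<tau> v w)" using T(4) unfolding bilinear_map_def by blast
    have "{\<tau> v w | w v. w \<in> carrier W \<and> v \<in> carrier V} = {\<tau> v w | v w. v \<in> carrier V \<and> w \<in> carrier W}" by blast
    then show "carrier T \<subseteq> sum_closure (\<oplus>\<^bsub>T\<^esub>) {\<tau> v w | w v. w \<in> carrier W \<and> v \<in> carrier V}"
      using \<tau> unfolding tensor_presentation_def by simp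
    fix f g assume fg: "functional K W f" "functional K V g"
    obtain h where h: "functional K T h" "\<And>v w. v \<in> carrier V \<Longrightarrow> w \<in> carrier W \<Longrightarrow> h (\<tau> v w) = g v \<otimes>\<^bsub>K\<^esub> f w"
      using T(6)[OF fg(2,1)] by blast
    show "\<exists>h. functional K T h \<and> (\<forall>w\<in>carrier W. \<forall>v\<in>carrier V. h (\<tau> v w) = f w \<otimes>\<^bsub>K\<^esub> g v)"
      using h linear_mapD(3)[OF fg(1)] linear_mapD(3)[OF fg(2)] by (intro exI[of _ h]) (auto simp: V.R.m_comm)
  qed (use T in simp_all)
qed

lemma tensor_presentation_unit:
  assumes V: "vectorspace K V"
  shows "tensor_presentation K V (self_space K) V (\<lambda>v c. c \<odot>\<^bsub>V\<^esub> v)"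
proof -
  interpret V: vectorspace K V by fact
  have S: "vectorspace K (self_space K)" by (rule vectorspace_self_space) unfold_locales
  show ?thesis unfolding tensor_presentation_def
  proof (intro conjI allI impI V S)
    show "bilinear_map K V (self_space K) V (\<lambda>v c. c \<odot>\<^bsub>V\<^esub> v)" unfolding bilinear_map_def
      using V S vectorspace_smult_commute[OF V]
      by (auto intro!: linear_mapI simp: V.smult_l_distr V.smult_r_distr V.smult_assoc1)
    have "v \<in> {c \<odot>\<^bsub>V\<^esub> v | v c. v \<in> carrier V \<and> c \<in> carrier (self_space K)}" if "v \<in> carrier V" for v
      using that by (auto intro!: exI[of _ v] exI[of _ "\<one>\<^bsub>K\<^esub>"])
    then show "carrier V \<subseteq> sum_closure (\<oplus>\<^bsub>V\<^esub>) {c \<odot>\<^bsub>V\<^esub> v | v c. v \<in> carrier V \<and> c \<in> carrier (self_space K)}"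
      by (blast intro: sum_closure.base)
    fix f g assume f: "functional K V f" and g: "functional K (self_space K) g"
    have g1: "g \<one>\<^bsub>K\<^esub> \<in> carrier K" using linear_mapD(3)[OF g, of "\<one>\<^bsub>K\<^esub>"] by simp
    have gc: "g c = c \<otimes>\<^bsub>K\<^esub> g \<one>\<^bsub>K\<^esub>" if "c \<in> carrier K" for c
      using linear_mapD(5)[OF g that, of "\<one>\<^bsub>K\<^esub>"] that by simp
    have "g \<one>\<^bsub>K\<^esub> \<otimes>\<^bsub>K\<^esub> f (c \<odot>\<^bsub>V\<^esub> v) = f v \<otimes>\<^bsub>K\<^esub> g c" if "v \<in> carrier V" "c \<in> carrier K" for v c
      using linear_mapD(5)[OF f that(2,1)] linear_mapD(3)[OF f that(1)] g1 gc[OF that(2)] that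
      by (simp add: V.R.m_ac)
    then show "\<exists>h. functional K V h \<and> (\<forall>v\<in>carrier V. \<forall>c\<in>carrier (self_space K). h (c \<odot>\<^bsub>V\<^esub> v) = f v \<otimes>\<^bsub>K\<^esub> g c)"
      using linear_map_smult[OF f g1] by (intro exI[of _ "\<lambda>v. g \<one>\<^bsub>K\<^esub> \<otimes>\<^bsub>K\<^esub> f v"]) simp
  qed
qed

lemma direct_sum_simps [simp]:
  "carrier (direct_sum V W) = carrier V \<times> carrier W"
  "\<zero>\<^bsub>direct_sum V W\<^esub> = (\<zero>\<^bsub>V\<^esub>, \<zero>\<^bsub>W\<^esub>)"
  "x \<oplus>\<^bsub>direct_sum V W\<^esub> y = (fst x \<oplus>\<^bsub>V\<^esub> fst y, snd x \<oplus>\<^bsub>W\<^esub> snd y)"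
  "c \<odot>\<^bsub>direct_sum V W\<^esub> x = (c \<odot>\<^bsub>V\<^esub> fst x, c \<odot>\<^bsub>W\<^esub> snd x)"
  by (simp_all add: direct_sum_def)

lemma linear_map_fst: "vectorspace K V \<Longrightarrow> vectorspace K W \<Longrightarrow> linear_map K (direct_sum V W) V fst"
  and linear_map_snd: "vectorspace K V \<Longrightarrow> vectorspace K W \<Longrightarrow> linear_map K (direct_sum V W) W snd"
  by (auto intro!: linear_mapI direct_sum_is_vs)

lemma linear_map_pair:
  assumes "linear_map K X V f" "linear_map K X W g"
  shows "linear_map K X (direct_sum V W) (\<lambda>x. (f x, g x))"
  using linear_mapD[OF assms(1)] linear_mapD[OF assms(2)] by (auto intro!: linear_mapI direct_sum_is_vs)

lemma linear_map_map_prod: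
  assumes "linear_map K V V' f" "linear_map K W W' g"
  shows "linear_map K (direct_sum V W) (direct_sum V' W') (map_prod f g)"
  using linear_mapD[OF assms(1)] linear_mapD[OF assms(2)] by (auto intro!: linear_mapI direct_sum_is_vs)

lemma linear_map_inl: "vectorspace K V \<Longrightarrow> vectorspace K W \<Longrightarrow> linear_map K V (direct_sum V W) (\<lambda>v. (v, \<zero>\<^bsub>W\<^esub>))"
  and linear_map_inr: "vectorspace K V \<Longrightarrow> vectorspace K W \<Longrightarrow> linear_map K W (direct_sum V W) (\<lambda>w. (\<zero>\<^bsub>V\<^esub>, w))"
  by (rule linear_map_pair; simp add: linear_map_id linear_map_zero)+

lemma fd_space_direct_sum:
  assumes V: "fd_space K V" and W: "fd_space K W"
  shows "fd_space K (direct_sum V W)"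
proof -
  interpret V: vectorspace K V using V by simp
  interpret W: vectorspace K W using W by simp
  interpret S: vectorspace K "direct_sum V W" using V W by (intro direct_sum_is_vs) simp_all
  note i = linear_map_inl[OF V.vectorspace_axioms W.vectorspace_axioms]
    and j = linear_map_inr[OF V.vectorspace_axioms W.vectorspace_axioms]
  obtain A where A: "finite A" "A \<subseteq> carrier V" "V.span A = carrier V" using V unfolding V.fin_dim_def by auto
  obtain B where B: "finite B" "B \<subseteq> carrier W" "W.span B = carrier W" using W unfolding W.fin_dim_def by auto
  let ?S = "(\<lambda>v. (v, \<zero>\<^bsub>W\<^esub>)) ` A \<union> (\<lambda>w. (\<zero>\<^bsub>V\<^esub>, w)) ` B"
  have SC: "?S \<subseteq> carrier (direct_sum V W)" using A B by auto
  have span: "submodule K (S.span ?S) (direct_sum V W)" by (rule S.span_is_submodule[OF SC])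
  interpret N: submodule K "S.span ?S" "direct_sum V W" by (rule span)
  have l: "(v, \<zero>\<^bsub>W\<^esub>) \<in> S.span ?S" if v: "v \<in> carrier V" for v
  proof -
    obtain c where c: "c \<in> A \<rightarrow> carrier K" "V.lincomb c A = v"
      using V.finite_in_span[OF A(1,2), of v] A(3) v by auto
    have "(v, \<zero>\<^bsub>W\<^esub>) = (\<Oplus>\<^bsub>direct_sum V W\<^esub>a\<in>A. (c a \<odot>\<^bsub>V\<^esub> a, \<zero>\<^bsub>W\<^esub>))"
      unfolding c(2)[symmetric] V.lincomb_def using c(1) A by (intro linear_map_of_finsum[OF i]) auto
    moreover have "(c a \<odot>\<^bsub>V\<^esub> a, \<zero>\<^bsub>W\<^esub>) \<in> S.span ?S" if "a \<in> A" for a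
    proof -
      have "(a, \<zero>\<^bsub>W\<^esub>) \<in> S.span ?S" using S.in_own_span[OF SC] that by blast
      then have "c a \<odot>\<^bsub>direct_sum V W\<^esub> (a, \<zero>\<^bsub>W\<^esub>) \<in> S.span ?S" using c(1) that by (intro N.smult_closed) auto
      then show ?thesis using c(1) that by (simp add: Pi_def W.rmult_0)
    qed
    ultimately show ?thesis using finsum_in_submodule[OF S.vectorspace_axioms span A(1)] by simp
  qed
  have r: "(\<zero>\<^bsub>V\<^esub>, w) \<in> S.span ?S" if w: "w \<in> carrier W" for w
  proof -
    obtain c where c: "c \<in> B \<rightarrow> carrier K" "W.lincomb c B = w"
      using W.finite_in_span[OF B(1,2), of w] B(3) w by auto
    have "(\<zero>\<^bsub>V\<^esub>, w) = (\<Oplus>\<^bsub>direct_sum V W\<^esub>b\<in>B. (\<zero>\<^bsub>V\<^esub>, c b \<odot>\<^bsub>W\<^esub> b))"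
      unfolding c(2)[symmetric] W.lincomb_def using c(1) B by (intro linear_map_of_finsum[OF j]) auto
    moreover have "(\<zero>\<^bsub>V\<^esub>, c b \<odot>\<^bsub>W\<^esub> b) \<in> S.span ?S" if "b \<in> B" for b
    proof -
      have "(\<zero>\<^bsub>V\<^esub>, b) \<in> S.span ?S" using S.in_own_span[OF SC] that by blast
      then have "c b \<odot>\<^bsub>direct_sum V W\<^esub> (\<zero>\<^bsub>V\<^esub>, b) \<in> S.span ?S" using c(1) that by (intro N.smult_closed) auto
      then show ?thesis using c(1) that by (simp add: Pi_def V.rmult_0)
    qed
    ultimately show ?thesis using finsum_in_submodule[OF S.vectorspace_axioms span B(1)] by simp
  qed
  have "x \<in> S.span ?S" if "x \<in> carrier (direct_sum V W)" for x
    using N.m_closed[OF l[of "fst x"] r[of "snd x"]] that by auto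
  then have "S.gen_set ?S" using S.span_is_subset2[OF SC] by auto
  then have "S.fin_dim" unfolding S.fin_dim_def using A(1) B(1) SC by (intro exI[of _ ?S]) auto
  then show ?thesis using S.vectorspace_axioms by simp
qed

text \<open>
  Tensor products distribute over direct sums: a functional on a direct sum is the sum of its
  two restrictions, and so a product functional can be assembled from those of the summands.
\<close>

lemma tensor_presentation_direct_sum:
  assumes \<tau>: "tensor_presentation K V W T \<tau>" and \<tau>': "tensor_presentation K V' W T' \<tau>'"
  shows "tensor_presentation K (direct_sum V V') W (direct_sum T T') (\<lambda>v w. (\<tau> (fst v) w, \<tau>' (snd v) w))"
proof -
  note T = tensor_presentationD[OF \<tau>] and T' = tensor_presentationD[OF \<tau>']
  interpret T: vectorspace K T by (rule T(3))
  interpret T': vectorspace K T' by (rule T'(3))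
  interpret V: vectorspace K V by (rule T(1))
  interpret V': vectorspace K V' by (rule T'(1))
  have z: "\<tau> \<zero>\<^bsub>V\<^esub> w = \<zero>\<^bsub>T\<^esub>" "\<tau>' \<zero>\<^bsub>V'\<^esub> w = \<zero>\<^bsub>T'\<^esub>" if "w \<in> carrier W" for w
    using linear_mapD(6)[OF bilinear_mapD(2)[OF T(4) that]] linear_mapD(6)[OF bilinear_mapD(2)[OF T'(4) that]] by auto
  show ?thesis unfolding tensor_presentation_def
  proof (intro conjI allI impI)
    show "vectorspace K (direct_sum V V')" "vectorspace K (direct_sum T T')"
      using T T' by (simp_all add: direct_sum_is_vs)
    show "vectorspace K W" by (rule T(2))
    show "bilinear_map K (direct_sum V V') W (direct_sum T T') (\<lambda>v w. (\<tau> (fst v) w, \<tau>' (snd v) w))"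
      unfolding bilinear_map_def
    proof (intro conjI ballI)
      fix v assume "v \<in> carrier (direct_sum V V')"
      then show "linear_map K W (direct_sum T T') (\<lambda>w. (\<tau> (fst v) w, \<tau>' (snd v) w))"
        by (intro linear_map_pair bilinear_mapD(1)[OF T(4)] bilinear_mapD(1)[OF T'(4)]) auto
    next
      fix w assume w: "w \<in> carrier W"
      show "linear_map K (direct_sum V V') (direct_sum T T') (\<lambda>v. (\<tau> (fst v) w, \<tau>' (snd v) w))"
        using T(1) T'(1)
        by (intro linear_map_pair linear_map_comp[OF linear_map_fst bilinear_mapD(2)[OF T(4) w]]
            linear_map_comp[OF linear_map_snd bilinear_mapD(2)[OF T'(4) w]])
    qed
    show "carrier (direct_sum T T') \<subseteq> sum_closure (\<oplus>\<^bsub>direct_sum T T'\<^esub>)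
        {(\<tau> (fst v) w, \<tau>' (snd v) w) | v w. v \<in> carrier (direct_sum V V') \<and> w \<in> carrier W}" (is "_ \<subseteq> ?X")
    proof
      have step: "(s \<oplus>\<^bsub>T\<^esub> t, s' \<oplus>\<^bsub>T'\<^esub> t') \<in> ?X" if "(s, s') \<in> ?X" "(t, t') \<in> ?X" for s t s' t'
        using sum_closure.step[OF that] by simp
      have l: "(t, \<zero>\<^bsub>T'\<^esub>) \<in> ?X" if "t \<in> carrier T" for t
        using \<tau> that
      proof (induction rule: tensor_induct)
        case (pure v w)
        then show ?case using z by (intro sum_closure.base) (auto intro!: exI[of _ v] exI[of _ "\<zero>\<^bsub>V'\<^esub>"] exI[of _ w])
      next
        case (add s t)
        then show ?case using step[OF add.IH] by (simp only: vectorspaceD(5)[OF T'(3) vectorspaceD(2)[OF T'(3)]])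
      qed
      have r: "(\<zero>\<^bsub>T\<^esub>, t) \<in> ?X" if "t \<in> carrier T'" for t
        using \<tau>' that
      proof (induction rule: tensor_induct)
        case (pure v w)
        then show ?case using z by (intro sum_closure.base) (auto intro!: exI[of _ v] exI[of _ "\<zero>\<^bsub>V\<^esub>"] exI[of _ w])
      next
        case (add s t)
        then show ?case using step[OF add.IH] by (simp only: vectorspaceD(5)[OF T(3) vectorspaceD(2)[OF T(3)]])
      qed
      fix x assume "x \<in> carrier (direct_sum T T')"
      then show "x \<in> ?X" using step[OF l r, of "fst x" "snd x"] by auto
    qed
    fix f g assume f: "functional K (direct_sum V V') f" and g: "functional K W g"
    note fl = linear_map_comp[OF linear_map_inl[OF T(1) T'(1)] f]
      and fr = linear_map_comp[OF linear_map_inr[OF T(1) T'(1)] f]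
    obtain h where h: "functional K T h" "\<And>v w. v \<in> carrier V \<Longrightarrow> w \<in> carrier W \<Longrightarrow> h (\<tau> v w) = f (v, \<zero>\<^bsub>V'\<^esub>) \<otimes>\<^bsub>K\<^esub> g w"
      using T(6)[OF fl g] by blast
    obtain h' where h': "functional K T' h'" "\<And>v w. v \<in> carrier V' \<Longrightarrow> w \<in> carrier W \<Longrightarrow> h' (\<tau>' v w) = f (\<zero>\<^bsub>V\<^esub>, v) \<otimes>\<^bsub>K\<^esub> g w"
      using T'(6)[OF fr g] by blast
    have lin: "functional K (direct_sum T T') (\<lambda>x. h (fst x) \<oplus>\<^bsub>self_space K\<^esub> h' (snd x))"
      using T(3) T'(3) by (intro linear_map_add linear_map_comp[OF linear_map_fst h(1)] linear_map_comp[OF linear_map_snd h'(1)])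
    have "h (\<tau> v w) \<oplus>\<^bsub>K\<^esub> h' (\<tau>' v' w) = f (v, v') \<otimes>\<^bsub>K\<^esub> g w"
      if "v \<in> carrier V" "v' \<in> carrier V'" "w \<in> carrier W" for v v' w
    proof -
      have "f (v, v') = f (v, \<zero>\<^bsub>V'\<^esub>) \<oplus>\<^bsub>K\<^esub> f (\<zero>\<^bsub>V\<^esub>, v')"
        using linear_mapD(4)[OF f, of "(v, \<zero>\<^bsub>V'\<^esub>)" "(\<zero>\<^bsub>V\<^esub>, v')"] that by simp
      then show ?thesis
        using that linear_mapD(3)[OF fl] linear_mapD(3)[OF fr] linear_mapD(3)[OF g]
        by (simp add: h(2) h'(2) T.R.l_distr)
    qed
    then show "\<exists>h. functional K (direct_sum T T') h \<and> (\<forall>v\<in>carrier (direct_sum V V'). \<forall>w\<in>carrier W.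
        h (\<tau> (fst v) w, \<tau>' (snd v) w) = f v \<otimes>\<^bsub>K\<^esub> g w)"
      using lin by (intro exI[of _ "\<lambda>x. h (fst x) \<oplus>\<^bsub>self_space K\<^esub> h' (snd x)"]) auto
  qed
qed

text \<open>
  Associativity without a second construction: a tensor product \<open>R\<close> of
  \<open>V\<close> with \<open>W \<otimes> X\<close> is shown to be also one of \<open>V
  \<otimes> W\<close> with \<open>X\<close>.
\<close>

lemma tensor_presentation_assoc:
  assumes A: "tensor_presentation K V W A \<alpha>" and B: "tensor_presentation K W X B \<beta>"
    and R: "tensor_presentation K V B R \<rho>"
    and V: "fd_space K V" and W: "fd_space K W" and X: "fd_space K X"
  obtains \<sigma> where "tensor_presentation K A X R \<sigma>"
    and "\<And>v w x. v \<in> carrier V \<Longrightarrow> w \<in> carrier W \<Longrightarrow> x \<in> carrier X \<Longrightarrow> \<sigma> (\<alpha> v w) x = \<rho> v (\<beta> w x)"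
proof -
  note AD = tensor_presentationD[OF A] and BD = tensor_presentationD[OF B] and RD = tensor_presentationD[OF R]
  have Bfd: "fd_space K B" by (rule tensor_fin_dim[OF B W X])
  interpret V: vectorspace K V by (rule AD(1))
  have bil: "bilinear_map K V W R (\<lambda>v w. \<rho> v (\<beta> w x))" if x: "x \<in> carrier X" for x
    unfolding bilinear_map_def
  proof (intro conjI ballI)
    show "linear_map K W R (\<lambda>w. \<rho> v (\<beta> w x))" if "v \<in> carrier V" for v
      by (rule linear_map_comp[OF bilinear_mapD(2)[OF BD(4) x] bilinear_mapD(1)[OF RD(4) that]])
    show "linear_map K V R (\<lambda>v. \<rho> v (\<beta> w x))" if "w \<in> carrier W" for w
      by (rule bilinear_mapD(2)[OF RD(4) BD(5)[OF that x]])
  qed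
  \<comment> \<open>For fixed \<open>x\<close> the map sending \<open>v\<close> and \<open>w\<close> to
    \<open>\<rho> v (\<beta> w x)\<close> is bilinear and so factors through \<open>A\<close>;
    the factors make up \<open>\<sigma>\<close>.\<close>
  have "\<forall>x\<in>carrier X. \<exists>\<phi>. linear_map K A R \<phi> \<and> (\<forall>v\<in>carrier V. \<forall>w\<in>carrier W. \<phi> (\<alpha> v w) = \<rho> v (\<beta> w x))"
  proof
    fix x assume "x \<in> carrier X"
    then obtain \<phi> where "linear_map K A R \<phi>" "\<And>v w. v \<in> carrier V \<Longrightarrow> w \<in> carrier W \<Longrightarrow> \<phi> (\<alpha> v w) = \<rho> v (\<beta> w x)"
      using tensor_lift[OF A V W bil RD(3), of x] by blast
    then show "\<exists>\<phi>. linear_map K A R \<phi> \<and> (\<forall>v\<in>carrier V. \<forall>w\<in>carrier W. \<phi> (\<alpha> v w) = \<rho> v (\<beta> w x))" by blast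
  qed
  then obtain s where s: "\<And>x. x \<in> carrier X \<Longrightarrow> linear_map K A R (s x)"
    "\<And>v w x. v \<in> carrier V \<Longrightarrow> w \<in> carrier W \<Longrightarrow> x \<in> carrier X \<Longrightarrow> s x (\<alpha> v w) = \<rho> v (\<beta> w x)" by metis
  interpret X: vectorspace K X by (rule BD(2))
  interpret R: vectorspace K R by (rule RD(3))
  have sx: "linear_map K X R (\<lambda>x. s x a)" if a: "a \<in> carrier A" for a
  proof (rule linear_mapI[OF BD(2) RD(3)])
    show "s x a \<in> carrier R" if "x \<in> carrier X" for x using linear_mapD(3)[OF s(1)[OF that] a] .
    show "s (x \<oplus>\<^bsub>X\<^esub> y) a = s x a \<oplus>\<^bsub>R\<^esub> s y a" if xy: "x \<in> carrier X" "y \<in> carrier X" for x y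
    proof (rule tensor_linear_maps_eq[OF A s(1)[OF X.a_closed[OF xy]] linear_map_add[OF s(1)[OF xy(1)] s(1)[OF xy(2)]] _ a])
      fix v w assume vw: "v \<in> carrier V" "w \<in> carrier W"
      show "s (x \<oplus>\<^bsub>X\<^esub> y) (\<alpha> v w) = s x (\<alpha> v w) \<oplus>\<^bsub>R\<^esub> s y (\<alpha> v w)"
        using vw xy BD(5) linear_mapD(4)[OF bilinear_mapD(1)[OF BD(4) vw(2)] xy]
          linear_mapD(4)[OF bilinear_mapD(1)[OF RD(4) vw(1)]] by (simp add: s(2))
    qed
    show "s (c \<odot>\<^bsub>X\<^esub> x) a = c \<odot>\<^bsub>R\<^esub> s x a" if c: "c \<in> carrier K" and x: "x \<in> carrier X" for c x
    proof (rule tensor_linear_maps_eq[OF A s(1)[OF X.smult_closed[OF c x]] linear_map_smult[OF s(1)[OF x] c] _ a])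
      fix v w assume vw: "v \<in> carrier V" "w \<in> carrier W"
      show "s (c \<odot>\<^bsub>X\<^esub> x) (\<alpha> v w) = c \<odot>\<^bsub>R\<^esub> s x (\<alpha> v w)"
        using vw c x BD(5) linear_mapD(5)[OF bilinear_mapD(1)[OF BD(4) vw(2)] c x]
          linear_mapD(5)[OF bilinear_mapD(1)[OF RD(4) vw(1)] c] by (simp add: s(2))
    qed
  qed
  have "tensor_presentation K A X R (\<lambda>a x. s x a)" unfolding tensor_presentation_def
  proof (intro conjI allI impI)
    show "bilinear_map K A X R (\<lambda>a x. s x a)" unfolding bilinear_map_def using sx s(1) by auto
    show "carrier R \<subseteq> sum_closure (\<oplus>\<^bsub>R\<^esub>) {s x a | a x. a \<in> carrier A \<and> x \<in> carrier X}" (is "_ \<subseteq> ?X")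
    proof
      fix r assume "r \<in> carrier R"
      with R show "r \<in> ?X"
      proof (induction rule: tensor_induct)
        case (pure v b)
        from B pure(2) show ?case
        proof (induction rule: tensor_induct)
          case (pure w x)
          then show ?case using s(2)[OF \<open>v \<in> carrier V\<close> pure, symmetric] AD(5) \<open>v \<in> carrier V\<close>
            by (intro sum_closure.base) auto
        next
          case (add b c)
          then show ?case using linear_mapD(4)[OF bilinear_mapD(1)[OF RD(4) \<open>v \<in> carrier V\<close>]]
            by (simp add: sum_closure.step)
        qed
      next
        case (add r r')
        then show ?case by (simp add: sum_closure.step)
      qed
    qed
    fix f g assume f: "functional K A f" and g: "functional K X g"
    \<comment> \<open>The product functional of \<open>f\<close> and \<open>g\<close> on \<open>R\<close> is
      built in two stages: for fixed \<open>v\<close>, the functional on \<open>W\<close> with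
      values \<open>f(\<alpha>(v,w))\<close> and \<open>g\<close> have a product \<open>h
      v\<close> on \<open>B\<close>; then \<open>h\<close>, being bilinear in \<open>v\<close>
      and \<open>b\<close>, factors through \<open>R\<close>.\<close>
    have fv: "functional K W (\<lambda>w. f (\<alpha> v w))" if "v \<in> carrier V" for v
      by (rule linear_map_comp[OF bilinear_mapD(1)[OF AD(4) that] f])
    have "\<forall>v\<in>carrier V. \<exists>h. functional K B h \<and> (\<forall>w\<in>carrier W. \<forall>x\<in>carrier X. h (\<beta> w x) = f (\<alpha> v w) \<otimes>\<^bsub>K\<^esub> g x)"
      using BD(6)[OF fv g] by blast
    then obtain h where h: "\<And>v. v \<in> carrier V \<Longrightarrow> functional K B (h v)"
      "\<And>v w x. v \<in> carrier V \<Longrightarrow> w \<in> carrier W \<Longrightarrow> x \<in> carrier X \<Longrightarrow> h v (\<beta> w x) = f (\<alpha> v w) \<otimes>\<^bsub>K\<^esub> g x" by metis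
    have S: "vectorspace K (self_space K)" by (rule linear_mapD(2)[OF f])
    have hb: "functional K V (\<lambda>v. h v b)" if b: "b \<in> carrier B" for b
    proof (rule linear_mapI[OF AD(1) S])
      show "h v b \<in> carrier (self_space K)" if "v \<in> carrier V" for v using linear_mapD(3)[OF h(1)[OF that] b] .
      show "h (v \<oplus>\<^bsub>V\<^esub> v') b = h v b \<oplus>\<^bsub>self_space K\<^esub> h v' b" if vv: "v \<in> carrier V" "v' \<in> carrier V" for v v'
      proof (rule tensor_linear_maps_eq[OF B h(1)[OF V.a_closed[OF vv]] linear_map_add[OF h(1)[OF vv(1)] h(1)[OF vv(2)]] _ b])
        fix w x assume wx: "w \<in> carrier W" "x \<in> carrier X"
        show "h (v \<oplus>\<^bsub>V\<^esub> v') (\<beta> w x) = h v (\<beta> w x) \<oplus>\<^bsub>self_space K\<^esub> h v' (\<beta> w x)"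
          using wx vv linear_mapD(4)[OF linear_map_comp[OF bilinear_mapD(2)[OF AD(4) wx(1)] f] vv]
            linear_mapD(3)[OF g wx(2)] linear_mapD(3)[OF fv[OF vv(1)] wx(1)] linear_mapD(3)[OF fv[OF vv(2)] wx(1)]
          by (simp add: h(2) V.R.l_distr)
      qed
      show "h (c \<odot>\<^bsub>V\<^esub> v) b = c \<odot>\<^bsub>self_space K\<^esub> h v b" if c: "c \<in> carrier K" and v: "v \<in> carrier V" for c v
      proof (rule tensor_linear_maps_eq[OF B h(1)[OF V.smult_closed[OF c v]] linear_map_smult[OF h(1)[OF v] c] _ b])
        fix w x assume wx: "w \<in> carrier W" "x \<in> carrier X"
        show "h (c \<odot>\<^bsub>V\<^esub> v) (\<beta> w x) = c \<odot>\<^bsub>self_space K\<^esub> h v (\<beta> w x)"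
          using wx v c linear_mapD(5)[OF linear_map_comp[OF bilinear_mapD(2)[OF AD(4) wx(1)] f] c v]
            linear_mapD(3)[OF g wx(2)] linear_mapD(3)[OF fv[OF v] wx(1)]
          by (simp add: h(2) V.R.m_assoc)
      qed
    qed
    have "bilinear_map K V B (self_space K) h" unfolding bilinear_map_def using h(1) hb by blast
    then obtain k where k: "functional K R k" "\<And>v b. v \<in> carrier V \<Longrightarrow> b \<in> carrier B \<Longrightarrow> k (\<rho> v b) = h v b"
      using tensor_lift[OF R V Bfd _ S] by blast
    have "k (s x a) = f a \<otimes>\<^bsub>K\<^esub> g x" if a: "a \<in> carrier A" and x: "x \<in> carrier X" for a x
    proof -
      have gx: "g x \<in> carrier K" using linear_mapD(3)[OF g x] by simp
      have "k (s x a) = g x \<odot>\<^bsub>self_space K\<^esub> f a"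
      proof (rule tensor_linear_maps_eq[OF A linear_map_comp[OF s(1)[OF x] k(1)] linear_map_smult[OF f gx] _ a])
        fix v w assume vw: "v \<in> carrier V" "w \<in> carrier W"
        show "k (s x (\<alpha> v w)) = g x \<odot>\<^bsub>self_space K\<^esub> f (\<alpha> v w)"
          using vw x BD(5) gx linear_mapD(3)[OF f AD(5)[OF vw]] by (simp add: s(2) k(2) h(2) V.R.m_comm)
      qed
      then show ?thesis using gx linear_mapD(3)[OF f a] by (simp add: V.R.m_comm)
    qed
    then show "\<exists>h. functional K R h \<and> (\<forall>a\<in>carrier A. \<forall>x\<in>carrier X. h (s x a) = f a \<otimes>\<^bsub>K\<^esub> g x)"
      using k(1) by blast
  qed (use AD BD RD in simp_all)
  with s(2) that[of "\<lambda>a x. s x a"] show ?thesis by blast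
qed

section \<open>Representations and their isomorphism classes\<close>

lemma is_repD:
  assumes "is_rep K Q V"
  shows "x \<in> verts Q \<Longrightarrow> fd_space K (space V x)"
    and "a \<in> arcs Q \<Longrightarrow> linear_map K (space V (tail Q a)) (space V (head Q a)) (arrow_map V a)"
  using assms unfolding is_rep_def by auto

lemma rep_isoI:
  assumes "\<And>x. x \<in> verts Q \<Longrightarrow> linear_map K (space V x) (space W x) (\<phi> x)"
    and "\<And>x. x \<in> verts Q \<Longrightarrow> bij_betw (\<phi> x) (carrier (space V x)) (carrier (space W x))"
    and "\<And>a v. a \<in> arcs Q \<Longrightarrow> v \<in> carrier (space V (tail Q a)) \<Longrightarrow>
      \<phi> (head Q a) (arrow_map V a v) = arrow_map W a (\<phi> (tail Q a) v)"
  shows "rep_iso K Q V W"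
  using assms unfolding rep_iso_def by blast

lemma rep_isoE:
  assumes "rep_iso K Q V W"
  obtains \<phi> where "\<And>x. x \<in> verts Q \<Longrightarrow> linear_map K (space V x) (space W x) (\<phi> x)"
    and "\<And>x. x \<in> verts Q \<Longrightarrow> bij_betw (\<phi> x) (carrier (space V x)) (carrier (space W x))"
    and "\<And>a v. a \<in> arcs Q \<Longrightarrow> v \<in> carrier (space V (tail Q a)) \<Longrightarrow>
      \<phi> (head Q a) (arrow_map V a v) = arrow_map W a (\<phi> (tail Q a) v)"
  using assms unfolding rep_iso_def by blast

lemma rep_iso_refl: "is_rep K Q V \<Longrightarrow> rep_iso K Q V V"
  by (rule rep_isoI[where \<phi> = "\<lambda>x v. v"]) (simp_all add: is_repD linear_map_id bij_betw_self)

lemma rep_iso_sym: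
  assumes Q: "wf_digraph Q" and V: "is_rep K Q V" and "rep_iso K Q V W"
  shows "rep_iso K Q W V"
proof -
  interpret wf_digraph Q by fact
  obtain \<phi> where \<phi>: "\<And>x. x \<in> verts Q \<Longrightarrow> linear_map K (space V x) (space W x) (\<phi> x)"
    "\<And>x. x \<in> verts Q \<Longrightarrow> bij_betw (\<phi> x) (carrier (space V x)) (carrier (space W x))"
    "\<And>a v. a \<in> arcs Q \<Longrightarrow> v \<in> carrier (space V (tail Q a)) \<Longrightarrow>
      \<phi> (head Q a) (arrow_map V a v) = arrow_map W a (\<phi> (tail Q a) v)"
    using assms(3) by (rule rep_isoE) blast
  let ?\<psi> = "\<lambda>x. the_inv_into (carrier (space V x)) (\<phi> x)"
  show ?thesis
  proof (rule rep_isoI[where \<phi> = ?\<psi>])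
    fix a w assume a: "a \<in> arcs Q" and w: "w \<in> carrier (space W (tail Q a))"
    note b = \<phi>(2)[OF tail_in_verts[OF a]] and b' = \<phi>(2)[OF head_in_verts[OF a]]
    have v: "?\<psi> (tail Q a) w \<in> carrier (space V (tail Q a))" "\<phi> (tail Q a) (?\<psi> (tail Q a) w) = w"
      using linear_mapD(3)[OF linear_map_bij_inverse[OF \<phi>(1) b] w] f_the_inv_into_f_bij_betw[OF b] w a by auto
    then have "arrow_map W a w = \<phi> (head Q a) (arrow_map V a (?\<psi> (tail Q a) w))" using \<phi>(3)[OF a v(1)] by simp
    then show "?\<psi> (head Q a) (arrow_map W a w) = arrow_map V a (?\<psi> (tail Q a) w)"
      using the_inv_into_f_f[OF bij_betw_imp_inj_on[OF b']] linear_mapD(3)[OF is_repD(2)[OF V a] v(1)] by simp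
  qed (use \<phi> linear_map_bij_inverse bij_betw_the_inv_into in blast)+
qed

lemma rep_iso_trans:
  assumes Q: "wf_digraph Q" and "rep_iso K Q V W" "rep_iso K Q W X"
  shows "rep_iso K Q V X"
proof -
  interpret wf_digraph Q by fact
  obtain \<phi> where \<phi>: "\<And>x. x \<in> verts Q \<Longrightarrow> linear_map K (space V x) (space W x) (\<phi> x)"
    "\<And>x. x \<in> verts Q \<Longrightarrow> bij_betw (\<phi> x) (carrier (space V x)) (carrier (space W x))"
    "\<And>a v. a \<in> arcs Q \<Longrightarrow> v \<in> carrier (space V (tail Q a)) \<Longrightarrow>
      \<phi> (head Q a) (arrow_map V a v) = arrow_map W a (\<phi> (tail Q a) v)"
    using assms(2) by (rule rep_isoE) blast
  obtain \<psi> where \<psi>: "\<And>x. x \<in> verts Q \<Longrightarrow> linear_map K (space W x) (space X x) (\<psi> x)"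
    "\<And>x. x \<in> verts Q \<Longrightarrow> bij_betw (\<psi> x) (carrier (space W x)) (carrier (space X x))"
    "\<And>a v. a \<in> arcs Q \<Longrightarrow> v \<in> carrier (space W (tail Q a)) \<Longrightarrow>
      \<psi> (head Q a) (arrow_map W a v) = arrow_map X a (\<psi> (tail Q a) v)"
    using assms(3) by (rule rep_isoE) blast
  show ?thesis
  proof (rule rep_isoI[where \<phi> = "\<lambda>x v. \<psi> x (\<phi> x v)"])
    show "linear_map K (space V x) (space X x) (\<lambda>v. \<psi> x (\<phi> x v))" if "x \<in> verts Q" for x
      by (rule linear_map_comp[OF \<phi>(1)[OF that] \<psi>(1)[OF that]])
    show "bij_betw (\<lambda>v. \<psi> x (\<phi> x v)) (carrier (space V x)) (carrier (space X x))" if "x \<in> verts Q" for x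
      using bij_betw_trans[OF \<phi>(2)[OF that] \<psi>(2)[OF that]] by (simp add: comp_def)
    show "\<psi> (head Q a) (\<phi> (head Q a) (arrow_map V a v)) = arrow_map X a (\<psi> (tail Q a) (\<phi> (tail Q a) v))"
      if "a \<in> arcs Q" "v \<in> carrier (space V (tail Q a))" for a v
      using \<phi>(3)[OF that] \<psi>(3)[OF that(1) linear_mapD(3)[OF \<phi>(1) that(2)]] that(1) by simp
  qed
qed

lemma rep_iso_cong:
  assumes "is_rep K Q V" "\<And>x. x \<in> verts Q \<Longrightarrow> space W x = space V x"
    and "\<And>a. a \<in> arcs Q \<Longrightarrow> arrow_map W a = arrow_map V a"
  shows "rep_iso K Q V W"
  using assms by (intro rep_isoI[where \<phi> = "\<lambda>x v. v"]) (simp_all add: is_repD linear_map_id bij_betw_self)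

text \<open>
  The arrows are conjugated with the given isomorphisms of the spaces.
\<close>

lemma transported_rep:
  assumes Q: "wf_digraph Q" and V: "is_rep K Q V"
    and \<phi>: "\<And>x. x \<in> verts Q \<Longrightarrow> linear_map K (space V x) (M x) (\<phi> x)"
      "\<And>x. x \<in> verts Q \<Longrightarrow> bij_betw (\<phi> x) (carrier (space V x)) (carrier (M x))"
  obtains Z where "space Z = M" "is_rep K Q Z" "rep_iso K Q V Z"
proof -
  interpret wf_digraph Q by fact
  define \<psi> where "\<psi> x = the_inv_into (carrier (space V x)) (\<phi> x)" for x
  have \<psi>: "linear_map K (M x) (space V x) (\<psi> x)" "\<And>v. v \<in> carrier (space V x) \<Longrightarrow> \<psi> x (\<phi> x v) = v"
    if "x \<in> verts Q" for x
    unfolding \<psi>_def using linear_map_bij_inverse[OF \<phi>[OF that]] the_inv_into_f_f[OF bij_betw_imp_inj_on[OF \<phi>(2)[OF that]]]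
    by auto
  define Z where "Z = \<lparr>space = M, arrow_map = (\<lambda>a v. \<phi> (head Q a) (arrow_map V a (\<psi> (tail Q a) v)))\<rparr>"
  have "is_rep K Q Z" unfolding is_rep_def
  proof (intro conjI ballI)
    fix x assume x: "x \<in> verts Q"
    show "vectorspace K (space Z x)" "vectorspace.fin_dim K (space Z x)"
      using fin_dim_linear_image[OF \<phi>(1)[OF x]] \<phi>(2)[OF x] is_repD(1)[OF V x] by (auto simp: Z_def bij_betw_def)
  next
    fix a assume a: "a \<in> arcs Q"
    show "linear_map K (space Z (tail Q a)) (space Z (head Q a)) (arrow_map Z a)"
      using linear_map_comp[OF linear_map_comp[OF \<psi>(1) is_repD(2)[OF V a]] \<phi>(1)] a by (simp add: Z_def)
  qed
  moreover have "rep_iso K Q V Z"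
    using \<phi> \<psi>(2) by (intro rep_isoI[where \<phi> = \<phi>]) (simp_all add: Z_def)
  ultimately show ?thesis using that[of Z] by (simp add: Z_def)
qed

text \<open>
  Every representation is isomorphic to one whose vectors are lists. Constructions that leave
  the type of lists, such as the direct sum, thereby have a class among
  \<^const>\<open>iso_classes\<close>.
\<close>

lemma std_rep_exists:
  fixes V :: "('v, 'a, 'k, 'u) quiver_rep" and Q :: "('v, 'a) pre_digraph"
  assumes Q: "wf_digraph Q" and V: "is_rep K Q V"
  obtains Z :: "('v, 'a, 'k) std_rep" where "is_rep K Q Z" "rep_iso K Q V Z"
proof -
  have "\<forall>x\<in>verts Q. \<exists>(M :: ('k, 'k list) module) \<phi>. linear_map K (space V x) M \<phi> \<and> bij_betw \<phi> (carrier (space V x)) (carrier M)"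
    using linear_iso_list is_repD(1)[OF V] by metis
  then obtain M :: "'v \<Rightarrow> ('k, 'k list) module" and \<phi> where
    "\<forall>x\<in>verts Q. linear_map K (space V x) (M x) (\<phi> x) \<and> bij_betw (\<phi> x) (carrier (space V x)) (carrier (M x))"
    by metis
  then show ?thesis using transported_rep[OF Q V, of M \<phi>] that by metis
qed

lemma rep_class_eq_iff:
  fixes V :: "('v, 'a, 'k, 'u) quiver_rep" and W :: "('v, 'a, 'k, 'w) quiver_rep"
  assumes Q: "wf_digraph Q" and V: "is_rep K Q V" and W: "is_rep K Q W"
  shows "rep_class K Q V = rep_class K Q W \<longleftrightarrow> rep_iso K Q V W"
proof
  assume eq: "rep_class K Q V = rep_class K Q W"
  obtain Z :: "('v, 'a, 'k) std_rep" where Z: "is_rep K Q Z" "rep_iso K Q V Z"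
    using std_rep_exists[OF Q V] by blast
  then have "Z \<in> rep_class K Q V" using rep_iso_sym[OF Q V] by (simp add: rep_class_def)
  then have "rep_iso K Q Z W" using eq unfolding rep_class_def by blast
  then show "rep_iso K Q V W" by (rule rep_iso_trans[OF Q Z(2)])
next
  assume VW: "rep_iso K Q V W"
  have "rep_iso K Q Z V \<longleftrightarrow> rep_iso K Q Z W" for Z :: "('v, 'a, 'k) std_rep"
    using rep_iso_trans[OF Q _ VW] rep_iso_trans[OF Q _ rep_iso_sym[OF Q V VW]] by blast
  then show "rep_class K Q V = rep_class K Q W" by (simp add: rep_class_def)
qed

lemma iso_classesE:
  assumes "A \<in> iso_classes K Q"
  obtains V :: "('v, 'a, 'k) std_rep" where "is_rep K Q V" "A = rep_class K Q V"
  using assms unfolding iso_classes_def by blast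

lemma rep_class_in_iso_classes:
  fixes V :: "('v, 'a, 'k, 'u) quiver_rep"
  assumes Q: "wf_digraph Q" and V: "is_rep K Q V"
  shows "rep_class K Q V \<in> iso_classes K Q"
proof -
  obtain Z :: "('v, 'a, 'k) std_rep" where Z: "is_rep K Q Z" "rep_iso K Q V Z"
    using std_rep_exists[OF Q V] by blast
  then have "rep_class K Q V = rep_class K Q Z" using rep_class_eq_iff[OF Q V] by blast
  then show ?thesis using Z unfolding iso_classes_def by blast
qed

lemma is_rep_sum: "is_rep K Q V \<Longrightarrow> is_rep K Q W \<Longrightarrow> is_rep K Q (rep_sum V W)"
  using fd_space_direct_sum linear_map_map_prod unfolding is_rep_def rep_sum_def by fastforce

lemma rep_iso_sum:
  assumes "rep_iso K Q V V'" "rep_iso K Q W W'"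
  shows "rep_iso K Q (rep_sum V W) (rep_sum V' W')"
proof -
  obtain \<phi> where \<phi>: "\<And>x. x \<in> verts Q \<Longrightarrow> linear_map K (space V x) (space V' x) (\<phi> x)"
    "\<And>x. x \<in> verts Q \<Longrightarrow> bij_betw (\<phi> x) (carrier (space V x)) (carrier (space V' x))"
    "\<And>a v. a \<in> arcs Q \<Longrightarrow> v \<in> carrier (space V (tail Q a)) \<Longrightarrow>
      \<phi> (head Q a) (arrow_map V a v) = arrow_map V' a (\<phi> (tail Q a) v)"
    using assms(1) by (rule rep_isoE) blast
  obtain \<psi> where \<psi>: "\<And>x. x \<in> verts Q \<Longrightarrow> linear_map K (space W x) (space W' x) (\<psi> x)"
    "\<And>x. x \<in> verts Q \<Longrightarrow> bij_betw (\<psi> x) (carrier (space W x)) (carrier (space W' x))"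
    "\<And>a v. a \<in> arcs Q \<Longrightarrow> v \<in> carrier (space W (tail Q a)) \<Longrightarrow>
      \<psi> (head Q a) (arrow_map W a v) = arrow_map W' a (\<psi> (tail Q a) v)"
    using assms(2) by (rule rep_isoE) blast
  show ?thesis
    by (rule rep_isoI[where \<phi> = "\<lambda>x. map_prod (\<phi> x) (\<psi> x)"])
      (use \<phi> \<psi> in \<open>auto simp: rep_sum_def linear_map_map_prod intro: bij_betw_map_prod\<close>)
qed

lemma class_sum_rep_class:
  fixes V W :: "('v, 'a, 'k) std_rep"
  assumes Q: "wf_digraph Q" and V: "is_rep K Q V" and W: "is_rep K Q W"
  shows "class_sum K Q (rep_class K Q V) (rep_class K Q W) = rep_class K Q (rep_sum V W)"
proof -
  have "rep_class K Q (rep_sum V' W') = rep_class K Q (rep_sum V W)"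
    if "V' \<in> rep_class K Q V" "W' \<in> rep_class K Q W" for V' W'
    using that rep_iso_sum[of K Q V' V W' W] V W
    by (subst rep_class_eq_iff[OF Q]) (auto simp: rep_class_def intro: is_rep_sum)
  moreover have "V \<in> rep_class K Q V" "W \<in> rep_class K Q W"
    using V W by (simp_all add: rep_class_def rep_iso_refl)
  ultimately show ?thesis unfolding class_sum_def by blast
qed

text \<open>
  The analogue of \<^const>\<open>is_rep_tensor\<close> for representations whose vectors are
  of any types. In proofs of ring laws the tensor product may live on pairs or scalars, where
  the universal property of \<^const>\<open>is_tensor_product\<close> has too few targets.
\<close>

definition rep_tensor :: "'k ring \<Rightarrow> ('v, 'a) pre_digraph \<Rightarrow> ('v, 'a, 'k, 'u) quiver_rep \<Rightarrow>
    ('v, 'a, 'k, 'w) quiver_rep \<Rightarrow> ('v, 'a, 'k, 't) quiver_rep \<Rightarrow> bool" where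
  "rep_tensor K Q V W T \<longleftrightarrow> is_rep K Q V \<and> is_rep K Q W \<and> is_rep K Q T \<and> (\<exists>\<tau>.
    (\<forall>x \<in> verts Q. tensor_presentation K (space V x) (space W x) (space T x) (\<tau> x)) \<and>
    (\<forall>a \<in> arcs Q. \<forall>v \<in> carrier (space V (tail Q a)). \<forall>w \<in> carrier (space W (tail Q a)).
       arrow_map T a (\<tau> (tail Q a) v w) = \<tau> (head Q a) (arrow_map V a v) (arrow_map W a w)))"

lemma rep_tensorE:
  assumes "rep_tensor K Q V W T"
  obtains \<tau> where "is_rep K Q V" "is_rep K Q W" "is_rep K Q T"
    and "\<And>x. x \<in> verts Q \<Longrightarrow> tensor_presentation K (space V x) (space W x) (space T x) (\<tau> x)"
    and "\<And>a v w. a \<in> arcs Q \<Longrightarrow> v \<in> carrier (space V (tail Q a)) \<Longrightarrow> w \<in> carrier (space W (tail Q a)) \<Longrightarrow>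
       arrow_map T a (\<tau> (tail Q a) v w) = \<tau> (head Q a) (arrow_map V a v) (arrow_map W a w)"
  using assms unfolding rep_tensor_def by blast

lemma rep_tensorI:
  assumes "is_rep K Q V" "is_rep K Q W" "is_rep K Q T"
    and "\<And>x. x \<in> verts Q \<Longrightarrow> tensor_presentation K (space V x) (space W x) (space T x) (\<tau> x)"
    and "\<And>a v w. a \<in> arcs Q \<Longrightarrow> v \<in> carrier (space V (tail Q a)) \<Longrightarrow> w \<in> carrier (space W (tail Q a)) \<Longrightarrow>
       arrow_map T a (\<tau> (tail Q a) v w) = \<tau> (head Q a) (arrow_map V a v) (arrow_map W a w)"
  shows "rep_tensor K Q V W T"
  using assms unfolding rep_tensor_def by blast

lemma is_rep_tensor_iff_rep_tensor:
  fixes T :: "('v, 'a, 'k) std_rep"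
  assumes V: "is_rep K Q V" and W: "is_rep K Q W"
  shows "is_rep_tensor K Q V W T \<longleftrightarrow> rep_tensor K Q V W T"
proof -
  have "is_tensor_product K (space V x) (space W x) (space T x) t \<longleftrightarrow>
      tensor_presentation K (space V x) (space W x) (space T x) t" if "x \<in> verts Q" "is_rep K Q T" for x t
    using tensor_presentation_is_tensor_product is_tensor_product_tensor_presentation
      is_repD(1)[OF V that(1)] is_repD(1)[OF W that(1)] is_repD(1)[OF that(2,1)] by blast
  then show ?thesis unfolding is_rep_tensor_def rep_tensor_def using V W by (simp cong: conj_cong)
qed

text \<open>
  Tensor products are chosen at the vertices; the maps at the arrows are induced by the
  bilinear maps that apply the arrow to both factors.
\<close>

lemma rep_tensor_exists:
  fixes V :: "('v, 'a, 'k, 'u) quiver_rep" and W :: "('v, 'a, 'k, 'w) quiver_rep"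
  assumes Q: "wf_digraph Q" and V: "is_rep K Q V" and W: "is_rep K Q W"
  obtains T :: "('v, 'a, 'k) std_rep" where "rep_tensor K Q V W T"
proof -
  interpret wf_digraph Q by fact
  have "\<forall>x\<in>verts Q. \<exists>(T :: ('k, 'k list) module) t. tensor_presentation K (space V x) (space W x) T t"
    using tensor_presentation_exists is_repD(1)[OF V] is_repD(1)[OF W] by metis
  then obtain T :: "'v \<Rightarrow> ('k, 'k list) module" and \<tau> where
    \<tau>: "\<And>x. x \<in> verts Q \<Longrightarrow> tensor_presentation K (space V x) (space W x) (T x) (\<tau> x)" by metis
  have "\<exists>f. linear_map K (T (tail Q a)) (T (head Q a)) f \<and>
      (\<forall>v\<in>carrier (space V (tail Q a)). \<forall>w\<in>carrier (space W (tail Q a)).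
        f (\<tau> (tail Q a) v w) = \<tau> (head Q a) (arrow_map V a v) (arrow_map W a w))" if a: "a \<in> arcs Q" for a
  proof -
    note t = tail_in_verts[OF a] and h = head_in_verts[OF a]
    note Va = is_repD(2)[OF V a] and Wa = is_repD(2)[OF W a]
    note H = tensor_presentationD[OF \<tau>[OF h]]
    have bil: "bilinear_map K (space V (tail Q a)) (space W (tail Q a)) (T (head Q a))
        (\<lambda>v w. \<tau> (head Q a) (arrow_map V a v) (arrow_map W a w))"
      unfolding bilinear_map_def
      by (intro conjI ballI linear_map_comp[OF Wa bilinear_mapD(1)[OF H(4)]]
          linear_map_comp[OF Va bilinear_mapD(2)[OF H(4)]] linear_mapD(3)[OF Va] linear_mapD(3)[OF Wa])
    show ?thesis
    proof (rule tensor_lift[OF \<tau>[OF t] is_repD(1)[OF V t] is_repD(1)[OF W t] bil H(3)])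
      fix \<phi> assume "linear_map K (T (tail Q a)) (T (head Q a)) \<phi>"
        and "\<And>v w. v \<in> carrier (space V (tail Q a)) \<Longrightarrow> w \<in> carrier (space W (tail Q a)) \<Longrightarrow>
          \<phi> (\<tau> (tail Q a) v w) = \<tau> (head Q a) (arrow_map V a v) (arrow_map W a w)"
      then show ?thesis by (intro exI[of _ \<phi>] conjI ballI)
    qed
  qed
  then obtain f where f: "\<And>a. a \<in> arcs Q \<Longrightarrow> linear_map K (T (tail Q a)) (T (head Q a)) (f a)"
    "\<And>a v w. a \<in> arcs Q \<Longrightarrow> v \<in> carrier (space V (tail Q a)) \<Longrightarrow> w \<in> carrier (space W (tail Q a)) \<Longrightarrow>
        f a (\<tau> (tail Q a) v w) = \<tau> (head Q a) (arrow_map V a v) (arrow_map W a w)" by metis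
  have "is_rep K Q \<lparr>space = T, arrow_map = f\<rparr>"
    unfolding is_rep_def using f(1) tensor_fin_dim[OF \<tau> is_repD(1)[OF V] is_repD(1)[OF W]] by simp
  then have "rep_tensor K Q V W \<lparr>space = T, arrow_map = f\<rparr>"
    using \<tau> f(2) by (intro rep_tensorI[OF V W]) simp_all
  then show ?thesis by (rule that)
qed

lemma rep_tensor_iso:
  assumes Q: "wf_digraph Q" and T: "rep_tensor K Q V W T"
    and V': "is_rep K Q V'" "rep_iso K Q V' V" and W': "is_rep K Q W'" "rep_iso K Q W' W"
    and T': "is_rep K Q T'" "rep_iso K Q T T'"
  shows "rep_tensor K Q V' W' T'"
proof -
  interpret wf_digraph Q by fact
  obtain \<tau> where V: "is_rep K Q V" and W: "is_rep K Q W"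
    and \<tau>: "\<And>x. x \<in> verts Q \<Longrightarrow> tensor_presentation K (space V x) (space W x) (space T x) (\<tau> x)"
    "\<And>a v w. a \<in> arcs Q \<Longrightarrow> v \<in> carrier (space V (tail Q a)) \<Longrightarrow> w \<in> carrier (space W (tail Q a)) \<Longrightarrow>
       arrow_map T a (\<tau> (tail Q a) v w) = \<tau> (head Q a) (arrow_map V a v) (arrow_map W a w)"
    using T by (rule rep_tensorE) blast
  obtain \<alpha> where \<alpha>: "\<And>x. x \<in> verts Q \<Longrightarrow> linear_map K (space V' x) (space V x) (\<alpha> x)"
    "\<And>x. x \<in> verts Q \<Longrightarrow> bij_betw (\<alpha> x) (carrier (space V' x)) (carrier (space V x))"
    "\<And>a v. a \<in> arcs Q \<Longrightarrow> v \<in> carrier (space V' (tail Q a)) \<Longrightarrow>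
      \<alpha> (head Q a) (arrow_map V' a v) = arrow_map V a (\<alpha> (tail Q a) v)"
    using V'(2) by (rule rep_isoE) blast
  obtain \<beta> where \<beta>: "\<And>x. x \<in> verts Q \<Longrightarrow> linear_map K (space W' x) (space W x) (\<beta> x)"
    "\<And>x. x \<in> verts Q \<Longrightarrow> bij_betw (\<beta> x) (carrier (space W' x)) (carrier (space W x))"
    "\<And>a v. a \<in> arcs Q \<Longrightarrow> v \<in> carrier (space W' (tail Q a)) \<Longrightarrow>
      \<beta> (head Q a) (arrow_map W' a v) = arrow_map W a (\<beta> (tail Q a) v)"
    using W'(2) by (rule rep_isoE) blast
  obtain \<gamma> where \<gamma>: "\<And>x. x \<in> verts Q \<Longrightarrow> linear_map K (space T x) (space T' x) (\<gamma> x)"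
    "\<And>x. x \<in> verts Q \<Longrightarrow> bij_betw (\<gamma> x) (carrier (space T x)) (carrier (space T' x))"
    "\<And>a v. a \<in> arcs Q \<Longrightarrow> v \<in> carrier (space T (tail Q a)) \<Longrightarrow>
      \<gamma> (head Q a) (arrow_map T a v) = arrow_map T' a (\<gamma> (tail Q a) v)"
    using T'(2) by (rule rep_isoE) blast
  show ?thesis
  proof (rule rep_tensorI[OF V'(1) W'(1) T'(1), where \<tau> = "\<lambda>x v w. \<gamma> x (\<tau> x (\<alpha> x v) (\<beta> x w))"])
    show "tensor_presentation K (space V' x) (space W' x) (space T' x) (\<lambda>v w. \<gamma> x (\<tau> x (\<alpha> x v) (\<beta> x w)))"
      if "x \<in> verts Q" for x
      by (rule tensor_presentation_iso[OF \<tau>(1)[OF that] \<alpha>(1,2)[OF that] \<beta>(1,2)[OF that] \<gamma>(1,2)[OF that]]) simp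
    fix a v w assume a: "a \<in> arcs Q" and v: "v \<in> carrier (space V' (tail Q a))" and w: "w \<in> carrier (space W' (tail Q a))"
    note t = tail_in_verts[OF a]
    have v': "\<alpha> (tail Q a) v \<in> carrier (space V (tail Q a))" and w': "\<beta> (tail Q a) w \<in> carrier (space W (tail Q a))"
      using linear_mapD(3)[OF \<alpha>(1)[OF t] v] linear_mapD(3)[OF \<beta>(1)[OF t] w] .
    have t': "\<tau> (tail Q a) (\<alpha> (tail Q a) v) (\<beta> (tail Q a) w) \<in> carrier (space T (tail Q a))"
      using tensor_presentationD(5)[OF \<tau>(1)[OF t] v' w'] .
    show "arrow_map T' a (\<gamma> (tail Q a) (\<tau> (tail Q a) (\<alpha> (tail Q a) v) (\<beta> (tail Q a) w))) =
        \<gamma> (head Q a) (\<tau> (head Q a) (\<alpha> (head Q a) (arrow_map V' a v)) (\<beta> (head Q a) (arrow_map W' a w)))"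
      using \<gamma>(3)[OF a t'] \<tau>(2)[OF a v' w'] \<alpha>(3)[OF a v] \<beta>(3)[OF a w] by simp
  qed
qed

text \<open>
  The canonical isomorphisms at the vertices commute with the arrows because they do so on
  pure tensors.
\<close>

lemma rep_tensor_unique:
  assumes Q: "wf_digraph Q" and T: "rep_tensor K Q V W T" and T': "rep_tensor K Q V W T'"
  shows "rep_iso K Q T T'"
proof -
  interpret wf_digraph Q by fact
  obtain \<tau> where V: "is_rep K Q V" and W: "is_rep K Q W" and TR: "is_rep K Q T"
    and \<tau>: "\<And>x. x \<in> verts Q \<Longrightarrow> tensor_presentation K (space V x) (space W x) (space T x) (\<tau> x)"
    "\<And>a v w. a \<in> arcs Q \<Longrightarrow> v \<in> carrier (space V (tail Q a)) \<Longrightarrow> w \<in> carrier (space W (tail Q a)) \<Longrightarrow>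
       arrow_map T a (\<tau> (tail Q a) v w) = \<tau> (head Q a) (arrow_map V a v) (arrow_map W a w)"
    using T by (rule rep_tensorE) blast
  obtain \<tau>' where TR': "is_rep K Q T'"
    and \<tau>': "\<And>x. x \<in> verts Q \<Longrightarrow> tensor_presentation K (space V x) (space W x) (space T' x) (\<tau>' x)"
    "\<And>a v w. a \<in> arcs Q \<Longrightarrow> v \<in> carrier (space V (tail Q a)) \<Longrightarrow> w \<in> carrier (space W (tail Q a)) \<Longrightarrow>
       arrow_map T' a (\<tau>' (tail Q a) v w) = \<tau>' (head Q a) (arrow_map V a v) (arrow_map W a w)"
    using T' by (rule rep_tensorE) blast
  have "\<forall>x\<in>verts Q. \<exists>\<phi>. linear_map K (space T x) (space T' x) \<phi> \<and> bij_betw \<phi> (carrier (space T x)) (carrier (space T' x)) \<and>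
      (\<forall>v\<in>carrier (space V x). \<forall>w\<in>carrier (space W x). \<phi> (\<tau> x v w) = \<tau>' x v w)"
    using tensor_unique[OF \<tau>(1) \<tau>'(1) is_repD(1)[OF V] is_repD(1)[OF W]] by metis
  then obtain \<phi> where \<phi>: "\<And>x. x \<in> verts Q \<Longrightarrow> linear_map K (space T x) (space T' x) (\<phi> x)"
    "\<And>x. x \<in> verts Q \<Longrightarrow> bij_betw (\<phi> x) (carrier (space T x)) (carrier (space T' x))"
    "\<And>x v w. x \<in> verts Q \<Longrightarrow> v \<in> carrier (space V x) \<Longrightarrow> w \<in> carrier (space W x) \<Longrightarrow> \<phi> x (\<tau> x v w) = \<tau>' x v w" by metis
  show ?thesis
  proof (rule rep_isoI[OF \<phi>(1,2)])
    fix a s assume a: "a \<in> arcs Q" and s: "s \<in> carrier (space T (tail Q a))"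
    note t = tail_in_verts[OF a] and h = head_in_verts[OF a]
    show "\<phi> (head Q a) (arrow_map T a s) = arrow_map T' a (\<phi> (tail Q a) s)"
    proof (rule tensor_linear_maps_eq[OF \<tau>(1)[OF t] linear_map_comp[OF is_repD(2)[OF TR a] \<phi>(1)[OF h]]
          linear_map_comp[OF \<phi>(1)[OF t] is_repD(2)[OF TR' a]] _ s])
      fix v w assume vw: "v \<in> carrier (space V (tail Q a))" "w \<in> carrier (space W (tail Q a))"
      show "\<phi> (head Q a) (arrow_map T a (\<tau> (tail Q a) v w)) = arrow_map T' a (\<phi> (tail Q a) (\<tau> (tail Q a) v w))"
        using \<tau>(2)[OF a vw] \<tau>'(2)[OF a vw] \<phi>(3)[OF t vw] \<phi>(3)[OF h]
          linear_mapD(3)[OF is_repD(2)[OF V a] vw(1)] linear_mapD(3)[OF is_repD(2)[OF W a] vw(2)] by simp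
    qed
  qed
qed

lemma class_tensor_rep_class:
  fixes V W :: "('v, 'a, 'k) std_rep"
  assumes Q: "wf_digraph Q" and T: "rep_tensor K Q V W T"
  shows "class_tensor K Q (rep_class K Q V) (rep_class K Q W) = rep_class K Q T"
proof -
  have V: "is_rep K Q V" and W: "is_rep K Q W" and TR: "is_rep K Q T" using T by (simp_all add: rep_tensor_def)
  show ?thesis
  proof (intro equalityI subsetI)
    fix Z assume "Z \<in> class_tensor K Q (rep_class K Q V) (rep_class K Q W)"
    then obtain V' W' :: "('v, 'a, 'k) std_rep" where V': "is_rep K Q V'" "rep_iso K Q V' V" and W': "is_rep K Q W'" "rep_iso K Q W' W"
      and "is_rep_tensor K Q V' W' Z" by (auto simp: class_tensor_def rep_class_def)
    then have Z: "rep_tensor K Q V' W' Z" by (simp add: is_rep_tensor_iff_rep_tensor)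
    then have ZR: "is_rep K Q Z" by (simp add: rep_tensor_def)
    have "rep_tensor K Q V W Z"
      by (rule rep_tensor_iso[OF Q Z V rep_iso_sym[OF Q V'] W rep_iso_sym[OF Q W'] ZR rep_iso_refl[OF ZR]])
    then have "rep_iso K Q Z T" by (rule rep_tensor_unique[OF Q _ T])
    with ZR show "Z \<in> rep_class K Q T" unfolding rep_class_def by blast
  next
    fix Z assume "Z \<in> rep_class K Q T"
    then have Z: "is_rep K Q Z" "rep_iso K Q Z T" unfolding rep_class_def by blast+
    have "rep_tensor K Q V W Z"
      by (rule rep_tensor_iso[OF Q T V rep_iso_refl[OF V] W rep_iso_refl[OF W] Z(1) rep_iso_sym[OF Q Z]])
    then have ten: "is_rep_tensor K Q V W Z" by (rule is_rep_tensor_iff_rep_tensor[OF V W, THEN iffD2])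
    have mem: "V \<in> rep_class K Q V" "W \<in> rep_class K Q W"
      using V W by (simp_all add: rep_class_def rep_iso_refl)
    show "Z \<in> class_tensor K Q (rep_class K Q V) (rep_class K Q W)"
      unfolding class_tensor_def by (intro CollectI bexI[OF _ mem(1)] bexI[OF _ mem(2)] ten)
  qed
qed

lemma rep_tensor_swap:
  assumes "rep_tensor K Q V W T"
  shows "rep_tensor K Q W V T"
proof -
  obtain \<tau> where V: "is_rep K Q V" and W: "is_rep K Q W" and T: "is_rep K Q T"
    and \<tau>: "\<And>x. x \<in> verts Q \<Longrightarrow> tensor_presentation K (space V x) (space W x) (space T x) (\<tau> x)"
    "\<And>a v w. a \<in> arcs Q \<Longrightarrow> v \<in> carrier (space V (tail Q a)) \<Longrightarrow> w \<in> carrier (space W (tail Q a)) \<Longrightarrow>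
       arrow_map T a (\<tau> (tail Q a) v w) = \<tau> (head Q a) (arrow_map V a v) (arrow_map W a w)"
    using assms by (rule rep_tensorE) blast
  show ?thesis
    by (rule rep_tensorI[OF W V T, where \<tau> = "\<lambda>x w v. \<tau> x v w"])
      (simp_all add: \<tau>(2) tensor_presentation_swap[OF \<tau>(1)])
qed

lemma fd_space_self_space:
  assumes "field K"
  shows "fd_space K (self_space K)"
proof -
  interpret S: vectorspace K "self_space K" by (rule vectorspace_self_space[OF assms])
  have "c \<in> S.span {\<one>\<^bsub>K\<^esub>}" if "c \<in> carrier K" for c
  proof -
    have sub: "{\<one>\<^bsub>K\<^esub>} \<subseteq> carrier (self_space K)" by simp
    interpret N: submodule K "S.span {\<one>\<^bsub>K\<^esub>}" "self_space K" by (rule S.span_is_submodule[OF sub])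
    have "\<one>\<^bsub>K\<^esub> \<in> S.span {\<one>\<^bsub>K\<^esub>}" using S.in_own_span[OF sub] by blast
    from N.smult_closed[OF that this] show ?thesis using that by simp
  qed
  then have "S.gen_set {\<one>\<^bsub>K\<^esub>}" using S.span_is_subset2[of "{\<one>\<^bsub>K\<^esub>}"] by auto
  then have "S.fin_dim" unfolding S.fin_dim_def by (intro exI[of _ "{\<one>\<^bsub>K\<^esub>}"]) auto
  then show ?thesis using S.vectorspace_axioms by simp
qed

lemma is_rep_unit: "field K \<Longrightarrow> is_rep K Q (unit_rep K)"
  using fd_space_self_space[of K] linear_map_id[of K "self_space K"]
  by (simp add: is_rep_def unit_rep_def id_def)

lemma rep_tensor_unit:
  assumes "field K" and V: "is_rep K Q V"
  shows "rep_tensor K Q V (unit_rep K) V"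
proof (rule rep_tensorI[OF V is_rep_unit[OF assms(1)] V, where \<tau> = "\<lambda>x v c. c \<odot>\<^bsub>space V x\<^esub> v"])
  show "tensor_presentation K (space V x) (space (unit_rep K) x) (space V x) (\<lambda>v c. c \<odot>\<^bsub>space V x\<^esub> v)"
    if "x \<in> verts Q" for x
    using tensor_presentation_unit[of K "space V x"] is_repD(1)[OF V that] by (simp add: unit_rep_def)
  show "arrow_map V a (c \<odot>\<^bsub>space V (tail Q a)\<^esub> v) = arrow_map (unit_rep K) a c \<odot>\<^bsub>space V (head Q a)\<^esub> arrow_map V a v"
    if "a \<in> arcs Q" "v \<in> carrier (space V (tail Q a))" "c \<in> carrier (space (unit_rep K) (tail Q a))" for a v c
    using linear_mapD(5)[OF is_repD(2)[OF V that(1)]] that by (simp add: unit_rep_def)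
qed

lemma rep_tensor_sum:
  assumes "rep_tensor K Q V X T" "rep_tensor K Q W X U"
  shows "rep_tensor K Q (rep_sum V W) X (rep_sum T U)"
proof -
  obtain \<tau> where V: "is_rep K Q V" and X: "is_rep K Q X" and T: "is_rep K Q T"
    and \<tau>: "\<And>x. x \<in> verts Q \<Longrightarrow> tensor_presentation K (space V x) (space X x) (space T x) (\<tau> x)"
    "\<And>a v w. a \<in> arcs Q \<Longrightarrow> v \<in> carrier (space V (tail Q a)) \<Longrightarrow> w \<in> carrier (space X (tail Q a)) \<Longrightarrow>
       arrow_map T a (\<tau> (tail Q a) v w) = \<tau> (head Q a) (arrow_map V a v) (arrow_map X a w)"
    using assms(1) by (rule rep_tensorE) blast
  obtain \<upsilon> where W: "is_rep K Q W" and U: "is_rep K Q U"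
    and \<upsilon>: "\<And>x. x \<in> verts Q \<Longrightarrow> tensor_presentation K (space W x) (space X x) (space U x) (\<upsilon> x)"
    "\<And>a v w. a \<in> arcs Q \<Longrightarrow> v \<in> carrier (space W (tail Q a)) \<Longrightarrow> w \<in> carrier (space X (tail Q a)) \<Longrightarrow>
       arrow_map U a (\<upsilon> (tail Q a) v w) = \<upsilon> (head Q a) (arrow_map W a v) (arrow_map X a w)"
    using assms(2) by (rule rep_tensorE) blast
  show ?thesis
  proof (rule rep_tensorI[OF is_rep_sum[OF V W] X is_rep_sum[OF T U],
        where \<tau> = "\<lambda>x v w. (\<tau> x (fst v) w, \<upsilon> x (snd v) w)"])
    show "tensor_presentation K (space (rep_sum V W) x) (space X x) (space (rep_sum T U) x)
        (\<lambda>v w. (\<tau> x (fst v) w, \<upsilon> x (snd v) w))" if "x \<in> verts Q" for x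
      using tensor_presentation_direct_sum[OF \<tau>(1)[OF that] \<upsilon>(1)[OF that]] by (simp add: rep_sum_def)
    show "arrow_map (rep_sum T U) a (\<tau> (tail Q a) (fst v) w, \<upsilon> (tail Q a) (snd v) w) =
        (\<tau> (head Q a) (fst (arrow_map (rep_sum V W) a v)) (arrow_map X a w),
         \<upsilon> (head Q a) (snd (arrow_map (rep_sum V W) a v)) (arrow_map X a w))"
      if "a \<in> arcs Q" "v \<in> carrier (space (rep_sum V W) (tail Q a))" "w \<in> carrier (space X (tail Q a))" for a v w
      using that by (auto simp: rep_sum_def \<tau>(2) \<upsilon>(2))
  qed
qed

lemma rep_tensor_assoc:
  assumes Q: "wf_digraph Q" and A: "rep_tensor K Q V W A" and B: "rep_tensor K Q W X B" and R: "rep_tensor K Q V B R"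
  shows "rep_tensor K Q A X R"
proof -
  interpret wf_digraph Q by fact
  obtain \<alpha> where V: "is_rep K Q V" and W: "is_rep K Q W" and AR: "is_rep K Q A"
    and \<alpha>: "\<And>x. x \<in> verts Q \<Longrightarrow> tensor_presentation K (space V x) (space W x) (space A x) (\<alpha> x)"
    "\<And>a v w. a \<in> arcs Q \<Longrightarrow> v \<in> carrier (space V (tail Q a)) \<Longrightarrow> w \<in> carrier (space W (tail Q a)) \<Longrightarrow>
       arrow_map A a (\<alpha> (tail Q a) v w) = \<alpha> (head Q a) (arrow_map V a v) (arrow_map W a w)"
    using A by (rule rep_tensorE) blast
  obtain \<beta> where X: "is_rep K Q X" and BR: "is_rep K Q B"
    and \<beta>: "\<And>x. x \<in> verts Q \<Longrightarrow> tensor_presentation K (space W x) (space X x) (space B x) (\<beta> x)"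
    "\<And>a v w. a \<in> arcs Q \<Longrightarrow> v \<in> carrier (space W (tail Q a)) \<Longrightarrow> w \<in> carrier (space X (tail Q a)) \<Longrightarrow>
       arrow_map B a (\<beta> (tail Q a) v w) = \<beta> (head Q a) (arrow_map W a v) (arrow_map X a w)"
    using B by (rule rep_tensorE) blast
  obtain \<rho> where RR: "is_rep K Q R"
    and \<rho>: "\<And>x. x \<in> verts Q \<Longrightarrow> tensor_presentation K (space V x) (space B x) (space R x) (\<rho> x)"
    "\<And>a v w. a \<in> arcs Q \<Longrightarrow> v \<in> carrier (space V (tail Q a)) \<Longrightarrow> w \<in> carrier (space B (tail Q a)) \<Longrightarrow>
       arrow_map R a (\<rho> (tail Q a) v w) = \<rho> (head Q a) (arrow_map V a v) (arrow_map B a w)"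
    using R by (rule rep_tensorE) blast
  have "\<forall>x\<in>verts Q. \<exists>\<sigma>. tensor_presentation K (space A x) (space X x) (space R x) \<sigma> \<and>
      (\<forall>v\<in>carrier (space V x). \<forall>w\<in>carrier (space W x). \<forall>y\<in>carrier (space X x). \<sigma> (\<alpha> x v w) y = \<rho> x v (\<beta> x w y))"
    using tensor_presentation_assoc[OF \<alpha>(1) \<beta>(1) \<rho>(1) is_repD(1)[OF V] is_repD(1)[OF W] is_repD(1)[OF X]] by metis
  then obtain \<sigma> where \<sigma>: "\<And>x. x \<in> verts Q \<Longrightarrow> tensor_presentation K (space A x) (space X x) (space R x) (\<sigma> x)"
    "\<And>x v w y. x \<in> verts Q \<Longrightarrow> v \<in> carrier (space V x) \<Longrightarrow> w \<in> carrier (space W x) \<Longrightarrow> y \<in> carrier (space X x) \<Longrightarrow>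
      \<sigma> x (\<alpha> x v w) y = \<rho> x v (\<beta> x w y)" by metis
  show ?thesis
  proof (rule rep_tensorI[OF AR X RR \<sigma>(1)])
    fix a s y assume a: "a \<in> arcs Q" and s: "s \<in> carrier (space A (tail Q a))" and y: "y \<in> carrier (space X (tail Q a))"
    note t = tail_in_verts[OF a] and h = head_in_verts[OF a]
    have y': "arrow_map X a y \<in> carrier (space X (head Q a))" by (rule linear_mapD(3)[OF is_repD(2)[OF X a] y])
    show "arrow_map R a (\<sigma> (tail Q a) s y) = \<sigma> (head Q a) (arrow_map A a s) (arrow_map X a y)"
    proof (rule tensor_linear_maps_eq[OF \<alpha>(1)[OF t]
          linear_map_comp[OF bilinear_mapD(2)[OF tensor_presentationD(4)[OF \<sigma>(1)[OF t]] y] is_repD(2)[OF RR a]]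
          linear_map_comp[OF is_repD(2)[OF AR a] bilinear_mapD(2)[OF tensor_presentationD(4)[OF \<sigma>(1)[OF h]] y']] _ s])
      fix v w assume vw: "v \<in> carrier (space V (tail Q a))" "w \<in> carrier (space W (tail Q a))"
      have v': "arrow_map V a v \<in> carrier (space V (head Q a))" by (rule linear_mapD(3)[OF is_repD(2)[OF V a] vw(1)])
      have w': "arrow_map W a w \<in> carrier (space W (head Q a))" by (rule linear_mapD(3)[OF is_repD(2)[OF W a] vw(2)])
      show "arrow_map R a (\<sigma> (tail Q a) (\<alpha> (tail Q a) v w) y) =
          \<sigma> (head Q a) (arrow_map A a (\<alpha> (tail Q a) v w)) (arrow_map X a y)"
        using \<sigma>(2)[OF t vw y] \<sigma>(2)[OF h v' w' y'] \<alpha>(2)[OF a vw] \<beta>(2)[OF a vw(2) y]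
          \<rho>(2)[OF a vw(1) tensor_presentationD(5)[OF \<beta>(1)[OF t] vw(2) y]] by simp
    qed
  qed
qed

text \<open>
  Each law is a statement about representations, transferred to classes. The unit and the
  direct sums are first replaced by isomorphic representations whose vectors are lists, since
  only these are members of classes.
\<close>

lemma class_semiring_iso_classes:
  fixes Q :: "('v, 'a) pre_digraph" and K :: "'k ring"
  assumes K: "field K" and Q: "wf_digraph Q"
  shows "class_semiring (iso_classes K Q) (class_sum K Q) (class_tensor K Q) (rep_class K Q (unit_rep K))"
proof
  fix A B assume A: "A \<in> iso_classes K Q" and B: "B \<in> iso_classes K Q"
  obtain V :: "('v, 'a, 'k) std_rep" where V: "is_rep K Q V" "A = rep_class K Q V" by (rule iso_classesE[OF A])
  obtain W :: "('v, 'a, 'k) std_rep" where W: "is_rep K Q W" "B = rep_class K Q W" by (rule iso_classesE[OF B])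
  obtain T :: "('v, 'a, 'k) std_rep" where T: "rep_tensor K Q V W T" by (rule rep_tensor_exists[OF Q V(1) W(1)])
  have TR: "is_rep K Q T" using T by (simp add: rep_tensor_def)
  show "class_sum K Q A B \<in> iso_classes K Q"
    using rep_class_in_iso_classes[OF Q is_rep_sum[OF V(1) W(1)]] class_sum_rep_class[OF Q V(1) W(1)] V W by simp
  show "class_tensor K Q A B \<in> iso_classes K Q"
    using rep_class_in_iso_classes[OF Q TR] class_tensor_rep_class[OF Q T] V W by simp
  show "class_tensor K Q A B = class_tensor K Q B A"
    using class_tensor_rep_class[OF Q T] class_tensor_rep_class[OF Q rep_tensor_swap[OF T]] V W by simp
  obtain U :: "('v, 'a, 'k) std_rep" where U: "is_rep K Q U" "rep_iso K Q (unit_rep K) U"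
    by (rule std_rep_exists[OF Q is_rep_unit[OF K]])
  have "rep_tensor K Q V U V"
    by (rule rep_tensor_iso[OF Q rep_tensor_unit[OF K V(1)] V(1) rep_iso_refl[OF V(1)] U(1)
          rep_iso_sym[OF Q is_rep_unit[OF K] U(2)] V(1) rep_iso_refl[OF V(1)]])
  moreover have "rep_class K Q (unit_rep K) = rep_class K Q U"
    using U rep_class_eq_iff[OF Q is_rep_unit[OF K] U(1)] by simp
  ultimately show "class_tensor K Q A (rep_class K Q (unit_rep K)) = A"
    using class_tensor_rep_class[OF Q, of K V U V] V by simp
  fix C assume C: "C \<in> iso_classes K Q"
  obtain X :: "('v, 'a, 'k) std_rep" where X: "is_rep K Q X" "C = rep_class K Q X" by (rule iso_classesE[OF C])
  obtain T' :: "('v, 'a, 'k) std_rep" where T': "rep_tensor K Q W X T'" by (rule rep_tensor_exists[OF Q W(1) X(1)])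
  have TR': "is_rep K Q T'" using T' by (simp add: rep_tensor_def)
  obtain R :: "('v, 'a, 'k) std_rep" where R: "rep_tensor K Q V T' R" by (rule rep_tensor_exists[OF Q V(1) TR'])
  show "class_tensor K Q (class_tensor K Q A B) C = class_tensor K Q A (class_tensor K Q B C)"
    using class_tensor_rep_class[OF Q T] class_tensor_rep_class[OF Q T'] class_tensor_rep_class[OF Q R]
      class_tensor_rep_class[OF Q rep_tensor_assoc[OF Q T T' R]] V W X by simp
  obtain T1 :: "('v, 'a, 'k) std_rep" where T1: "rep_tensor K Q V X T1" by (rule rep_tensor_exists[OF Q V(1) X(1)])
  have TR1: "is_rep K Q T1" using T1 by (simp add: rep_tensor_def)
  obtain S :: "('v, 'a, 'k) std_rep" where S: "is_rep K Q S" "rep_iso K Q (rep_sum V W) S"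
    by (rule std_rep_exists[OF Q is_rep_sum[OF V(1) W(1)]])
  obtain S' :: "('v, 'a, 'k) std_rep" where S': "is_rep K Q S'" "rep_iso K Q (rep_sum T1 T') S'"
    by (rule std_rep_exists[OF Q is_rep_sum[OF TR1 TR']])
  have t: "rep_tensor K Q S X S'"
    by (rule rep_tensor_iso[OF Q rep_tensor_sum[OF T1 T'] S(1) rep_iso_sym[OF Q is_rep_sum[OF V(1) W(1)] S(2)]
          X(1) rep_iso_refl[OF X(1)] S'])
  have "class_sum K Q A B = rep_class K Q S"
    using class_sum_rep_class[OF Q V(1) W(1)] rep_class_eq_iff[OF Q is_rep_sum[OF V(1) W(1)] S(1)] S V W by simp
  moreover have "class_sum K Q (class_tensor K Q A C) (class_tensor K Q B C) = rep_class K Q S'"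
    using class_sum_rep_class[OF Q TR1 TR'] rep_class_eq_iff[OF Q is_rep_sum[OF TR1 TR'] S'(1)] S'
      class_tensor_rep_class[OF Q T1] class_tensor_rep_class[OF Q T'] V W X by simp
  ultimately show "class_tensor K Q (class_sum K Q A B) C = class_sum K Q (class_tensor K Q A C) (class_tensor K Q B C)"
    using class_tensor_rep_class[OF Q t] X by simp
qed (rule rep_class_in_iso_classes[OF Q is_rep_unit[OF K]])

lemma finite_multiplicative_type_iff:
  assumes K: "field K" and Q: "wf_digraph Q"
  shows "finite_multiplicative_type K Q \<longleftrightarrow> finite_mod_radical
    (monoid_algebra (iso_classes K Q) (class_tensor K Q) (rep_class K Q (unit_rep K)))
    (additivity_ideal (iso_classes K Q) (class_sum K Q) (class_tensor K Q) (rep_class K Q (unit_rep K)))"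
proof -
  interpret S: class_semiring "iso_classes K Q" "class_sum K Q" "class_tensor K Q" "rep_class K Q (unit_rep K)"
    by (rule class_semiring_iso_classes[OF assms])
  have "free_rep_ring K Q = S.alg"
    by (simp add: free_rep_ring_def monoid_algebra_def frag_mult_def fun_eq_iff)
  moreover have "sum_relations K Q = additivity_relations (iso_classes K Q) (class_sum K Q)"
    by (simp add: sum_relations_def additivity_relations_def)
  ultimately have "rep_ring K Q = S.alg Quot S.relations_ideal"
    by (simp only: rep_ring_def additivity_ideal_def)
  then show ?thesis
    unfolding finite_multiplicative_type_def Let_def
    using S.alg.reduced_quotient_fin_gen_iff[OF S.ideal_relations] by simp
qed

section \<open>Pull-back along maps of quivers\<close>

text \<open>
  The map of quivers may collapse arrows: the value \<open>None\<close> means that the arrow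
  goes to the identity at a vertex.
\<close>

definition pull_rep :: "('v \<Rightarrow> 'w) \<Rightarrow> ('a \<Rightarrow> 'b option) \<Rightarrow> ('w, 'b, 'k, 'u) quiver_rep \<Rightarrow> ('v, 'a, 'k, 'u) quiver_rep" where
  "pull_rep gv ga V = \<lparr>space = (\<lambda>x. space V (gv x)),
     arrow_map = (\<lambda>a. case ga a of None \<Rightarrow> id | Some b \<Rightarrow> arrow_map V b)\<rparr>"

locale quiver_map = P: wf_digraph P + Q: wf_digraph Q
  for P :: "('v, 'a) pre_digraph" and Q :: "('w, 'b) pre_digraph" +
  fixes gv :: "'v \<Rightarrow> 'w" and ga :: "'a \<Rightarrow> 'b option"
  assumes vert: "x \<in> verts P \<Longrightarrow> gv x \<in> verts Q"
    and arc: "a \<in> arcs P \<Longrightarrow> ga a = Some b \<Longrightarrow> b \<in> arcs Q \<and> tail Q b = gv (tail P a) \<and> head Q b = gv (head P a)"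
    and identity: "a \<in> arcs P \<Longrightarrow> ga a = None \<Longrightarrow> gv (tail P a) = gv (head P a)"
begin

abbreviation "pull \<equiv> pull_rep gv ga"

lemma space_pull [simp]: "space (pull V) x = space V (gv x)"
  by (simp add: pull_rep_def)

lemma arrow_map_pull [simp]:
  "ga a = Some b \<Longrightarrow> arrow_map (pull V) a = arrow_map V b"
  "ga a = None \<Longrightarrow> arrow_map (pull V) a = id"
  by (simp_all add: pull_rep_def)

lemma arc_cases:
  assumes "a \<in> arcs P"
  obtains b where "ga a = Some b" "b \<in> arcs Q" "gv (tail P a) = tail Q b" "gv (head P a) = head Q b"
  | "ga a = None" "gv (head P a) = gv (tail P a)"
proof (cases "ga a")
  case None
  then show ?thesis using that(2) identity[OF assms None] by presburger
next
  case (Some b)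
  then show ?thesis using that(1)[OF Some] arc[OF assms Some] by presburger
qed

lemma is_rep_pull:
  assumes "is_rep K Q V"
  shows "is_rep K P (pull V)"
  unfolding is_rep_def
proof (intro conjI ballI)
  show "vectorspace K (space (pull V) x)" "vectorspace.fin_dim K (space (pull V) x)" if "x \<in> verts P" for x
    using is_repD(1)[OF assms vert[OF that]] by simp_all
  fix a assume a: "a \<in> arcs P"
  then show "linear_map K (space (pull V) (tail P a)) (space (pull V) (head P a)) (arrow_map (pull V) a)"
    using is_repD[OF assms] vert[OF P.tail_in_verts[OF a]]
    by (cases rule: arc_cases) (auto simp: id_def linear_map_id)
qed

lemma rep_iso_pull:
  assumes "rep_iso K Q V W"
  shows "rep_iso K P (pull V) (pull W)"
proof -
  obtain \<phi> where \<phi>: "\<And>x. x \<in> verts Q \<Longrightarrow> linear_map K (space V x) (space W x) (\<phi> x)"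
    "\<And>x. x \<in> verts Q \<Longrightarrow> bij_betw (\<phi> x) (carrier (space V x)) (carrier (space W x))"
    "\<And>a v. a \<in> arcs Q \<Longrightarrow> v \<in> carrier (space V (tail Q a)) \<Longrightarrow>
      \<phi> (head Q a) (arrow_map V a v) = arrow_map W a (\<phi> (tail Q a) v)"
    using assms by (rule rep_isoE) blast
  show ?thesis
  proof (rule rep_isoI[where \<phi> = "\<lambda>x. \<phi> (gv x)"])
    fix a v assume a: "a \<in> arcs P" and v: "v \<in> carrier (space (pull V) (tail P a))"
    from a show "\<phi> (gv (head P a)) (arrow_map (pull V) a v) = arrow_map (pull W) a (\<phi> (gv (tail P a)) v)"
      using v \<phi>(3) by (cases rule: arc_cases) auto
  qed (use \<phi> vert in simp_all)
qed

lemma pull_sum: "pull (rep_sum V W) = rep_sum (pull V) (pull W)"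
  by (auto simp: pull_rep_def rep_sum_def fun_eq_iff split: option.splits)

lemma pull_unit: "pull (unit_rep K) = unit_rep K"
  by (auto simp: pull_rep_def unit_rep_def fun_eq_iff split: option.splits)

lemma rep_tensor_pull:
  assumes "rep_tensor K Q V W T"
  shows "rep_tensor K P (pull V) (pull W) (pull T)"
proof -
  obtain \<tau> where V: "is_rep K Q V" and W: "is_rep K Q W" and T: "is_rep K Q T"
    and \<tau>: "\<And>x. x \<in> verts Q \<Longrightarrow> tensor_presentation K (space V x) (space W x) (space T x) (\<tau> x)"
    "\<And>a v w. a \<in> arcs Q \<Longrightarrow> v \<in> carrier (space V (tail Q a)) \<Longrightarrow> w \<in> carrier (space W (tail Q a)) \<Longrightarrow>
       arrow_map T a (\<tau> (tail Q a) v w) = \<tau> (head Q a) (arrow_map V a v) (arrow_map W a w)"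
    using assms by (rule rep_tensorE) blast
  show ?thesis
  proof (rule rep_tensorI[OF is_rep_pull[OF V] is_rep_pull[OF W] is_rep_pull[OF T], where \<tau> = "\<lambda>x. \<tau> (gv x)"])
    show "tensor_presentation K (space (pull V) x) (space (pull W) x) (space (pull T) x) (\<tau> (gv x))" if "x \<in> verts P" for x
      using \<tau>(1)[OF vert[OF that]] by simp
    fix a v w assume a: "a \<in> arcs P" and v: "v \<in> carrier (space (pull V) (tail P a))"
      and w: "w \<in> carrier (space (pull W) (tail P a))"
    from a show "arrow_map (pull T) a (\<tau> (gv (tail P a)) v w) =
        \<tau> (gv (head P a)) (arrow_map (pull V) a v) (arrow_map (pull W) a w)"
      using v w \<tau>(2) by (cases rule: arc_cases) auto
  qed
qed

definition class_pull :: "'k ring \<Rightarrow> ('w, 'b, 'k) std_rep set \<Rightarrow> ('v, 'a, 'k) std_rep set" where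
  "class_pull K A = (\<Union>V\<in>A. rep_class K P (pull V))"

lemma class_pull_rep_class:
  fixes V :: "('w, 'b, 'k) std_rep"
  assumes V: "is_rep K Q V"
  shows "class_pull K (rep_class K Q V) = rep_class K P (pull V)"
proof -
  have "rep_class K P (pull V') = rep_class K P (pull V)" if "V' \<in> rep_class K Q V" for V'
    using that rep_iso_pull is_rep_pull V unfolding rep_class_def[of K Q]
    by (subst rep_class_eq_iff[OF P.wf_digraph_axioms]) auto
  moreover have "V \<in> rep_class K Q V" using V by (simp add: rep_class_def rep_iso_refl)
  ultimately show ?thesis unfolding class_pull_def by blast
qed

text \<open>
  Pulling back does nothing but reindex vertices and arrows, so it commutes with the
  operations on the nose. What remains is to pass from representations to their classes.
\<close>

lemma class_pull_hom:
  fixes K :: "'k ring"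
  assumes K: "field K"
  shows "class_pull K ` iso_classes K Q \<subseteq> iso_classes K P"
    and "class_pull K (rep_class K Q (unit_rep K)) = rep_class K P (unit_rep K)"
    and "A \<in> iso_classes K Q \<Longrightarrow> B \<in> iso_classes K Q \<Longrightarrow>
      class_pull K (class_tensor K Q A B) = class_tensor K P (class_pull K A) (class_pull K B)"
    and "A \<in> iso_classes K Q \<Longrightarrow> B \<in> iso_classes K Q \<Longrightarrow>
      class_pull K (class_sum K Q A B) = class_sum K P (class_pull K A) (class_pull K B)"
proof -
  note P = P.wf_digraph_axioms and Q = Q.wf_digraph_axioms
  have std: "class_pull K (rep_class K Q V) = rep_class K P (pull V)" if V: "is_rep K Q V"
    for V :: "('w, 'b, 'k, 'u) quiver_rep"
  proof -
    obtain Z :: "('w, 'b, 'k) std_rep" where Z: "is_rep K Q Z" "rep_iso K Q V Z" by (rule std_rep_exists[OF Q V])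
    have "rep_class K Q V = rep_class K Q Z" "rep_class K P (pull V) = rep_class K P (pull Z)"
      using rep_class_eq_iff[OF Q V Z(1)] rep_class_eq_iff[OF P is_rep_pull[OF V] is_rep_pull[OF Z(1)]]
        Z(2) rep_iso_pull[OF Z(2)] by simp_all
    then show ?thesis using class_pull_rep_class[OF Z(1)] by simp
  qed
  show "class_pull K ` iso_classes K Q \<subseteq> iso_classes K P"
  proof
    fix B assume "B \<in> class_pull K ` iso_classes K Q"
    then obtain A where A: "A \<in> iso_classes K Q" "B = class_pull K A" by blast
    obtain V :: "('w, 'b, 'k) std_rep" where V: "is_rep K Q V" "A = rep_class K Q V" by (rule iso_classesE[OF A(1)])
    then show "B \<in> iso_classes K P"
      using rep_class_in_iso_classes[OF P is_rep_pull[OF V(1)]] class_pull_rep_class[OF V(1)] A(2) by simp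
  qed
  obtain U :: "('w, 'b, 'k) std_rep" where U: "is_rep K Q U" "rep_iso K Q (unit_rep K) U"
    by (rule std_rep_exists[OF Q is_rep_unit[OF K]])
  have "rep_class K Q (unit_rep K) = rep_class K Q U" "rep_class K P (unit_rep K) = rep_class K P (pull U)"
    using rep_class_eq_iff[OF Q is_rep_unit[OF K] U(1)] rep_class_eq_iff[OF P is_rep_unit[OF K] is_rep_pull[OF U(1)]]
      U(2) rep_iso_pull[OF U(2)] by (simp_all add: pull_unit)
  then show "class_pull K (rep_class K Q (unit_rep K)) = rep_class K P (unit_rep K)"
    using class_pull_rep_class[OF U(1)] by simp
  assume A: "A \<in> iso_classes K Q" and B: "B \<in> iso_classes K Q"
  obtain V :: "('w, 'b, 'k) std_rep" where V: "is_rep K Q V" "A = rep_class K Q V" by (rule iso_classesE[OF A])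
  obtain W :: "('w, 'b, 'k) std_rep" where W: "is_rep K Q W" "B = rep_class K Q W" by (rule iso_classesE[OF B])
  obtain T :: "('w, 'b, 'k) std_rep" where T: "rep_tensor K Q V W T" by (rule rep_tensor_exists[OF Q V(1) W(1)])
  have TR: "is_rep K Q T" using T by (simp add: rep_tensor_def)
  show "class_pull K (class_tensor K Q A B) = class_tensor K P (class_pull K A) (class_pull K B)"
    using class_tensor_rep_class[OF Q T] class_tensor_rep_class[OF P rep_tensor_pull[OF T]]
      class_pull_rep_class[OF V(1)] class_pull_rep_class[OF W(1)] class_pull_rep_class[OF TR] V W by simp
  obtain S :: "('w, 'b, 'k) std_rep" where S: "is_rep K Q S" "rep_iso K Q (rep_sum V W) S"
    by (rule std_rep_exists[OF Q is_rep_sum[OF V(1) W(1)]])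
  have "rep_class K P (pull S) = rep_class K P (rep_sum (pull V) (pull W))"
    using rep_class_eq_iff[OF P is_rep_sum[OF is_rep_pull[OF V(1)] is_rep_pull[OF W(1)]] is_rep_pull[OF S(1)]]
      rep_iso_pull[OF S(2)] by (simp add: pull_sum)
  moreover have "rep_class K Q (rep_sum V W) = rep_class K Q S"
    using rep_class_eq_iff[OF Q is_rep_sum[OF V(1) W(1)] S(1)] S(2) by simp
  ultimately show "class_pull K (class_sum K Q A B) = class_sum K P (class_pull K A) (class_pull K B)"
    using class_sum_rep_class[OF Q V(1) W(1)] class_sum_rep_class[OF P is_rep_pull[OF V(1)] is_rep_pull[OF W(1)]]
      class_pull_rep_class[OF V(1)] class_pull_rep_class[OF W(1)] class_pull_rep_class[OF S(1)] V W by simp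
qed

lemma finite_multiplicative_type_pull_surj:
  fixes K :: "'k ring"
  assumes K: "field K" and fin: "finite_multiplicative_type K Q"
    and ext: "\<And>W :: ('v, 'a, 'k) std_rep. is_rep K P W \<Longrightarrow>
      \<exists>V :: ('w, 'b, 'k) std_rep. is_rep K Q V \<and> rep_iso K P (pull V) W"
  shows "finite_multiplicative_type K P"
proof -
  note P = P.wf_digraph_axioms and Q = Q.wf_digraph_axioms
  have "B \<in> class_pull K ` iso_classes K Q" if B: "B \<in> iso_classes K P" for B
  proof -
    obtain W :: "('v, 'a, 'k) std_rep" where W: "is_rep K P W" "B = rep_class K P W" by (rule iso_classesE[OF B])
    obtain V :: "('w, 'b, 'k) std_rep" where V: "is_rep K Q V" "rep_iso K P (pull V) W" using ext[OF W(1)] by blast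
    have "B = class_pull K (rep_class K Q V)"
      using class_pull_rep_class[OF V(1)] rep_class_eq_iff[OF P is_rep_pull[OF V(1)] W(1)] V(2) W(2) by simp
    then show ?thesis using rep_class_in_iso_classes[OF Q V(1)] by blast
  qed
  then have "class_pull K ` iso_classes K Q = iso_classes K P" using class_pull_hom(1)[OF K] by blast
  from finite_mod_radical_surjective_class_hom[where f = "class_pull K", OF class_semiring_iso_classes[OF K Q] class_semiring_iso_classes[OF K P]
      this class_pull_hom(2)[OF K] class_pull_hom(3)[OF K] class_pull_hom(4)[OF K]]
  show ?thesis using fin finite_multiplicative_type_iff[OF K P] finite_multiplicative_type_iff[OF K Q] by simp
qed

lemma finite_multiplicative_type_pull_split:
  fixes K :: "'k ring"
  assumes K: "field K" and fin: "finite_multiplicative_type K P"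
    and G: "G ` iso_classes K P \<subseteq> iso_classes K Q"
    and G_sum: "\<And>A B. A \<in> iso_classes K P \<Longrightarrow> B \<in> iso_classes K P \<Longrightarrow>
      G (class_sum K P A B) = class_sum K Q (G A) (G B)"
    and G_pull: "\<And>V :: ('w, 'b, 'k) std_rep. is_rep K Q V \<Longrightarrow> G (rep_class K P (pull V)) = rep_class K Q V"
  shows "finite_multiplicative_type K Q"
proof -
  note P = P.wf_digraph_axioms and Q = Q.wf_digraph_axioms
  have "G (class_pull K A) = A" if A: "A \<in> iso_classes K Q" for A
  proof -
    obtain V :: "('w, 'b, 'k) std_rep" where V: "is_rep K Q V" "A = rep_class K Q V" by (rule iso_classesE[OF A])
    then show ?thesis using G_pull[OF V(1)] class_pull_rep_class[OF V(1)] by simp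
  qed
  from finite_mod_radical_split_class_hom[where f = "class_pull K" and g = G, OF class_semiring_iso_classes[OF K P] class_semiring_iso_classes[OF K Q]
      class_pull_hom(1-3)[OF K] G G_sum this]
  show ?thesis using fin finite_multiplicative_type_iff[OF K P] finite_multiplicative_type_iff[OF K Q] by simp
qed

end

section \<open>Subquivers and isomorphic quivers\<close>

lemma fd_space_singleton:
  fixes K :: "'k ring"
  assumes "field K"
  obtains Z :: "('k, 'k list) module" where "fd_space K Z" "carrier Z = {[]}" "\<zero>\<^bsub>Z\<^esub> = []"
proof -
  interpret K: field K by fact
  define Z :: "('k, 'k list) module" where "Z = \<lparr>carrier = {[]}, monoid.mult = (\<lambda>x y. x), one = [], zero = [],
    add = (\<lambda>x y. x), smult = (\<lambda>c x. x)\<rparr>"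
  have im: "(\<lambda>_. []) ` carrier (self_space K) = carrier Z" using K.zero_closed by (auto simp: Z_def)
  have "linear_map K (self_space K) Z (\<lambda>_. [])"
    using fd_space_self_space[OF assms] by (intro linear_map_on_image im[symmetric]) (auto simp: Z_def)
  from fin_dim_linear_image[OF this im] have "fd_space K Z" using fd_space_self_space[OF assms] by blast
  then show ?thesis by (rule that) (simp_all add: Z_def)
qed

text \<open>
  The pull-back along the inclusion of a subquiver is restriction, and every representation of
  the subquiver is a restriction: extend it by zero spaces and zero maps. An arrow outside the
  subquiver may join two of its vertices; it acts by zero.
\<close>

lemma finite_multiplicative_type_subgraph:
  fixes K :: "'k ring" and Q :: "('v, 'a) pre_digraph"
  assumes K: "field K" and sub: "subgraph P Q" and fin: "finite_multiplicative_type K Q"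
  shows "finite_multiplicative_type K P"
proof -
  have sub': "verts P \<subseteq> verts Q" "arcs P \<subseteq> arcs Q" "wf_digraph P" "wf_digraph Q" "tail P = tail Q" "head P = head Q"
    using sub unfolding subgraph_def compatible_def by auto
  interpret quiver_map P Q "\<lambda>x. x" Some
    using sub' by (intro quiver_map.intro quiver_map_axioms.intro) auto
  obtain Z :: "('k, 'k list) module" where Z: "fd_space K Z" "carrier Z = {[]}" "\<zero>\<^bsub>Z\<^esub> = []"
    by (rule fd_space_singleton[OF K])
  show ?thesis
  proof (rule finite_multiplicative_type_pull_surj[OF K fin])
    fix W :: "('v, 'a, 'k) std_rep" assume W: "is_rep K P W"
    define M where "M x = (if x \<in> verts P then space W x else Z)" for x
    define V :: "('v, 'a, 'k) std_rep" where
      "V = \<lparr>space = M, arrow_map = (\<lambda>a. if a \<in> arcs P then arrow_map W a else (\<lambda>_. \<zero>\<^bsub>M (head Q a)\<^esub>))\<rparr>"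
    have M: "fd_space K (M x)" for x using is_repD(1)[OF W] Z(1) by (auto simp: M_def)
    have "is_rep K Q V" unfolding is_rep_def
    proof (intro conjI ballI)
      show "vectorspace K (space V x)" "vectorspace.fin_dim K (space V x)" for x using M by (simp_all add: V_def)
      show "linear_map K (space V (tail Q a)) (space V (head Q a)) (arrow_map V a)" if "a \<in> arcs Q" for a
      proof (cases "a \<in> arcs P")
        case True
        then show ?thesis using is_repD(2)[OF W True] P.tail_in_verts[OF True] P.head_in_verts[OF True] sub'
          by (simp add: V_def M_def)
      next
        case False
        then show ?thesis using M by (simp add: V_def linear_map_zero)
      qed
    qed
    moreover have "rep_iso K P (pull V) W"
      by (rule rep_iso_cong[OF is_rep_pull[OF \<open>is_rep K Q V\<close>]]) (auto simp: pull_rep_def V_def M_def)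
    ultimately show "\<exists>V :: ('v, 'a, 'k) std_rep. is_rep K Q V \<and> rep_iso K P (pull V) W" by blast
  qed
qed

lemma finite_multiplicative_type_digraph_iso:
  fixes K :: "'k ring" and P :: "('v, 'a) pre_digraph" and Q :: "('w, 'b) pre_digraph"
  assumes K: "field K" and iso: "digraph_iso P Q" and fin: "finite_multiplicative_type K P"
  shows "finite_multiplicative_type K Q"
proof -
  obtain f where f: "pre_digraph.digraph_isomorphism P f" and Q: "Q = app_iso f P"
    using iso unfolding digraph_iso_def by blast
  interpret P: wf_digraph P using f unfolding pre_digraph.digraph_isomorphism_def by simp
  interpret Q: wf_digraph Q unfolding Q by (rule P.wf_digraphI_app_iso[OF f])
  let ?g = "pre_digraph.inv_iso P f"
  have Qv: "iso_verts f x \<in> verts Q" if "x \<in> verts P" for x using that by (simp add: Q)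
  interpret F: quiver_map P Q "iso_verts f" "Some \<circ> iso_arcs f"
    using f by unfold_locales (auto simp: Q P.iso_verts_tail P.iso_verts_head)
  interpret G: quiver_map Q P "iso_verts ?g" "Some \<circ> iso_arcs ?g"
    using f by unfold_locales (auto simp: Q P.iso_verts_tail P.iso_verts_head)
  show ?thesis
  proof (rule G.finite_multiplicative_type_pull_surj[OF K fin])
    fix W :: "('w, 'b, 'k) std_rep" assume W: "is_rep K Q W"
    have "rep_iso K Q (G.pull (F.pull W)) W"
      by (rule rep_iso_cong[OF G.is_rep_pull[OF F.is_rep_pull[OF W]]])
        (use f in \<open>auto simp: pull_rep_def Q\<close>)
    then show "\<exists>V :: ('v, 'a, 'k) std_rep. is_rep K P V \<and> rep_iso K Q (G.pull V) W"
      using F.is_rep_pull[OF W] by blast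
  qed
qed

section \<open>Making an arrow invertible\<close>

definition rep_hom :: "'k ring \<Rightarrow> ('v, 'a) pre_digraph \<Rightarrow> ('v, 'a, 'k, 'u) quiver_rep \<Rightarrow>
    ('v, 'a, 'k, 'w) quiver_rep \<Rightarrow> ('v \<Rightarrow> 'u \<Rightarrow> 'w) \<Rightarrow> bool" where
  "rep_hom K Q V W \<phi> \<longleftrightarrow> (\<forall>x \<in> verts Q. linear_map K (space V x) (space W x) (\<phi> x)) \<and>
    (\<forall>a \<in> arcs Q. \<forall>v \<in> carrier (space V (tail Q a)).
       \<phi> (head Q a) (arrow_map V a v) = arrow_map W a (\<phi> (tail Q a) v))"

text \<open>
  The largest subrepresentation in which every vector at the head of \<open>e\<close> is the
  image under \<open>e\<close> of a vector at its tail. Coinduction yields it as a union of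
  all families of sets of vectors with these properties; that it consists of subspaces has to
  be proved.
\<close>

coinductive divisible :: "('v, 'a) pre_digraph \<Rightarrow> 'a \<Rightarrow> ('v, 'a, 'k, 'u) quiver_rep \<Rightarrow> 'v \<Rightarrow> 'u \<Rightarrow> bool"
  for Q e V where
  "v \<in> carrier (space V x) \<Longrightarrow>
   \<forall>a\<in>arcs Q. tail Q a = x \<longrightarrow> divisible Q e V (head Q a) (arrow_map V a v) \<Longrightarrow>
   x = head Q e \<longrightarrow> (\<exists>u. divisible Q e V (tail Q e) u \<and> arrow_map V e u = v) \<Longrightarrow>
   divisible Q e V x v"

text \<open>
  The smallest subrepresentation of the divisible part modulo which \<open>e\<close> becomes
  injective.
\<close>

inductive vanishing :: "'k ring \<Rightarrow> ('v, 'a) pre_digraph \<Rightarrow> 'a \<Rightarrow> ('v, 'a, 'k, 'u) quiver_rep \<Rightarrow> 'v \<Rightarrow> 'u \<Rightarrow> bool"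
  for K Q e V where
  zero: "x \<in> verts Q \<Longrightarrow> vanishing K Q e V x \<zero>\<^bsub>space V x\<^esub>"
| add: "vanishing K Q e V x v \<Longrightarrow> vanishing K Q e V x w \<Longrightarrow> vanishing K Q e V x (v \<oplus>\<^bsub>space V x\<^esub> w)"
| smult: "c \<in> carrier K \<Longrightarrow> vanishing K Q e V x v \<Longrightarrow> vanishing K Q e V x (c \<odot>\<^bsub>space V x\<^esub> v)"
| arrow: "a \<in> arcs Q \<Longrightarrow> vanishing K Q e V (tail Q a) v \<Longrightarrow> vanishing K Q e V (head Q a) (arrow_map V a v)"
| cancel: "divisible Q e V (tail Q e) v \<Longrightarrow> vanishing K Q e V (head Q e) (arrow_map V e v) \<Longrightarrow>
    vanishing K Q e V (tail Q e) v"

lemma divisible_carrier: "divisible Q e V x v \<Longrightarrow> v \<in> carrier (space V x)"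
  by (auto elim: divisible.cases)

lemma divisible_arrow: "divisible Q e V (tail Q a) v \<Longrightarrow> a \<in> arcs Q \<Longrightarrow> divisible Q e V (head Q a) (arrow_map V a v)"
  by (auto elim: divisible.cases)

lemma divisible_preimage:
  assumes "divisible Q e V (head Q e) v"
  obtains u where "divisible Q e V (tail Q e) u" "arrow_map V e u = v"
  using assms by (auto elim: divisible.cases)

lemma divisible_coinduct:
  assumes "X x v" "\<And>x v. X x v \<Longrightarrow> v \<in> carrier (space V x)"
    and "\<And>a v. X (tail Q a) v \<Longrightarrow> a \<in> arcs Q \<Longrightarrow> X (head Q a) (arrow_map V a v)"
    and "\<And>v. X (head Q e) v \<Longrightarrow> \<exists>u. X (tail Q e) u \<and> arrow_map V e u = v"
  shows "divisible Q e V x v"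
proof (rule divisible.coinduct[of X, OF assms(1)])
  fix x v assume "X x v"
  then show "\<exists>v' x'. x = x' \<and> v = v' \<and> v' \<in> carrier (space V x') \<and>
      (\<forall>a\<in>arcs Q. tail Q a = x' \<longrightarrow>
        X (head Q a) (arrow_map V a v') \<or> divisible Q e V (head Q a) (arrow_map V a v')) \<and>
      (x' = head Q e \<longrightarrow> (\<exists>u. (X (tail Q e) u \<or> divisible Q e V (tail Q e) u) \<and> arrow_map V e u = v'))"
    using assms(2-4) by (intro exI[of _ v] exI[of _ x]) blast
qed

locale quiver_arrow = wf_digraph Q for Q :: "('v, 'a) pre_digraph" +
  fixes e :: 'a
  assumes e: "e \<in> arcs Q"
begin

abbreviation "D \<equiv> divisible Q e"
abbreviation "N K \<equiv> vanishing K Q e"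

text \<open>
  The image of the divisible part is closed under arrows and preimages, so it is contained in
  the largest such family.
\<close>

lemma divisible_hom:
  assumes \<phi>: "rep_hom K Q V W \<phi>" and "x \<in> verts Q" "D V x v"
  shows "D W x (\<phi> x v)"
proof (rule divisible_coinduct[where X = "\<lambda>x w. \<exists>v. x \<in> verts Q \<and> D V x v \<and> w = \<phi> x v"])
  show "\<exists>v'. x \<in> verts Q \<and> D V x v' \<and> \<phi> x v = \<phi> x v'" using assms by blast
  have lin: "linear_map K (space V y) (space W y) (\<phi> y)" if "y \<in> verts Q" for y
    using \<phi> that by (simp add: rep_hom_def)
  have arr: "\<phi> (head Q a) (arrow_map V a y) = arrow_map W a (\<phi> (tail Q a) y)"
    if "a \<in> arcs Q" "D V (tail Q a) y" for a y
    using \<phi> that divisible_carrier[OF that(2)] by (simp add: rep_hom_def)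
  show "w \<in> carrier (space W x)" if "\<exists>v. x \<in> verts Q \<and> D V x v \<and> w = \<phi> x v" for x w
    using that by (auto simp: linear_mapD(3)[OF lin] divisible_carrier)
  show "\<exists>v. head Q a \<in> verts Q \<and> D V (head Q a) v \<and> arrow_map W a w = \<phi> (head Q a) v"
    if w: "\<exists>v. tail Q a \<in> verts Q \<and> D V (tail Q a) v \<and> w = \<phi> (tail Q a) v" and a: "a \<in> arcs Q" for a w
  proof -
    obtain v where v: "D V (tail Q a) v" "w = \<phi> (tail Q a) v" using w by blast
    then show ?thesis
      using arr[OF a v(1)] divisible_arrow[OF v(1) a] head_in_verts[OF a] by metis
  qed
  show "\<exists>u. (\<exists>v. tail Q e \<in> verts Q \<and> D V (tail Q e) v \<and> u = \<phi> (tail Q e) v) \<and> arrow_map W e u = w"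
    if w: "\<exists>v. head Q e \<in> verts Q \<and> D V (head Q e) v \<and> w = \<phi> (head Q e) v" for w
  proof -
    obtain v where v: "D V (head Q e) v" "w = \<phi> (head Q e) v" using w by blast
    obtain u where u: "D V (tail Q e) u" "arrow_map V e u = v" using divisible_preimage[OF v(1)] .
    have "arrow_map W e (\<phi> (tail Q e) u) = w" using arr[OF e u(1)] u(2) v(2) by simp
    then show ?thesis using u(1) tail_in_verts[OF e] by blast
  qed
qed

lemma vanishing_carrier:
  assumes V: "is_rep K Q V" and "N K V x v"
  shows "x \<in> verts Q \<and> v \<in> carrier (space V x)"
  using assms(2)
proof (induction rule: vanishing.induct)
  have vs: "vectorspace K (space V y)" if "y \<in> verts Q" for y using is_repD(1)[OF V that] by simp
  {
    case (zero x)
    then show ?case by (simp add: vectorspaceD(2)[OF vs])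
  next
    case (add x v w)
    then show ?case by (simp add: vectorspaceD(3)[OF vs])
  next
    case (smult c x v)
    then show ?case by (simp add: vectorspaceD(4)[OF vs])
  next
    case (arrow a v)
    then show ?case by (simp add: linear_mapD(3)[OF is_repD(2)[OF V arrow.hyps(1)]])
  next
    case (cancel v)
    then show ?case by (simp add: divisible_carrier e)
  }
qed

lemma vanishing_hom:
  assumes V: "is_rep K Q V" and \<phi>: "rep_hom K Q V W \<phi>" and "N K V x v"
  shows "N K W x (\<phi> x v)"
  using assms(3)
proof (induction rule: vanishing.induct)
  have lin: "linear_map K (space V y) (space W y) (\<phi> y)" if "y \<in> verts Q" for y
    using \<phi> that by (simp add: rep_hom_def)
  have arr: "\<phi> (head Q a) (arrow_map V a y) = arrow_map W a (\<phi> (tail Q a) y)"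
    if "a \<in> arcs Q" "y \<in> carrier (space V (tail Q a))" for a y
    using \<phi> that by (simp add: rep_hom_def)
  {
    case (zero x)
    then show ?case using linear_mapD(6)[OF lin[OF zero]] vanishing.zero[OF zero] by simp
  next
    case (add x v w)
    then have "x \<in> verts Q" "v \<in> carrier (space V x)" "w \<in> carrier (space V x)" using vanishing_carrier[OF V] by auto
    then show ?case using linear_mapD(4)[OF lin] vanishing.add[OF add.IH] by simp
  next
    case (smult c x v)
    then have "x \<in> verts Q" "v \<in> carrier (space V x)" using vanishing_carrier[OF V] by auto
    then show ?case using linear_mapD(5)[OF lin] vanishing.smult[OF smult.hyps(1) smult.IH] smult.hyps(1) by simp
  next
    case (arrow a v)
    then show ?case using arr[OF arrow.hyps(1)] vanishing_carrier[OF V arrow.hyps(2)] vanishing.arrow[OF arrow.hyps(1) arrow.IH] by simp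
  next
    case (cancel v)
    have "D W (tail Q e) (\<phi> (tail Q e) v)" by (rule divisible_hom[OF \<phi> tail_in_verts[OF e] cancel.hyps(1)])
    then show ?case
      using arr[OF e divisible_carrier[OF cancel.hyps(1)]] cancel.IH by (intro vanishing.cancel) simp_all
  }
qed

lemma submodule_divisible:
  assumes V: "is_rep K Q V" and x: "x \<in> verts Q"
  shows "submodule K {v. D V x v} (space V x)"
proof -
  have vs: "vectorspace K (space V y)" if "y \<in> verts Q" for y using is_repD(1)[OF V that] by simp
  note lin = is_repD(2)[OF V]
  interpret S: vectorspace K "space V x" by (rule vs[OF x])
  have "D V x \<zero>\<^bsub>space V x\<^esub>"
  proof (rule divisible_coinduct[where X = "\<lambda>x v. x \<in> verts Q \<and> v = \<zero>\<^bsub>space V x\<^esub>"])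
    show "v \<in> carrier (space V x)" if "x \<in> verts Q \<and> v = \<zero>\<^bsub>space V x\<^esub>" for x v
      using that by (simp add: vectorspaceD(2)[OF vs])
    show "head Q a \<in> verts Q \<and> arrow_map V a v = \<zero>\<^bsub>space V (head Q a)\<^esub>"
      if "tail Q a \<in> verts Q \<and> v = \<zero>\<^bsub>space V (tail Q a)\<^esub>" "a \<in> arcs Q" for a v
      using that linear_mapD(6)[OF lin] by simp
    show "\<exists>u. (tail Q e \<in> verts Q \<and> u = \<zero>\<^bsub>space V (tail Q e)\<^esub>) \<and> arrow_map V e u = v"
      if "head Q e \<in> verts Q \<and> v = \<zero>\<^bsub>space V (head Q e)\<^esub>" for v
      using that linear_mapD(6)[OF lin[OF e]] tail_in_verts[OF e] by simp
  qed (use x in simp)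
  moreover have "D V x (v \<oplus>\<^bsub>space V x\<^esub> w)" if vw: "D V x v" "D V x w" for v w
  proof (rule divisible_coinduct[where X = "\<lambda>x s. x \<in> verts Q \<and> (\<exists>v w. D V x v \<and> D V x w \<and> s = v \<oplus>\<^bsub>space V x\<^esub> w)"])
    show "x \<in> verts Q \<and> (\<exists>v' w'. D V x v' \<and> D V x w' \<and> v \<oplus>\<^bsub>space V x\<^esub> w = v' \<oplus>\<^bsub>space V x\<^esub> w')" using x vw by blast
    show "s \<in> carrier (space V x)" if "x \<in> verts Q \<and> (\<exists>v w. D V x v \<and> D V x w \<and> s = v \<oplus>\<^bsub>space V x\<^esub> w)" for x s
      using that by (auto simp: vectorspaceD(3)[OF vs] divisible_carrier)
    show "head Q a \<in> verts Q \<and> (\<exists>v w. D V (head Q a) v \<and> D V (head Q a) w \<and> arrow_map V a s = v \<oplus>\<^bsub>space V (head Q a)\<^esub> w)"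
      if s: "tail Q a \<in> verts Q \<and> (\<exists>v w. D V (tail Q a) v \<and> D V (tail Q a) w \<and> s = v \<oplus>\<^bsub>space V (tail Q a)\<^esub> w)"
        and a: "a \<in> arcs Q" for a s
    proof -
      obtain v w where vw: "D V (tail Q a) v" "D V (tail Q a) w" "s = v \<oplus>\<^bsub>space V (tail Q a)\<^esub> w" using s by blast
      then have "arrow_map V a s = arrow_map V a v \<oplus>\<^bsub>space V (head Q a)\<^esub> arrow_map V a w"
        by (simp add: linear_mapD(4)[OF lin[OF a]] divisible_carrier)
      moreover have "D V (head Q a) (arrow_map V a v)" "D V (head Q a) (arrow_map V a w)"
        using vw(1,2) a by (simp_all add: divisible_arrow)
      ultimately show ?thesis using head_in_verts[OF a] by blast
    qed
    show "\<exists>u. (tail Q e \<in> verts Q \<and> (\<exists>v w. D V (tail Q e) v \<and> D V (tail Q e) w \<and> u = v \<oplus>\<^bsub>space V (tail Q e)\<^esub> w)) \<and> arrow_map V e u = s"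
      if s: "head Q e \<in> verts Q \<and> (\<exists>v w. D V (head Q e) v \<and> D V (head Q e) w \<and> s = v \<oplus>\<^bsub>space V (head Q e)\<^esub> w)" for s
    proof -
      obtain v w where vw: "D V (head Q e) v" "D V (head Q e) w" "s = v \<oplus>\<^bsub>space V (head Q e)\<^esub> w" using s by blast
      obtain v' where v': "D V (tail Q e) v'" "arrow_map V e v' = v" by (rule divisible_preimage[OF vw(1)])
      obtain w' where w': "D V (tail Q e) w'" "arrow_map V e w' = w" by (rule divisible_preimage[OF vw(2)])
      have "arrow_map V e (v' \<oplus>\<^bsub>space V (tail Q e)\<^esub> w') = s"
        using linear_mapD(4)[OF lin[OF e] divisible_carrier[OF v'(1)] divisible_carrier[OF w'(1)]] v' w' vw by simp
      moreover have "\<exists>v w. D V (tail Q e) v \<and> D V (tail Q e) w \<and> v' \<oplus>\<^bsub>space V (tail Q e)\<^esub> w' = v \<oplus>\<^bsub>space V (tail Q e)\<^esub> w"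
        using v'(1) w'(1) by (intro exI[of _ v'] exI[of _ w']) simp
      ultimately show ?thesis
        using tail_in_verts[OF e] by (intro exI[of _ "v' \<oplus>\<^bsub>space V (tail Q e)\<^esub> w'"]) simp
    qed
  qed
  moreover have "D V x (c \<odot>\<^bsub>space V x\<^esub> v)" if c: "c \<in> carrier K" and v: "D V x v" for c v
  proof -
    \<comment> \<open>Multiplication by a scalar is an endomorphism and as such preserves the divisible part.\<close>
    have "rep_hom K Q V V (\<lambda>x v. c \<odot>\<^bsub>space V x\<^esub> v)" unfolding rep_hom_def
      using c vs linear_map_smult[OF linear_map_id[OF vs] c] linear_mapD(5)[OF lin] by auto
    from divisible_hom[OF this x v] show ?thesis .
  qed
  ultimately show ?thesis
    using divisible_carrier S.module_axioms unfolding submodule_def by auto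
qed

lemma vanishing_divisible:
  assumes V: "is_rep K Q V" and "N K V x v"
  shows "D V x v"
  using assms(2)
proof (induction rule: vanishing.induct)
  case (zero x)
  then show ?case using submodule_divisible[OF V zero] by (simp add: submodule_def)
next
  case (add x v w)
  then show ?case using submodule_divisible[OF V] vanishing_carrier[OF V] by (simp add: submodule_def)
next
  case (smult c x v)
  then show ?case using submodule_divisible[OF V] vanishing_carrier[OF V] by (simp add: submodule_def)
next
  case (arrow a v)
  then show ?case by (simp add: divisible_arrow)
qed

abbreviation "D_space V x \<equiv> (space V x)\<lparr>carrier := {v. D V x v}\<rparr>"

lemma fd_space_D_space: "is_rep K Q V \<Longrightarrow> x \<in> verts Q \<Longrightarrow> fd_space K (D_space V x)"
  by (rule fin_dim_subspace[OF is_repD(1) submodule_divisible])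

lemma submodule_vanishing:
  assumes V: "is_rep K Q V" and x: "x \<in> verts Q"
  shows "submodule K {v. N K V x v} (D_space V x)"
proof -
  interpret S: vectorspace K "D_space V x" using fd_space_D_space[OF assms] by simp
  show ?thesis unfolding submodule_def
  proof (intro conjI allI impI)
    show "{v. N K V x v} \<subseteq> carrier (D_space V x)" using vanishing_divisible[OF V] by auto
  qed (simp_all add: S.module_axioms vanishing.zero[OF x] vanishing.add vanishing.smult)
qed

end

text \<open>
  A linear map that vanishes on the kernel of a surjection factors through it.
\<close>

lemma linear_factor:
  assumes p: "linear_map K V W p" "p ` carrier V = carrier W" and g: "linear_map K V X g"
    and ker: "\<And>v. v \<in> carrier V \<Longrightarrow> p v = \<zero>\<^bsub>W\<^esub> \<Longrightarrow> g v = \<zero>\<^bsub>X\<^esub>"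
  obtains f where "linear_map K W X f" "\<And>v. v \<in> carrier V \<Longrightarrow> f (p v) = g v"
proof -
  note P = linear_mapD[OF p(1)] and G = linear_mapD[OF g]
  interpret V: vectorspace K V by (rule P(1))
  interpret W: vectorspace K W by (rule P(2))
  interpret X: vectorspace K X by (rule G(2))
  define s where "s w = (SOME v. v \<in> carrier V \<and> p v = w)" for w
  have s: "s w \<in> carrier V" "p (s w) = w" if "w \<in> carrier W" for w
  proof -
    have "\<exists>v. v \<in> carrier V \<and> p v = w" using that p(2) by (metis imageE)
    from someI_ex[OF this] show "s w \<in> carrier V" "p (s w) = w" unfolding s_def by auto
  qed
  have eq: "g (s (p v)) = g v" if v: "v \<in> carrier V" for v
  proof -
    have sv: "s (p v) \<in> carrier V" "p (s (p v)) = p v" using s[OF P(3)[OF v]] by auto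
    then have "p (s (p v) \<ominus>\<^bsub>V\<^esub> v) = \<zero>\<^bsub>W\<^esub>" using P(7)[OF sv(1) v] P(3)[OF v] W.M.minus_other_side[of "p v" "p v"] by simp
    then have "g (s (p v) \<ominus>\<^bsub>V\<^esub> v) = \<zero>\<^bsub>X\<^esub>" using ker sv(1) v by simp
    then show ?thesis using G(7)[OF sv(1) v] X.M.minus_other_side[OF G(3)[OF sv(1)] G(3)[OF v]] by simp
  qed
  have "linear_map K W X (\<lambda>w. g (s w))"
  proof (rule linear_mapI[OF P(2) G(2)])
    fix w w' assume w: "w \<in> carrier W" "w' \<in> carrier W"
    have "g (s (w \<oplus>\<^bsub>W\<^esub> w')) = g (s (p (s w \<oplus>\<^bsub>V\<^esub> s w')))" using w s P(4) by simp
    also have "\<dots> = g (s w) \<oplus>\<^bsub>X\<^esub> g (s w')" using w s eq G(4) by simp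
    finally show "g (s (w \<oplus>\<^bsub>W\<^esub> w')) = g (s w) \<oplus>\<^bsub>X\<^esub> g (s w')" .
  next
    fix c w assume c: "c \<in> carrier K" and w: "w \<in> carrier W"
    have "g (s (c \<odot>\<^bsub>W\<^esub> w)) = g (s (p (c \<odot>\<^bsub>V\<^esub> s w)))" using c w s P(5) by simp
    also have "\<dots> = c \<odot>\<^bsub>X\<^esub> g (s w)" using c w s eq G(5) by simp
    finally show "g (s (c \<odot>\<^bsub>W\<^esub> w)) = c \<odot>\<^bsub>X\<^esub> g (s w)" .
  qed (use s G(3) in simp)
  then show ?thesis using that[of "\<lambda>w. g (s w)"] eq by simp
qed

section \<open>Contracting an arrow that is not a loop\<close>

locale nonloop_arrow = quiver_arrow Q e for Q :: "('v, 'a) pre_digraph" and e +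
  assumes nonloop: "tail Q e \<noteq> head Q e"
begin

abbreviation "C \<equiv> contract_arc Q e"
definition "merge x = (if x = head Q e then tail Q e else x)"
text \<open>
  The arrow \<open>e\<close> is collapsed to the merged vertex; all others keep their names.
\<close>

definition "residual a = (if a = e then None else Some a)"

lemma contract_simps:
  "verts C = merge ` verts Q" "arcs C = arcs Q - {e}" "tail C a = merge (tail Q a)" "head C a = merge (head Q a)"
  by (simp_all add: contract_arc_def merge_def fun_eq_iff Let_def)

lemma merge_simps: "merge (head Q e) = tail Q e" "merge (tail Q e) = tail Q e" "x \<noteq> head Q e \<Longrightarrow> merge x = x"
  by (simp_all add: merge_def)

lemma contract_vertsD: "x \<in> verts C \<Longrightarrow> x \<in> verts Q \<and> merge x = x \<and> x \<noteq> head Q e"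
  using nonloop tail_in_verts[OF e] by (auto simp: contract_simps merge_def)

sublocale quiver_map Q C merge residual
proof
  show "tail C a \<in> verts C" "head C a \<in> verts C" if "a \<in> arcs C" for a
    using that by (simp_all add: contract_simps)
  show "merge x \<in> verts C" if "x \<in> verts Q" for x using that by (simp add: contract_simps)
  show "b \<in> arcs C \<and> tail C b = merge (tail Q a) \<and> head C b = merge (head Q a)"
    if "a \<in> arcs Q" "residual a = Some b" for a b
    using that by (auto simp: residual_def contract_simps split: if_splits)
  show "merge (tail Q a) = merge (head Q a)" if "a \<in> arcs Q" "residual a = None" for a
    using that by (auto simp: residual_def merge_simps split: if_splits)
qed

lemma arrow_map_pull_e [simp]: "arrow_map (pull Y) e = id"
  and arrow_map_pull_ne [simp]: "a \<noteq> e \<Longrightarrow> arrow_map (pull Y) a = arrow_map Y a"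
  by (simp_all add: pull_rep_def residual_def)

text \<open>
  The maps \<open>\<pi> x\<close> exhibit the pull-back of \<open>Y\<close> as the quotient of
  the divisible part of \<open>Z\<close> by the vanishing part. Working with the quotient maps
  instead of one chosen quotient makes uniqueness, transport along isomorphisms and additivity
  statements about kernels and images.
\<close>

definition localization_maps :: "'k ring \<Rightarrow> ('v, 'a, 'k, 'u) quiver_rep \<Rightarrow> ('v, 'a, 'k, 'w) quiver_rep \<Rightarrow>
    ('v \<Rightarrow> 'u \<Rightarrow> 'w) \<Rightarrow> bool" where
  "localization_maps K Z Y \<pi> \<longleftrightarrow>
    (\<forall>x\<in>verts Q. linear_map K (D_space Z x) (space Y (merge x)) (\<pi> x) \<and>
       \<pi> x ` {v. D Z x v} = carrier (space Y (merge x)) \<and>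
       (\<forall>v. D Z x v \<longrightarrow> (\<pi> x v = \<zero>\<^bsub>space Y (merge x)\<^esub> \<longleftrightarrow> N K Z x v))) \<and>
    (\<forall>a\<in>arcs Q. \<forall>v. D Z (tail Q a) v \<longrightarrow> \<pi> (head Q a) (arrow_map Z a v) = arrow_map (pull Y) a (\<pi> (tail Q a) v))"

lemma localization_mapsI:
  assumes "\<And>x. x \<in> verts Q \<Longrightarrow> linear_map K (D_space Z x) (space Y (merge x)) (\<pi> x)"
    and "\<And>x. x \<in> verts Q \<Longrightarrow> \<pi> x ` {v. D Z x v} = carrier (space Y (merge x))"
    and "\<And>x v. x \<in> verts Q \<Longrightarrow> D Z x v \<Longrightarrow> \<pi> x v = \<zero>\<^bsub>space Y (merge x)\<^esub> \<longleftrightarrow> N K Z x v"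
    and "\<And>a v. a \<in> arcs Q \<Longrightarrow> D Z (tail Q a) v \<Longrightarrow>
      \<pi> (head Q a) (arrow_map Z a v) = arrow_map (pull Y) a (\<pi> (tail Q a) v)"
  shows "localization_maps K Z Y \<pi>"
  using assms unfolding localization_maps_def by blast

lemma localization_mapsD:
  assumes "localization_maps K Z Y \<pi>"
  shows "x \<in> verts Q \<Longrightarrow> linear_map K (D_space Z x) (space Y (merge x)) (\<pi> x)"
    and "x \<in> verts Q \<Longrightarrow> \<pi> x ` {v. D Z x v} = carrier (space Y (merge x))"
    and "x \<in> verts Q \<Longrightarrow> D Z x v \<Longrightarrow> \<pi> x v = \<zero>\<^bsub>space Y (merge x)\<^esub> \<longleftrightarrow> N K Z x v"
    and "a \<in> arcs Q \<Longrightarrow> D Z (tail Q a) v \<Longrightarrow>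
      \<pi> (head Q a) (arrow_map Z a v) = arrow_map (pull Y) a (\<pi> (tail Q a) v)"
  using assms unfolding localization_maps_def by blast+

lemma linear_map_D_space:
  assumes Z: "is_rep K Q Z" and a: "a \<in> arcs Q"
  shows "linear_map K (D_space Z (tail Q a)) (D_space Z (head Q a)) (arrow_map Z a)"
proof -
  note lin = linear_mapD[OF is_repD(2)[OF Z a]]
  show ?thesis
  proof (rule linear_mapI)
    show "vectorspace K (D_space Z (tail Q a))" "vectorspace K (D_space Z (head Q a))"
      using fd_space_D_space[OF Z tail_in_verts[OF a]] fd_space_D_space[OF Z head_in_verts[OF a]] by simp_all
  qed (use a lin(4,5) in \<open>simp_all add: divisible_arrow divisible_carrier\<close>)
qed

text \<open>
  At vertices other than the head of \<open>e\<close> the quotient of the divisible by the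
  vanishing part is taken. At the head, \<open>e\<close> induces a bijection between the
  quotients at its two ends, so the quotient at the tail serves for both.
\<close>

lemma localization_exists:
  fixes Z :: "('v, 'a, 'k, 'u) quiver_rep" and K :: "'k ring"
  assumes Z: "is_rep K Q Z"
  obtains Y :: "('v, 'a, 'k) std_rep" and \<pi> where "is_rep K C Y" "localization_maps K Z Y \<pi>"
proof -
  note t = tail_in_verts[OF e] and h = head_in_verts[OF e]
  have "\<exists>(W :: ('k, 'k list) module) q. linear_map K (D_space Z x) W q \<and> q ` {v. D Z x v} = carrier W \<and> fd_space K W \<and>
      (\<forall>v. D Z x v \<longrightarrow> (q v = \<zero>\<^bsub>W\<^esub> \<longleftrightarrow> N K Z x v))" if x: "x \<in> verts Q" for x
  proof (rule linear_quotient_list[OF fd_space_D_space[OF Z x] submodule_vanishing[OF Z x]])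
    fix W :: "('k, 'k list) module" and q
    assume "linear_map K (D_space Z x) W q" "q ` carrier (D_space Z x) = carrier W" "fd_space K W"
      and "\<And>v. v \<in> carrier (D_space Z x) \<Longrightarrow> q v = \<zero>\<^bsub>W\<^esub> \<longleftrightarrow> v \<in> {v. N K Z x v}"
    then show ?thesis by (intro exI[of _ W] exI[of _ q]) simp
  qed
  then obtain W :: "'v \<Rightarrow> ('k, 'k list) module" and q where q:
    "\<And>x. x \<in> verts Q \<Longrightarrow> linear_map K (D_space Z x) (W x) (q x)"
    "\<And>x. x \<in> verts Q \<Longrightarrow> q x ` {v. D Z x v} = carrier (W x)"
    "\<And>x. x \<in> verts Q \<Longrightarrow> fd_space K (W x)"
    "\<And>x v. x \<in> verts Q \<Longrightarrow> D Z x v \<Longrightarrow> q x v = \<zero>\<^bsub>W x\<^esub> \<longleftrightarrow> N K Z x v" by metis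
  define s where "s v = (SOME u. D Z (tail Q e) u \<and> arrow_map Z e u = v)" for v
  have s: "D Z (tail Q e) (s v)" "arrow_map Z e (s v) = v" if v: "D Z (head Q e) v" for v
  proof -
    have "\<exists>u. D Z (tail Q e) u \<and> arrow_map Z e u = v" using divisible_preimage[OF v] by metis
    from someI_ex[OF this] show "D Z (tail Q e) (s v)" "arrow_map Z e (s v) = v" unfolding s_def by auto
  qed
  \<comment> \<open>A vector at the head is sent to the class of a divisible preimage under \<open>e\<close>.\<close>
  define \<pi> where "\<pi> x = (if x = head Q e then (\<lambda>v. q (tail Q e) (s v)) else q x)" for x
  have \<pi>_x: "\<pi> x = q x" if "x \<noteq> head Q e" for x using that by (simp add: \<pi>_def)
  interpret T: vectorspace K "D_space Z (tail Q e)" using fd_space_D_space[OF Z t] by simp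
  interpret H: vectorspace K "D_space Z (head Q e)" using fd_space_D_space[OF Z h] by simp
  interpret Wt: vectorspace K "W (tail Q e)" using q(3)[OF t] by simp
  note Q = linear_mapD[OF q(1)[OF t]] and E = linear_mapD[OF linear_map_D_space[OF Z e]]
  \<comment> \<open>The choice of the preimage is immaterial: the difference of two preimages is mapped to
    zero by \<open>e\<close> and hence vanishes.\<close>
  have \<pi>_h: "\<pi> (head Q e) (arrow_map Z e u) = q (tail Q e) u" if u: "D Z (tail Q e) u" for u
  proof -
    have v: "D Z (head Q e) (arrow_map Z e u)" using divisible_arrow[OF u e] .
    define d where "d = s (arrow_map Z e u) \<ominus>\<^bsub>D_space Z (tail Q e)\<^esub> u"
    have d: "D Z (tail Q e) d" using T.M.minus_closed[of "s (arrow_map Z e u)" u] s(1)[OF v] u by (simp add: d_def)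
    have "arrow_map Z e d = arrow_map Z e (s (arrow_map Z e u)) \<ominus>\<^bsub>D_space Z (head Q e)\<^esub> arrow_map Z e u"
      unfolding d_def using E(7)[of "s (arrow_map Z e u)" u] s(1)[OF v] u by simp
    then have "arrow_map Z e d = \<zero>\<^bsub>space Z (head Q e)\<^esub>"
      using s(2)[OF v] H.M.minus_other_side[of "arrow_map Z e u" "arrow_map Z e u"] v by simp
    then have "N K Z (tail Q e) d" using vanishing.zero[OF h, of K e Z] d by (intro vanishing.cancel) simp_all
    then have "q (tail Q e) d = \<zero>\<^bsub>W (tail Q e)\<^esub>" using q(4)[OF t d] by simp
    then have "q (tail Q e) (s (arrow_map Z e u)) = q (tail Q e) u"
      using Q(7)[of "s (arrow_map Z e u)" u] s(1)[OF v] u Q(3)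
        Wt.M.minus_other_side[of "q (tail Q e) (s (arrow_map Z e u))" "q (tail Q e) u"] by (simp add: d_def)
    then show ?thesis by (simp add: \<pi>_def)
  qed
  have lin: "linear_map K (D_space Z x) (W (merge x)) (\<pi> x)"
    and im: "\<pi> x ` {v. D Z x v} = carrier (W (merge x))"
    and ker: "\<And>v. D Z x v \<Longrightarrow> \<pi> x v = \<zero>\<^bsub>W (merge x)\<^esub> \<longleftrightarrow> N K Z x v" if x: "x \<in> verts Q" for x
  proof -
    have "linear_map K (D_space Z x) (W (merge x)) (\<pi> x) \<and> \<pi> x ` {v. D Z x v} = carrier (W (merge x)) \<and>
      (\<forall>v. D Z x v \<longrightarrow> (\<pi> x v = \<zero>\<^bsub>W (merge x)\<^esub> \<longleftrightarrow> N K Z x v))"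
    proof (cases "x = head Q e")
      case False
      then show ?thesis using q[OF x] by (simp add: \<pi>_x merge_simps)
    next
      case True
      have fac: "\<exists>u. D Z (tail Q e) u \<and> arrow_map Z e u = v \<and> \<pi> (head Q e) v = q (tail Q e) u" if "D Z (head Q e) v" for v
        using s[OF that] \<pi>_h[OF s(1)[OF that]] by (intro exI[of _ "s v"]) simp
      have "linear_map K (D_space Z (head Q e)) (W (tail Q e)) (\<pi> (head Q e))"
      proof (rule linear_mapI[OF E(2) Q(2)])
        fix v assume "v \<in> carrier (D_space Z (head Q e))"
        then obtain u where "D Z (tail Q e) u" "\<pi> (head Q e) v = q (tail Q e) u" using fac[of v] by auto
        then show "\<pi> (head Q e) v \<in> carrier (W (tail Q e))" using Q(3)[of u] by simp
      next
        fix v w assume "v \<in> carrier (D_space Z (head Q e))" "w \<in> carrier (D_space Z (head Q e))"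
        then obtain u u' where u: "D Z (tail Q e) u" "arrow_map Z e u = v" "\<pi> (head Q e) v = q (tail Q e) u"
          "D Z (tail Q e) u'" "arrow_map Z e u' = w" "\<pi> (head Q e) w = q (tail Q e) u'" using fac[of v] fac[of w] by auto
        then have "v \<oplus>\<^bsub>D_space Z (head Q e)\<^esub> w = arrow_map Z e (u \<oplus>\<^bsub>D_space Z (tail Q e)\<^esub> u')"
          using E(4)[of u u'] by simp
        moreover have "D Z (tail Q e) (u \<oplus>\<^bsub>D_space Z (tail Q e)\<^esub> u')" using T.a_closed[of u u'] u by simp
        ultimately show "\<pi> (head Q e) (v \<oplus>\<^bsub>D_space Z (head Q e)\<^esub> w) = \<pi> (head Q e) v \<oplus>\<^bsub>W (tail Q e)\<^esub> \<pi> (head Q e) w"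
          using \<pi>_h Q(4)[of u u'] u by simp
      next
        fix c v assume c: "c \<in> carrier K" and "v \<in> carrier (D_space Z (head Q e))"
        then obtain u where u: "D Z (tail Q e) u" "arrow_map Z e u = v" "\<pi> (head Q e) v = q (tail Q e) u"
          using fac[of v] by auto
        then have "c \<odot>\<^bsub>D_space Z (head Q e)\<^esub> v = arrow_map Z e (c \<odot>\<^bsub>D_space Z (tail Q e)\<^esub> u)"
          using E(5)[OF c, of u] by simp
        moreover have "D Z (tail Q e) (c \<odot>\<^bsub>D_space Z (tail Q e)\<^esub> u)" using T.smult_closed[OF c, of u] u by simp
        ultimately show "\<pi> (head Q e) (c \<odot>\<^bsub>D_space Z (head Q e)\<^esub> v) = c \<odot>\<^bsub>W (tail Q e)\<^esub> \<pi> (head Q e) v"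
          using \<pi>_h Q(5)[OF c, of u] u by simp
      qed
      moreover have "\<pi> (head Q e) ` {v. D Z (head Q e) v} = carrier (W (tail Q e))"
      proof (intro equalityI subsetI)
        fix y assume "y \<in> carrier (W (tail Q e))"
        then obtain u where u: "D Z (tail Q e) u" "y = q (tail Q e) u" using q(2)[OF t] by auto
        then show "y \<in> \<pi> (head Q e) ` {v. D Z (head Q e) v}"
          using \<pi>_h[OF u(1)] divisible_arrow[OF u(1) e] by (intro image_eqI[of _ _ "arrow_map Z e u"]) simp_all
      next
        fix y assume "y \<in> \<pi> (head Q e) ` {v. D Z (head Q e) v}"
        then obtain v where "D Z (head Q e) v" "y = \<pi> (head Q e) v" by auto
        then obtain u where "D Z (tail Q e) u" "y = q (tail Q e) u" using fac[of v] by auto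
        then show "y \<in> carrier (W (tail Q e))" using Q(3)[of u] by simp
      qed
      moreover have "\<pi> (head Q e) v = \<zero>\<^bsub>W (tail Q e)\<^esub> \<longleftrightarrow> N K Z (head Q e) v" if v: "D Z (head Q e) v" for v
      proof -
        obtain u where u: "D Z (tail Q e) u" "arrow_map Z e u = v" "\<pi> (head Q e) v = q (tail Q e) u"
          using fac[OF v] by auto
        have "N K Z (tail Q e) u \<longleftrightarrow> N K Z (head Q e) v"
          using vanishing.arrow[OF e, of K e Z u] vanishing.cancel[OF u(1), of K] u(2) by auto
        then show ?thesis using q(4)[OF t u(1)] u(3) by simp
      qed
      ultimately show ?thesis using True by (simp add: merge_simps)
    qed
    then show "linear_map K (D_space Z x) (W (merge x)) (\<pi> x)" "\<pi> x ` {v. D Z x v} = carrier (W (merge x))"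
      "\<And>v. D Z x v \<Longrightarrow> \<pi> x v = \<zero>\<^bsub>W (merge x)\<^esub> \<longleftrightarrow> N K Z x v" by auto
  qed
  have "\<exists>f. linear_map K (W (merge (tail Q a))) (W (merge (head Q a))) f \<and>
      (\<forall>v. D Z (tail Q a) v \<longrightarrow> f (\<pi> (tail Q a) v) = \<pi> (head Q a) (arrow_map Z a v))" if a: "a \<in> arcs Q" for a
  proof -
    note ta = tail_in_verts[OF a] and ha = head_in_verts[OF a]
    have im': "\<pi> (tail Q a) ` carrier (D_space Z (tail Q a)) = carrier (W (merge (tail Q a)))" using im[OF ta] by simp
    have k: "\<pi> (head Q a) (arrow_map Z a v) = \<zero>\<^bsub>W (merge (head Q a))\<^esub>"
      if "v \<in> carrier (D_space Z (tail Q a))" "\<pi> (tail Q a) v = \<zero>\<^bsub>W (merge (tail Q a))\<^esub>" for v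
      using that ker[OF ta, of v] ker[OF ha, of "arrow_map Z a v"] vanishing.arrow[OF a, of K e Z v]
        divisible_arrow[of Q e Z a v] a by simp
    show ?thesis
    proof (rule linear_factor[OF lin[OF ta] im' linear_map_comp[OF linear_map_D_space[OF Z a] lin[OF ha]]])
      fix f assume "linear_map K (W (merge (tail Q a))) (W (merge (head Q a))) f"
        and "\<And>v. v \<in> carrier (D_space Z (tail Q a)) \<Longrightarrow> f (\<pi> (tail Q a) v) = \<pi> (head Q a) (arrow_map Z a v)"
      then show ?thesis by (intro exI[of _ f]) simp
    qed (rule k)
  qed
  then obtain f where f: "\<And>a. a \<in> arcs Q \<Longrightarrow> linear_map K (W (merge (tail Q a))) (W (merge (head Q a))) (f a)"
    "\<And>a v. a \<in> arcs Q \<Longrightarrow> D Z (tail Q a) v \<Longrightarrow> f a (\<pi> (tail Q a) v) = \<pi> (head Q a) (arrow_map Z a v)" by metis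
  define Y :: "('v, 'a, 'k) std_rep" where "Y = \<lparr>space = W, arrow_map = f\<rparr>"
  have "is_rep K C Y" unfolding is_rep_def
    using q(3) f(1) contract_vertsD by (simp add: Y_def contract_simps(2-4))
  moreover have "localization_maps K Z Y \<pi>"
  proof (rule localization_mapsI)
    fix a v assume a: "a \<in> arcs Q" and v: "D Z (tail Q a) v"
    show "\<pi> (head Q a) (arrow_map Z a v) = arrow_map (pull Y) a (\<pi> (tail Q a) v)"
    proof (cases "a = e")
      case True
      then show ?thesis using \<pi>_h v nonloop by (simp add: \<pi>_x)
    next
      case False
      then show ?thesis using f(2)[OF a v] by (simp add: Y_def)
    qed
  qed (use lin im ker in \<open>simp_all add: Y_def\<close>)
  ultimately show ?thesis by (rule that)
qed

lemma localization_factor: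
  assumes \<pi>: "localization_maps K Z Y \<pi>" and \<pi>': "localization_maps K Z Y' \<pi>'" and x: "x \<in> verts Q"
  shows "\<exists>f. linear_map K (space Y (merge x)) (space Y' (merge x)) f \<and> (\<forall>v. D Z x v \<longrightarrow> f (\<pi> x v) = \<pi>' x v)"
proof -
  note P = localization_mapsD[OF \<pi>] and P' = localization_mapsD[OF \<pi>']
  have im: "\<pi> x ` carrier (D_space Z x) = carrier (space Y (merge x))" using P(2)[OF x] by simp
  have k: "\<pi>' x v = \<zero>\<^bsub>space Y' (merge x)\<^esub>"
    if "v \<in> carrier (D_space Z x)" "\<pi> x v = \<zero>\<^bsub>space Y (merge x)\<^esub>" for v
    using that P(3)[OF x, of v] P'(3)[OF x, of v] by simp
  show ?thesis
  proof (rule linear_factor[OF P(1)[OF x] im P'(1)[OF x]])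
    fix f assume "linear_map K (space Y (merge x)) (space Y' (merge x)) f"
      and "\<And>v. v \<in> carrier (D_space Z x) \<Longrightarrow> f (\<pi> x v) = \<pi>' x v"
    then show ?thesis by (intro exI[of _ f]) simp
  qed (rule k)
qed

text \<open>
  Both representations are quotients of the same spaces by the same kernels.
\<close>

lemma localization_unique:
  assumes \<pi>: "localization_maps K Z Y \<pi>" and \<pi>': "localization_maps K Z Y' \<pi>'"
  shows "rep_iso K C Y Y'"
proof -
  note P = localization_mapsD[OF \<pi>] and P' = localization_mapsD[OF \<pi>']
  obtain f where f: "\<And>x. x \<in> verts Q \<Longrightarrow> linear_map K (space Y (merge x)) (space Y' (merge x)) (f x)"
    "\<And>x v. x \<in> verts Q \<Longrightarrow> D Z x v \<Longrightarrow> f x (\<pi> x v) = \<pi>' x v"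
    using localization_factor[OF \<pi> \<pi>'] by metis
  obtain g where g: "\<And>x. x \<in> verts Q \<Longrightarrow> linear_map K (space Y' (merge x)) (space Y (merge x)) (g x)"
    "\<And>x v. x \<in> verts Q \<Longrightarrow> D Z x v \<Longrightarrow> g x (\<pi>' x v) = \<pi> x v"
    using localization_factor[OF \<pi>' \<pi>] by metis
  have lift: "\<exists>v. D Z x v \<and> y = \<pi> x v" if "x \<in> verts Q" "y \<in> carrier (space Y (merge x))" for x y
    using P(2)[OF that(1)] that(2) by auto
  have lift': "\<exists>v. D Z x v \<and> y = \<pi>' x v" if "x \<in> verts Q" "y \<in> carrier (space Y' (merge x))" for x y
    using P'(2)[OF that(1)] that(2) by auto
  \<comment> \<open>Compatibility at the head of \<open>e\<close>, where \<open>f (head Q e)\<close> is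
    replaced by the map at the merged vertex, holds because vectors at the head come from the
    tail.\<close>
  have f_merge: "f (merge x) (\<pi> x v) = \<pi>' x v" if x: "x \<in> verts Q" and v: "D Z x v" for x v
  proof (cases "x = head Q e")
    case False
    then show ?thesis using f(2)[OF x v] by (simp add: merge_simps)
  next
    case True
    obtain u where u: "D Z (tail Q e) u" "arrow_map Z e u = v" using divisible_preimage v True by metis
    then have "\<pi> x v = \<pi> (tail Q e) u" "\<pi>' x v = \<pi>' (tail Q e) u" using P(4)[OF e u(1)] P'(4)[OF e u(1)] True by simp_all
    then show ?thesis using f(2)[OF tail_in_verts[OF e] u(1)] True by (simp add: merge_simps)
  qed
  show ?thesis
  proof (rule rep_isoI[where \<phi> = f])
    fix x assume "x \<in> verts C"
    then have x: "x \<in> verts Q" "merge x = x" using contract_vertsD by auto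
    show "linear_map K (space Y x) (space Y' x) (f x)" using f(1)[OF x(1)] x(2) by simp
    have "g x (f x y) = y" if "y \<in> carrier (space Y x)" for y
      using lift[OF x(1), of y] that x f(2)[OF x(1)] g(2)[OF x(1)] by auto
    moreover have "f x (g x y) = y" if "y \<in> carrier (space Y' x)" for y
      using lift'[OF x(1), of y] that x f(2)[OF x(1)] g(2)[OF x(1)] by auto
    ultimately show "bij_betw (f x) (carrier (space Y x)) (carrier (space Y' x))"
      using linear_mapD(3)[OF f(1)[OF x(1)]] linear_mapD(3)[OF g(1)[OF x(1)]] x(2)
      by (intro bij_betw_byWitness[where f' = "g x"]) auto
  next
    fix b y assume b: "b \<in> arcs C" and y: "y \<in> carrier (space Y (tail C b))"
    then have b': "b \<in> arcs Q" "b \<noteq> e" by (simp_all add: contract_simps)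
    note tb = tail_in_verts[OF b'(1)] and hb = head_in_verts[OF b'(1)]
    obtain v where v: "D Z (tail Q b) v" "y = \<pi> (tail Q b) v" using lift[OF tb, of y] y by (auto simp: contract_simps)
    have "arrow_map Y b y = \<pi> (head Q b) (arrow_map Z b v)" using P(4)[OF b'(1) v(1)] v(2) b'(2) by simp
    moreover have "\<pi>' (head Q b) (arrow_map Z b v) = arrow_map Y' b (\<pi>' (tail Q b) v)" using P'(4)[OF b'(1) v(1)] b'(2) by simp
    ultimately show "f (head C b) (arrow_map Y b y) = arrow_map Y' b (f (tail C b) y)"
      using f_merge[OF tb v(1)] f_merge[OF hb divisible_arrow[OF v(1) b'(1)]] v(2) by (simp add: contract_simps)
  qed
qed

lemma rep_iso_hom_inverse:
  assumes Z: "is_rep K Q Z" and "rep_iso K Q Z Z'"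
  obtains \<phi> \<psi> where "rep_hom K Q Z Z' \<phi>" "rep_hom K Q Z' Z \<psi>"
    and "\<And>x v. x \<in> verts Q \<Longrightarrow> v \<in> carrier (space Z x) \<Longrightarrow> \<psi> x (\<phi> x v) = v"
    and "\<And>x v. x \<in> verts Q \<Longrightarrow> v \<in> carrier (space Z' x) \<Longrightarrow> \<phi> x (\<psi> x v) = v"
proof -
  obtain \<phi> where \<phi>: "\<And>x. x \<in> verts Q \<Longrightarrow> linear_map K (space Z x) (space Z' x) (\<phi> x)"
    "\<And>x. x \<in> verts Q \<Longrightarrow> bij_betw (\<phi> x) (carrier (space Z x)) (carrier (space Z' x))"
    "\<And>a v. a \<in> arcs Q \<Longrightarrow> v \<in> carrier (space Z (tail Q a)) \<Longrightarrow>
      \<phi> (head Q a) (arrow_map Z a v) = arrow_map Z' a (\<phi> (tail Q a) v)"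
    using assms(2) by (rule rep_isoE) blast
  define \<psi> where "\<psi> x = the_inv_into (carrier (space Z x)) (\<phi> x)" for x
  have l: "\<psi> x (\<phi> x v) = v" if "x \<in> verts Q" "v \<in> carrier (space Z x)" for x v
    unfolding \<psi>_def using the_inv_into_f_f[OF bij_betw_imp_inj_on[OF \<phi>(2)[OF that(1)]] that(2)] .
  have r: "\<phi> x (\<psi> x v) = v" if "x \<in> verts Q" "v \<in> carrier (space Z' x)" for x v
    unfolding \<psi>_def using f_the_inv_into_f_bij_betw[OF \<phi>(2)[OF that(1)]] that(2) by simp
  have lin: "linear_map K (space Z' x) (space Z x) (\<psi> x)" if "x \<in> verts Q" for x
    unfolding \<psi>_def by (rule linear_map_bij_inverse[OF \<phi>(1,2)[OF that]])
  have "\<psi> (head Q a) (arrow_map Z' a w) = arrow_map Z a (\<psi> (tail Q a) w)"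
    if a: "a \<in> arcs Q" and w: "w \<in> carrier (space Z' (tail Q a))" for a w
  proof -
    note ta = tail_in_verts[OF a] and ha = head_in_verts[OF a]
    have v: "\<psi> (tail Q a) w \<in> carrier (space Z (tail Q a))" by (rule linear_mapD(3)[OF lin[OF ta] w])
    have "arrow_map Z' a w = \<phi> (head Q a) (arrow_map Z a (\<psi> (tail Q a) w))" using \<phi>(3)[OF a v] r[OF ta w] by simp
    then show ?thesis using l[OF ha linear_mapD(3)[OF is_repD(2)[OF Z a] v]] by simp
  qed
  then have "rep_hom K Q Z' Z \<psi>" using lin by (simp add: rep_hom_def)
  moreover have "rep_hom K Q Z Z' \<phi>" using \<phi> by (simp add: rep_hom_def)
  ultimately show ?thesis using l r by (rule_tac that)
qed

lemma localization_transport: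
  assumes Z: "is_rep K Q Z" and Z': "is_rep K Q Z'" and iso: "rep_iso K Q Z Z'" and \<pi>: "localization_maps K Z' Y \<pi>"
  obtains \<rho> where "localization_maps K Z Y \<rho>"
proof -
  note P = localization_mapsD[OF \<pi>]
  obtain \<phi> \<psi> where \<phi>: "rep_hom K Q Z Z' \<phi>" and \<psi>: "rep_hom K Q Z' Z \<psi>"
    and l: "\<And>x v. x \<in> verts Q \<Longrightarrow> v \<in> carrier (space Z x) \<Longrightarrow> \<psi> x (\<phi> x v) = v"
    and r: "\<And>x v. x \<in> verts Q \<Longrightarrow> v \<in> carrier (space Z' x) \<Longrightarrow> \<phi> x (\<psi> x v) = v"
    by (rule rep_iso_hom_inverse[OF Z iso]) blast
  note dz = divisible_hom[OF \<phi>] and dz' = divisible_hom[OF \<psi>]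
  have lin: "linear_map K (space Z x) (space Z' x) (\<phi> x)" if "x \<in> verts Q" for x using \<phi> that by (simp add: rep_hom_def)
  have "localization_maps K Z Y (\<lambda>x v. \<pi> x (\<phi> x v))"
  proof (rule localization_mapsI)
    fix x assume x: "x \<in> verts Q"
    note L = linear_mapD[OF lin[OF x]]
    have "linear_map K (D_space Z x) (D_space Z' x) (\<phi> x)"
    proof (rule linear_mapI)
      show "vectorspace K (D_space Z x)" "vectorspace K (D_space Z' x)"
        using fd_space_D_space[OF Z x] fd_space_D_space[OF Z' x] by simp_all
    qed (use L(4,5) dz[OF x] in \<open>simp_all add: divisible_carrier\<close>)
    then show "linear_map K (D_space Z x) (space Y (merge x)) (\<lambda>v. \<pi> x (\<phi> x v))"
      by (rule linear_map_comp[OF _ P(1)[OF x]])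
    have "\<phi> x ` {v. D Z x v} = {v. D Z' x v}"
    proof (intro equalityI subsetI)
      fix w assume "w \<in> {v. D Z' x v}"
      then show "w \<in> \<phi> x ` {v. D Z x v}"
        using dz'[OF x, of w] r[OF x, of w] divisible_carrier[of Q e Z' x w] by (intro image_eqI[of _ _ "\<psi> x w"]) simp_all
    qed (use dz[OF x] in auto)
    then show "(\<lambda>v. \<pi> x (\<phi> x v)) ` {v. D Z x v} = carrier (space Y (merge x))"
      using P(2)[OF x] by (simp add: image_image[symmetric])
    fix v assume v: "D Z x v"
    have "N K Z' x (\<phi> x v) \<longleftrightarrow> N K Z x v"
      using vanishing_hom[OF Z \<phi>, of x v] vanishing_hom[OF Z' \<psi>, of x "\<phi> x v"] l[OF x divisible_carrier[OF v]] by auto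
    then show "\<pi> x (\<phi> x v) = \<zero>\<^bsub>space Y (merge x)\<^esub> \<longleftrightarrow> N K Z x v" using P(3)[OF x dz[OF x v]] by simp
  next
    fix a v assume a: "a \<in> arcs Q" and v: "D Z (tail Q a) v"
    have "\<phi> (head Q a) (arrow_map Z a v) = arrow_map Z' a (\<phi> (tail Q a) v)"
      using \<phi> a divisible_carrier[OF v] by (simp add: rep_hom_def)
    then show "\<pi> (head Q a) (\<phi> (head Q a) (arrow_map Z a v)) = arrow_map (pull Y) a (\<pi> (tail Q a) (\<phi> (tail Q a) v))"
      using P(4)[OF a dz[OF tail_in_verts[OF a] v]] by simp
  qed
  then show ?thesis by (rule that)
qed

lemma rep_hom_sum_components:
  assumes Z: "is_rep K Q Z" and Z': "is_rep K Q Z'"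
  shows "rep_hom K Q (rep_sum Z Z') Z (\<lambda>x. fst)" "rep_hom K Q (rep_sum Z Z') Z' (\<lambda>x. snd)"
    and "rep_hom K Q Z (rep_sum Z Z') (\<lambda>x v. (v, \<zero>\<^bsub>space Z' x\<^esub>))"
    and "rep_hom K Q Z' (rep_sum Z Z') (\<lambda>x v. (\<zero>\<^bsub>space Z x\<^esub>, v))"
  using is_repD[OF Z] is_repD[OF Z'] linear_mapD(6)[OF is_repD(2)[OF Z]] linear_mapD(6)[OF is_repD(2)[OF Z']]
  by (auto simp: rep_hom_def rep_sum_def intro!: linear_map_fst linear_map_snd linear_map_inl linear_map_inr)

text \<open>
  Projections and inclusions of a direct sum are morphisms, and morphisms preserve the
  divisible and the vanishing part. Both parts of a direct sum are therefore the direct sums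
  of the parts of the summands.
\<close>

lemma localization_sum:
  assumes Z: "is_rep K Q Z" and Z': "is_rep K Q Z'"
    and \<pi>: "localization_maps K Z Y \<pi>" and \<pi>': "localization_maps K Z' Y' \<pi>'"
  shows "localization_maps K (rep_sum Z Z') (rep_sum Y Y') (\<lambda>x. map_prod (\<pi> x) (\<pi>' x))"
proof -
  note P = localization_mapsD[OF \<pi>] and P' = localization_mapsD[OF \<pi>'] and S = is_rep_sum[OF Z Z']
  note homs = rep_hom_sum_components[OF Z Z']
  have space: "space (rep_sum Z Z') x = direct_sum (space Z x) (space Z' x)" "space (rep_sum Y Y') x = direct_sum (space Y x) (space Y' x)" for x
    by (simp_all add: rep_sum_def)
  have sum_eq: "(v, \<zero>\<^bsub>space Z' x\<^esub>) \<oplus>\<^bsub>space (rep_sum Z Z') x\<^esub> (\<zero>\<^bsub>space Z x\<^esub>, v') = (v, v')"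
    if "x \<in> verts Q" "v \<in> carrier (space Z x)" "v' \<in> carrier (space Z' x)" for x v v'
    using that vectorspaceD(5,6)[of K "space Z x"] vectorspaceD(5,6)[of K "space Z' x"] is_repD(1)[OF Z that(1)] is_repD(1)[OF Z' that(1)]
    by (simp add: space)
  have D_iff: "D (rep_sum Z Z') x (v, v') \<longleftrightarrow> D Z x v \<and> D Z' x v'" if x: "x \<in> verts Q" for x v v'
  proof
    assume "D (rep_sum Z Z') x (v, v')"
    then show "D Z x v \<and> D Z' x v'" using divisible_hom[OF homs(1) x] divisible_hom[OF homs(2) x] by fastforce
  next
    assume *: "D Z x v \<and> D Z' x v'"
    then have "D (rep_sum Z Z') x (v, \<zero>\<^bsub>space Z' x\<^esub>)" "D (rep_sum Z Z') x (\<zero>\<^bsub>space Z x\<^esub>, v')"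
      using divisible_hom[OF homs(3) x, of v] divisible_hom[OF homs(4) x, of v'] by simp_all
    then have "D (rep_sum Z Z') x ((v, \<zero>\<^bsub>space Z' x\<^esub>) \<oplus>\<^bsub>space (rep_sum Z Z') x\<^esub> (\<zero>\<^bsub>space Z x\<^esub>, v'))"
      using submodule_divisible[OF S x] unfolding submodule_def by simp
    then show "D (rep_sum Z Z') x (v, v')"
      using sum_eq[OF x divisible_carrier[OF conjunct1[OF *]] divisible_carrier[OF conjunct2[OF *]]] by simp
  qed
  have N_iff: "N K (rep_sum Z Z') x (v, v') \<longleftrightarrow> N K Z x v \<and> N K Z' x v'" if x: "x \<in> verts Q" for x v v'
  proof
    assume "N K (rep_sum Z Z') x (v, v')"
    then show "N K Z x v \<and> N K Z' x v'" using vanishing_hom[OF S homs(1)] vanishing_hom[OF S homs(2)] by fastforce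
  next
    assume *: "N K Z x v \<and> N K Z' x v'"
    then have "N K (rep_sum Z Z') x (v, \<zero>\<^bsub>space Z' x\<^esub>)" "N K (rep_sum Z Z') x (\<zero>\<^bsub>space Z x\<^esub>, v')"
      using vanishing_hom[OF Z homs(3), of x v] vanishing_hom[OF Z' homs(4), of x v'] by simp_all
    then have "N K (rep_sum Z Z') x ((v, \<zero>\<^bsub>space Z' x\<^esub>) \<oplus>\<^bsub>space (rep_sum Z Z') x\<^esub> (\<zero>\<^bsub>space Z x\<^esub>, v'))"
      by (rule vanishing.add)
    then show "N K (rep_sum Z Z') x (v, v')"
      using sum_eq[OF x, of v v'] * vanishing_carrier[OF Z] vanishing_carrier[OF Z'] by simp
  qed
  have D_set: "{s. D (rep_sum Z Z') x s} = {v. D Z x v} \<times> {v. D Z' x v}" if "x \<in> verts Q" for x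
    using D_iff[OF that] by auto
  show ?thesis
  proof (rule localization_mapsI)
    fix x assume x: "x \<in> verts Q"
    note L = linear_mapD[OF P(1)[OF x]] and L' = linear_mapD[OF P'(1)[OF x]]
    show "linear_map K (D_space (rep_sum Z Z') x) (space (rep_sum Y Y') (merge x)) (map_prod (\<pi> x) (\<pi>' x))"
    proof (rule linear_mapI)
      show "vectorspace K (D_space (rep_sum Z Z') x)" using fd_space_D_space[OF S x] by simp
      show "vectorspace K (space (rep_sum Y Y') (merge x))" unfolding space by (rule direct_sum_is_vs[OF L(2) L'(2)])
    qed (use L(3-5) L'(3-5) D_iff[OF x] in \<open>auto simp: space\<close>)
    show "map_prod (\<pi> x) (\<pi>' x) ` {s. D (rep_sum Z Z') x s} = carrier (space (rep_sum Y Y') (merge x))"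
      unfolding D_set[OF x] space using P(2)[OF x] P'(2)[OF x] by (simp add: map_prod_surj_on)
    show "map_prod (\<pi> x) (\<pi>' x) s = \<zero>\<^bsub>space (rep_sum Y Y') (merge x)\<^esub> \<longleftrightarrow> N K (rep_sum Z Z') x s"
      if "D (rep_sum Z Z') x s" for s
      using that D_iff[OF x, of "fst s" "snd s"] N_iff[OF x, of "fst s" "snd s"] P(3)[OF x, of "fst s"] P'(3)[OF x, of "snd s"]
      by (cases s) (simp add: space)
  next
    fix a s assume a: "a \<in> arcs Q" and s: "D (rep_sum Z Z') (tail Q a) s"
    have "D Z (tail Q a) (fst s)" "D Z' (tail Q a) (snd s)" using D_iff[OF tail_in_verts[OF a], of "fst s" "snd s"] s by simp_all
    then show "map_prod (\<pi> (head Q a)) (\<pi>' (head Q a)) (arrow_map (rep_sum Z Z') a s) =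
        arrow_map (pull (rep_sum Y Y')) a (map_prod (\<pi> (tail Q a)) (\<pi>' (tail Q a)) s)"
      using P(4)[OF a, of "fst s"] P'(4)[OF a, of "snd s"] unfolding pull_sum by (cases s) (simp add: rep_sum_def)
  qed
qed

text \<open>
  In a pulled back representation \<open>e\<close> acts by the identity: all vectors are
  divisible and only zero vanishes.
\<close>

lemma localization_pull:
  assumes Y: "is_rep K C Y"
  shows "localization_maps K (pull Y) Y (\<lambda>x v. v)"
proof -
  have Z: "is_rep K Q (pull Y)" by (rule is_rep_pull[OF Y])
  have D_pull: "D (pull Y) x v \<longleftrightarrow> v \<in> carrier (space (pull Y) x)" if "x \<in> verts Q" for x v
  proof
    assume v: "v \<in> carrier (space (pull Y) x)"
    show "D (pull Y) x v"
    proof (rule divisible_coinduct[where X = "\<lambda>x v. x \<in> verts Q \<and> v \<in> carrier (space (pull Y) x)"])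
      show "\<exists>u. (tail Q e \<in> verts Q \<and> u \<in> carrier (space (pull Y) (tail Q e))) \<and> arrow_map (pull Y) e u = w"
        if "head Q e \<in> verts Q \<and> w \<in> carrier (space (pull Y) (head Q e))" for w
        using that tail_in_verts[OF e] by (intro exI[of _ w]) (simp add: merge_simps)
    qed (use \<open>x \<in> verts Q\<close> v linear_mapD(3)[OF is_repD(2)[OF Z]] head_in_verts in auto)
  qed (rule divisible_carrier)
  have N_zero: "v = \<zero>\<^bsub>space (pull Y) x\<^esub>" if "N K (pull Y) x v" for x v
    using that
  proof (induction rule: vanishing.induct)
    case (add x v w)
    then have "x \<in> verts Q" using vanishing_carrier[OF Z] by blast
    then show ?case using add.IH vectorspaceD(2,5) is_repD(1)[OF Z] by metis
  next
    case (smult c x v)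
    then have "x \<in> verts Q" using vanishing_carrier[OF Z] by blast
    then show ?case using smult vectorspaceD(7) is_repD(1)[OF Z] by metis
  next
    case (arrow a v)
    then show ?case using linear_mapD(6)[OF is_repD(2)[OF Z arrow.hyps(1)]] by simp
  next
    case (cancel v)
    then show ?case by (simp add: merge_simps)
  qed simp
  show ?thesis
  proof (rule localization_mapsI)
    fix x assume x: "x \<in> verts Q"
    have "{v. D (pull Y) x v} = carrier (space (pull Y) x)" using D_pull[OF x] by auto
    then have eq: "{v. D (pull Y) x v} = carrier (space Y (merge x))" by simp
    have vs: "vectorspace K (space Y (merge x))" using is_repD(1)[OF Z x] by simp
    then show "linear_map K (D_space (pull Y) x) (space Y (merge x)) (\<lambda>v. v)"
      using linear_map_id[OF vs] unfolding eq by simp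
    show "(\<lambda>v. v) ` {v. D (pull Y) x v} = carrier (space Y (merge x))" using eq by simp
    show "v = \<zero>\<^bsub>space Y (merge x)\<^esub> \<longleftrightarrow> N K (pull Y) x v" for v
      using N_zero[of x v] vanishing.zero[OF x, of K e "pull Y"] by auto
  qed simp
qed

text \<open>
  A union over all members of the class and all their localizations; these are isomorphic to
  each other, so it is a union of equal sets.
\<close>

definition localization_class :: "'k ring \<Rightarrow> ('v, 'a, 'k) std_rep set \<Rightarrow> ('v, 'a, 'k) std_rep set" where
  "localization_class K A = (\<Union>Z\<in>A. \<Union>Y\<in>{Y :: ('v, 'a, 'k) std_rep. is_rep K C Y \<and> (\<exists>\<pi>. localization_maps K Z Y \<pi>)}. rep_class K C Y)"

lemma localization_class_rep_class:
  fixes Z :: "('v, 'a, 'k) std_rep" and Y :: "('v, 'a, 'k, 'u) quiver_rep" and K :: "'k ring"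
  assumes Z: "is_rep K Q Z" and Y: "is_rep K C Y" and \<pi>: "localization_maps K Z Y \<pi>"
  shows "localization_class K (rep_class K Q Z) = rep_class K C Y"
proof -
  have eq: "rep_class K C Y' = rep_class K C Y"
    if Z': "Z' \<in> rep_class K Q Z" and Y': "is_rep K C Y'" "localization_maps K Z' Y' \<rho>"
    for Z' Y' :: "('v, 'a, 'k) std_rep" and \<rho>
  proof -
    have Z'R: "is_rep K Q Z'" "rep_iso K Q Z' Z" using Z' by (simp_all add: rep_class_def)
    obtain \<sigma> where "localization_maps K Z' Y \<sigma>" by (rule localization_transport[OF Z'R(1) Z Z'R(2) \<pi>])
    then have "rep_iso K C Y' Y" by (rule localization_unique[OF Y'(2)])
    then show ?thesis using rep_class_eq_iff[OF Q.wf_digraph_axioms Y'(1) Y] by simp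
  qed
  obtain Y0 :: "('v, 'a, 'k) std_rep" and \<rho> where Y0: "is_rep K C Y0" "localization_maps K Z Y0 \<rho>"
    by (rule localization_exists[OF Z])
  have mem: "Z \<in> rep_class K Q Z" using Z by (simp add: rep_class_def rep_iso_refl)
  show ?thesis
  proof (intro equalityI subsetI)
    fix X assume "X \<in> localization_class K (rep_class K Q Z)"
    then obtain Z' Y' :: "('v, 'a, 'k) std_rep" and \<sigma> where
      "Z' \<in> rep_class K Q Z" "is_rep K C Y'" "localization_maps K Z' Y' \<sigma>" "X \<in> rep_class K C Y'"
      by (auto simp: localization_class_def)
    then show "X \<in> rep_class K C Y" using eq by simp
  next
    fix X assume "X \<in> rep_class K C Y"
    then have "X \<in> rep_class K C Y0" using eq[OF mem Y0] by simp
    then show "X \<in> localization_class K (rep_class K Q Z)" unfolding localization_class_def using mem Y0 by blast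
  qed
qed

text \<open>
  The map of classes induced by inverting \<open>e\<close> is additive and a left inverse of
  the pull-back from the contracted quiver.
\<close>

theorem finite_multiplicative_type_contract:
  fixes K :: "'k ring"
  assumes K: "field K" and fin: "finite_multiplicative_type K Q"
  shows "finite_multiplicative_type K C"
proof (rule finite_multiplicative_type_pull_split[OF K fin, where G = "localization_class K"])
  note wfC = Q.wf_digraph_axioms and wfQ = wf_digraph_axioms
  show "localization_class K ` iso_classes K Q \<subseteq> iso_classes K C"
  proof
    fix B assume "B \<in> localization_class K ` iso_classes K Q"
    then obtain A where A: "A \<in> iso_classes K Q" "B = localization_class K A" by blast
    obtain Z :: "('v, 'a, 'k) std_rep" where Z: "is_rep K Q Z" "A = rep_class K Q Z" by (rule iso_classesE[OF A(1)])
    obtain Y :: "('v, 'a, 'k) std_rep" and \<pi> where Y: "is_rep K C Y" "localization_maps K Z Y \<pi>"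
      by (rule localization_exists[OF Z(1)])
    show "B \<in> iso_classes K C"
      using localization_class_rep_class[OF Z(1) Y] rep_class_in_iso_classes[OF wfC Y(1)] A(2) Z(2) by simp
  qed
  show "localization_class K (rep_class K Q (pull Y)) = rep_class K C Y" if Y: "is_rep K C Y" for Y :: "('v, 'a, 'k) std_rep"
    by (rule localization_class_rep_class[OF is_rep_pull[OF Y] Y localization_pull[OF Y]])
  fix A B assume A: "A \<in> iso_classes K Q" and B: "B \<in> iso_classes K Q"
  obtain Z :: "('v, 'a, 'k) std_rep" where Z: "is_rep K Q Z" "A = rep_class K Q Z" by (rule iso_classesE[OF A])
  obtain Z' :: "('v, 'a, 'k) std_rep" where Z': "is_rep K Q Z'" "B = rep_class K Q Z'" by (rule iso_classesE[OF B])
  obtain Y :: "('v, 'a, 'k) std_rep" and \<pi> where Y: "is_rep K C Y" "localization_maps K Z Y \<pi>"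
    by (rule localization_exists[OF Z(1)])
  obtain Y' :: "('v, 'a, 'k) std_rep" and \<pi>' where Y': "is_rep K C Y'" "localization_maps K Z' Y' \<pi>'"
    by (rule localization_exists[OF Z'(1)])
  note S = is_rep_sum[OF Z(1) Z'(1)]
  obtain T :: "('v, 'a, 'k) std_rep" where T: "is_rep K Q T" "rep_iso K Q (rep_sum Z Z') T" by (rule std_rep_exists[OF wfQ S])
  obtain \<rho> where \<rho>: "localization_maps K T (rep_sum Y Y') \<rho>"
    by (rule localization_transport[OF T(1) S rep_iso_sym[OF wfQ S T(2)] localization_sum[OF Z(1) Z'(1) Y(2) Y'(2)]])
  have "class_sum K Q A B = rep_class K Q T"
    using class_sum_rep_class[OF wfQ Z(1) Z'(1)] rep_class_eq_iff[OF wfQ S T(1)] T(2) Z(2) Z'(2) by simp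
  then show "localization_class K (class_sum K Q A B) = class_sum K C (localization_class K A) (localization_class K B)"
    using localization_class_rep_class[OF T(1) is_rep_sum[OF Y(1) Y'(1)] \<rho>] class_sum_rep_class[OF wfC Y(1) Y'(1)]
      localization_class_rep_class[OF Z(1) Y] localization_class_rep_class[OF Z'(1) Y'] Z(2) Z'(2) by simp
qed

end

section \<open>Minors\<close>

lemma contract_loop:
  assumes "tail Q e = head Q e"
  shows "contract_arc Q e = pre_digraph.del_arc Q e"
proof -
  have "(\<lambda>x. if x = head Q e then tail Q e else x) = id" using assms by auto
  then show ?thesis by (simp only: contract_arc_def Let_def pre_digraph.del_arc_def) simp
qed

lemma finite_multiplicative_type_contract_arc:
  assumes K: "field K" and Q: "wf_digraph Q" and e: "e \<in> arcs Q" and fin: "finite_multiplicative_type K Q"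
  shows "wf_digraph (contract_arc Q e) \<and> finite_multiplicative_type K (contract_arc Q e)"
proof (cases "tail Q e = head Q e")
  case True
  then show ?thesis
    using wf_digraph.subgraph_del_arc[OF Q, of e] finite_multiplicative_type_subgraph[OF K _ fin] wf_digraph.wf_digraph_del_arc[OF Q]
    by (simp add: contract_loop)
next
  case False
  interpret nonloop_arrow Q e
    using Q e False by (simp add: nonloop_arrow_def nonloop_arrow_axioms_def quiver_arrow_def quiver_arrow_axioms_def)
  show ?thesis using finite_multiplicative_type_contract[OF K fin] Q.wf_digraph_axioms by blast
qed

lemma finite_multiplicative_type_minor_sequence:
  assumes K: "field K" and Q: "wf_digraph Q" and fin: "finite_multiplicative_type K Q" and "minor_sequence Q P"
  shows "wf_digraph P \<and> finite_multiplicative_type K P"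
  using assms(4)
proof (induction rule: minor_sequence.induct)
  case start
  then show ?case using Q fin by simp
next
  case (remove_vertex P x)
  then show ?case
    using wf_digraph.subgraph_del_vert[of P x] finite_multiplicative_type_subgraph[OF K, of "pre_digraph.del_vert P x" P]
      wf_digraph.wf_digraph_del_vert[of P x] by simp
next
  case (remove_arrow P e)
  then show ?case
    using wf_digraph.subgraph_del_arc[of P e] finite_multiplicative_type_subgraph[OF K, of "pre_digraph.del_arc P e" P]
      wf_digraph.wf_digraph_del_arc[of P e] by simp
next
  case (contract_arrow P e)
  then show ?case using finite_multiplicative_type_contract_arc[OF K, of P e] by simp
qed

theorem proposition53:
  fixes K :: "'k ring"
    and Q :: "('v, 'a) pre_digraph"
    and Q' :: "('w, 'b) pre_digraph"
  assumes "field K"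
    and "fin_digraph Q"
    and "finite_multiplicative_type K Q"
    and "quiver_minor Q' Q"
  shows "finite_multiplicative_type K Q'"
proof -
  obtain P where P: "minor_sequence Q P" "digraph_iso P Q'" using assms(4) unfolding quiver_minor_def by blast
  have "wf_digraph Q" using assms(2) by (rule fin_digraph.axioms(1))
  then have "finite_multiplicative_type K P"
    using finite_multiplicative_type_minor_sequence[OF assms(1) _ assms(3) P(1)] by blast
  then show ?thesis by (rule finite_multiplicative_type_digraph_iso[OF assms(1) P(2)])
qed

end
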